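(* Let $\mathbf p=(p_1,\dots,p_8)$ be eight pairwise distinct points in $\mathbb P^2_{\mathbb C}$. The following are equivalent: (1) three of the points of $\mathbf p$ lie on a line or six of the points of $\mathbf p$ lie on a conic; (2) there is a reducible cubic through $\mathbf p$, i.e. $r_{\mathbf p}>0$; (3) the inclusion $L_{\mathbf p}\cap\mathcal C\subsetneq L_{\mathbf p}\cap\mathcal D$ is strict; (4) counted with multiplicity, there are fewer than $12$ rational cubics through $\mathbf p$, i.e. $d_{\mathbf p}<12$.
   Context: A conic is an irreducible plane quadric. $\mathbb PS^3\mathbb C^3\cong\mathbb P^9$ is the space of plane cubics, $\mathcal D$ is the discriminant hypersurface (of degree 12) of singular cubics, and $\mathcal C\subset\mathcal D$ is the set of rational cubics, i.e. irreducible singular cubics. $L_{\mathbf p}\subset\mathbb PS^3\mathbb C^3$ is the linear space of cubics vanishing at $p_1,\dots,p_8$. (In the paper's notation $L_{\mathbf p}\cap\mathcal C=\pi^{-1}(\mathbf p)$ and $L_{\mathbf p}\cap\mathcal D=\overline\pi^{-1}(\mathbf p)$.) Define $d_{\mathbf p}=\sum_{C\in L_{\mathbf p}\cap\mathcal C}\mathrm{imult}_C(L_{\mathbf p},\mathcal D)$, where $\mathrm{imult}_C$ is the intersection multiplicity at $C$ (if $L_{\mathbf p}\cap\mathcal C\neq\emptyset$ then $L_{\mathbf p}$ is a line meeting $\mathcal D$ in finitely many points; the empty sum is $0$). If $L_{\mathbf p}\cap\mathcal D$ is finite, define $r_{\mathbf p}=\sum_{C\in (L_{\mathbf p}\cap\mathcal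 D)\setminus\mathcal C}\mathrm{imult}_C(L_{\mathbf p},\mathcal D)$ (the sum over reducible cubics through $\mathbf p$); otherwise $r_{\mathbf p}=\infty$. *)

theory Defs
  imports
    "HOL-Analysis.Analysis"
    "HOL-Library.Poly_Mapping"
    "HOL-Library.Extended_Nat"
    "HOL-Computational_Algebra.Computational_Algebra"
begin

section \<open>Ternary forms\<close>

(* The polynomial ring C[x_0, x_1, x_2]: a monomial is its exponent vector 3 => nat. *)
type_synonym tpoly = "(3 \<Rightarrow>\<^sub>0 nat) \<Rightarrow>\<^sub>0 complex"

(* The vector space S^d(C^3), including the zero form. *)
definition forms :: "nat \<Rightarrow> tpoly set" where
  "forms d = {F. \<forall>m \<in> Poly_Mapping.keys F. (\<Sum>i\<in>UNIV. Poly_Mapping.lookup m i) = d}"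

definition tpoly_eval :: "tpoly \<Rightarrow> complex ^ 3 \<Rightarrow> complex" where
  "tpoly_eval F x =
     (\<Sum>m \<in> Poly_Mapping.keys F.
        Poly_Mapping.lookup F m * (\<Prod>i\<in>UNIV. (x $ i) ^ Poly_Mapping.lookup m i))"

(* The truncated subtraction of exponents is harmless: its coefficient is then 0. *)
definition pd :: "3 \<Rightarrow> tpoly \<Rightarrow> tpoly" where
  "pd i F =
     (\<Sum>m \<in> Poly_Mapping.keys F.
        Poly_Mapping.single (m - Poly_Mapping.single i 1)
          (of_nat (Poly_Mapping.lookup m i) * Poly_Mapping.lookup F m))"

definition smul :: "complex \<Rightarrow> tpoly \<Rightarrow> tpoly" where
  "smul c F = Poly_Mapping.single 0 c * F"


section \<open>Projective points\<close>

(* A point of a projective space is the set of all its (nonzero) representatives. *)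

definition plane_points :: "(complex ^ 3) set set" where
  "plane_points = {{c *s v | c. c \<noteq> 0} | v. v \<noteq> 0}"

definition cubic_class :: "tpoly \<Rightarrow> tpoly set" where
  "cubic_class F = {smul c F | c. c \<noteq> 0}"

definition vanishes_at :: "tpoly \<Rightarrow> (complex ^ 3) set \<Rightarrow> bool" where
  "vanishes_at F p \<longleftrightarrow> (\<forall>x\<in>p. tpoly_eval F x = 0)"


section \<open>Singular and rational cubics\<close>

definition singular_form :: "tpoly \<Rightarrow> bool" where
  "singular_form F \<longleftrightarrow>
     (\<exists>x. x \<noteq> 0 \<and> tpoly_eval F x = 0 \<and> (\<forall>i. tpoly_eval (pd i F) x = 0))"

(* Singular cubics may be reducible or non-reduced. *)
definition singular_cubics :: "tpoly set set" where
  "singular_cubics = {cubic_class F | F. F \<in> forms 3 \<and> F \<noteq> 0 \<and> singular_form F}"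

definition rational_cubics :: "tpoly set set" where
  "rational_cubics =
     {cubic_class F | F. F \<in> forms 3 \<and> F \<noteq> 0 \<and> irreducible F \<and> singular_form F}"

definition cubics_through :: "(nat \<Rightarrow> (complex ^ 3) set) \<Rightarrow> tpoly set set" where
  "cubics_through p =
     {cubic_class F | F. F \<in> forms 3 \<and> F \<noteq> 0 \<and> (\<forall>i\<in>{1..8}. vanishes_at F (p i))}"


section \<open>The discriminant and intersection multiplicities\<close>

definition hessian :: "tpoly \<Rightarrow> tpoly" where
  "hessian F = det (\<chi> i j. pd i (pd j F))"

(* The six quadratic monomials: the squares, and the products x_{j+1} x_{j+2}
   (indices modulo 3, as in the arithmetic of the type 3). *)
definition quad_monom :: "3 + 3 \<Rightarrow> (3 \<Rightarrow>\<^sub>0 nat)" where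
  "quad_monom s = (case s of
     Inl j \<Rightarrow> Poly_Mapping.single j 2
   | Inr j \<Rightarrow> Poly_Mapping.single (j + 1) 1 + Poly_Mapping.single (j + 2) 1)"

(* The discriminant of a ternary cubic is, up to a nonzero constant, the resultant of its three
   partial derivatives.  By Sylvester's formula the resultant of three ternary quadrics is, up to
   a nonzero constant, the 6 x 6 determinant of the coefficients of the quadrics and of the
   partial derivatives of their Jacobian determinant, which here is the Hessian of F.  The result
   has degree 3 * 1 + 3 * 3 = 12 in the coefficients of F; it is the irreducible (in particular
   reduced) equation of the hypersurface of singular cubics. *)
definition discriminant :: "tpoly \<Rightarrow> complex" where
  "discriminant F = det ((\<chi> r s.
     Poly_Mapping.lookup
       (case r of Inl i \<Rightarrow> pd i F | Inr i \<Rightarrow> pd i (hessian F))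
       (quad_monom s)) :: complex ^ (3 + 3) ^ (3 + 3))"

(* The pullback of a polynomial function on cubics along t |-> F + t G, as a polynomial in t. *)
definition pencil_poly :: "(tpoly \<Rightarrow> complex) \<Rightarrow> tpoly \<Rightarrow> tpoly \<Rightarrow> complex poly" where
  "pencil_poly \<Phi> F G = (THE q. \<forall>t. poly q t = \<Phi> (F + smul t G))"

(* imult \<Phi> L C is the intersection multiplicity at C of the projective line L with the
   hypersurface \<Phi> = 0, for a homogeneous polynomial function \<Phi> not vanishing identically
   on L: the order of vanishing at t = 0 of \<Phi> (F + t G), where F represents C and G
   represents any other point of L.  It does not depend on these choices. *)
definition imult :: "(tpoly \<Rightarrow> complex) \<Rightarrow> tpoly set set \<Rightarrow> tpoly set \<Rightarrow> nat" where
  "imult \<Phi> L C =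
     order 0 (pencil_poly \<Phi> (SOME F. F \<in> C) (SOME G. G \<in> \<Union> (L - {C})))"

definition d_mult :: "(nat \<Rightarrow> (complex ^ 3) set) \<Rightarrow> nat" where
  "d_mult p = (\<Sum>C \<in> cubics_through p \<inter> rational_cubics.
     imult discriminant (cubics_through p) C)"

definition r_mult :: "(nat \<Rightarrow> (complex ^ 3) set) \<Rightarrow> enat" where
  "r_mult p =
     (if finite (cubics_through p \<inter> singular_cubics)
      then enat (\<Sum>C \<in> (cubics_through p \<inter> singular_cubics) - rational_cubics.
                   imult discriminant (cubics_through p) C)
      else \<infinity>)"


section \<open>Special position\<close>

definition three_on_line :: "(nat \<Rightarrow> (complex ^ 3) set) \<Rightarrow> bool" where
  "three_on_line p \<longleftrightarrow>
     (\<exists>I \<subseteq> {1..8}. card I = 3 \<and>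
        (\<exists>l \<in> forms 1. l \<noteq> 0 \<and> (\<forall>i\<in>I. vanishes_at l (p i))))"

definition six_on_conic :: "(nat \<Rightarrow> (complex ^ 3) set) \<Rightarrow> bool" where
  "six_on_conic p \<longleftrightarrow>
     (\<exists>I \<subseteq> {1..8}. card I = 6 \<and>
        (\<exists>Q \<in> forms 2. irreducible Q \<and> (\<forall>i\<in>I. vanishes_at Q (p i))))"

definition reducible_cubic_through :: "(nat \<Rightarrow> (complex ^ 3) set) \<Rightarrow> bool" where
  "reducible_cubic_through p \<longleftrightarrow>
     (\<exists>F \<in> forms 3. F \<noteq> 0 \<and> \<not> irreducible F \<and> (\<forall>i\<in>{1..8}. vanishes_at F (p i)))"

end

theory Submission
  imports Defs "HOL-Computational_Algebra.Field_as_Ring"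
begin

text \<open>A cubic \<open>F\<close> is handled through its symmetric trilinear form \<open>tri F\<close>. If the \<open>6 \<times> 6\<close> determinant
  vanishes, a linear relation between its rows yields a linear vector field tangent to the cubic. A
  nonzero one is nilpotent unless the cubic is singular, and a nilpotent one produces a singular
  point as well.

  A reducible cubic consists of a line and a conic, and eight points on it have three on the line or
  six on the conic; conversely the points left over by such a line or conic lie on a complementary
  conic or line. If some member of the linear system is irreducible, then the points impose
  independent conditions (remove lines until only conics through five points are left), so the
  system is a pencil.

  Not all members of this pencil are singular: near an irreducible member the singular points would
  be base points (a limit argument), hence among the eight points by the bound on common points, so
  two members and therefore all would be singular at the same base point, which again contradicts
  the bound. Hence the discriminant is a nonzero binary form of degree 12 on the pencil, the
  multiplicities of the singular members add up to 12, and the rational ones account for all of them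
  exactly when no member is reducible. If all members are reducible, there are no rational
  cubics and infinitely many singular ones.\<close>

no_notation fps_nth (infixl \<open>$\<close> 75)

section \<open>Algebra of ternary forms\<close>

text \<open>The \<open>discriminant\<close> is an explicit determinant, so it has to be proved that
  its zeros are the singular cubics. A row relation reads
  \<open>tri F x x a + tri (hessian F) x x b = 0\<close>; tangent linear fields help because a
  smooth cubic has no infinitesimal linear symmetry. For the converse, a singular point of a cubic
  is singular on its Hessian too. The bounds on common points exceed the Bezout number 9 of two
  cubics: a double point of one cubic on the other counts at least 2, a common double point at least
  4, so 8 or 7 further common points are too many unless the cubics are proportional. Irreducibility
  is hard to follow through limits; \<open>no_line\<close> replaces it, since a reducible plane
  cubic contains a line and lines have limits. The affine parameter of a pencil misses one member.
  This member is chosen nonsingular, so that all twelve zeros of the discriminant are finite. The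
  final equivalences rest on each singular member having positive multiplicity.\<close>

definition mdeg :: "(3 \<Rightarrow>\<^sub>0 nat) \<Rightarrow> nat" where
  "mdeg m = (\<Sum>i\<in>UNIV. Poly_Mapping.lookup m i)"

lemma mdeg_add: "mdeg (m + n) = mdeg m + mdeg n"
  by (simp add: mdeg_def lookup_add sum.distrib)

lemma tpoly_induct [case_names single add]:
  fixes F :: tpoly
  assumes "\<And>m c. P (Poly_Mapping.single m c)"
    and "\<And>F G. P F \<Longrightarrow> P G \<Longrightarrow> P (F + G)"
  shows "P F"
proof (induction F rule: update_induct)
  case const
  then show ?case using assms(1)[of 0 0] by simp
next
  case (update F m c)
  have "Poly_Mapping.update m c F = F + Poly_Mapping.single m c"
  proof (rule poly_mapping_eqI)
    fix k
    have "Poly_Mapping.lookup F m = 0" using update(1) by (simp add: in_keys_iff)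
    then show "Poly_Mapping.lookup (Poly_Mapping.update m c F) k =
        Poly_Mapping.lookup (F + Poly_Mapping.single m c) k"
      by (auto simp: lookup_update lookup_add lookup_single when_def)
  qed
  then show ?case using update assms by simp
qed

lemma forms_iff: "F \<in> forms d \<longleftrightarrow> (\<forall>m. Poly_Mapping.lookup F m \<noteq> 0 \<longrightarrow> mdeg m = d)"
  by (auto simp: forms_def mdeg_def in_keys_iff)

lemma forms_zero [simp]: "0 \<in> forms d"
  by (simp add: forms_iff)

lemma forms_add: "F \<in> forms d \<Longrightarrow> G \<in> forms d \<Longrightarrow> F + G \<in> forms d"
  unfolding forms_iff lookup_add by (metis add.right_neutral)

lemma forms_uminus: "F \<in> forms d \<Longrightarrow> - F \<in> forms d"
  by (simp add: forms_iff)

lemma forms_diff: "F \<in> forms d \<Longrightarrow> G \<in> forms d \<Longrightarrow> F - G \<in> forms d"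
  using forms_add[OF _ forms_uminus] by fastforce

lemma forms_sum: "(\<And>i. i \<in> A \<Longrightarrow> f i \<in> forms d) \<Longrightarrow> sum f A \<in> forms d"
  by (induction A rule: infinite_finite_induct) (auto intro: forms_add)

lemma single_in_forms: "mdeg m = d \<Longrightarrow> Poly_Mapping.single m c \<in> forms d"
  by (auto simp: forms_iff lookup_single when_def)

text \<open>Splitting a monomial off a form leaves a form of the same degree, so both summands in
  the \<open>add\<close> case may be taken in \<open>forms d\<close>.\<close>

lemma forms_induct [consumes 1, case_names single add]:
  assumes "F \<in> forms d"
    and "\<And>m c. mdeg m = d \<Longrightarrow> P (Poly_Mapping.single m c)"
    and "\<And>F G. F \<in> forms d \<Longrightarrow> G \<in> forms d \<Longrightarrow> P F \<Longrightarrow> P G \<Longrightarrow> P (F + G)"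
  shows "P F"
proof -
  have "mdeg (Poly_Mapping.single 0 d) = d"
    by (simp add: mdeg_def lookup_single when_def)
  then have P0: "P 0" using assms(2)[of _ 0] by fastforce
  have "F \<in> forms d \<longrightarrow> P F"
  proof (induction F rule: update_induct)
    case const then show ?case using P0 by simp
  next
    case (update F m c)
    have z: "Poly_Mapping.lookup F m = 0" using update(1) by (simp add: in_keys_iff)
    have e: "Poly_Mapping.update m c F = F + Poly_Mapping.single m c"
      by (rule poly_mapping_eqI) (use z in \<open>auto simp: lookup_update lookup_add lookup_single when_def\<close>)
    show ?case
    proof
      assume u: "Poly_Mapping.update m c F \<in> forms d"
      have m: "mdeg m = d" using u update(2) by (auto simp: forms_iff lookup_update)
      have F: "F \<in> forms d" unfolding forms_iff
      proof (intro allI impI)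
        fix k assume k: "Poly_Mapping.lookup F k \<noteq> 0"
        then have "k \<noteq> m" using z by auto
        then show "mdeg k = d" using u k by (auto simp: forms_iff lookup_update)
      qed
      show "P (Poly_Mapping.update m c F)"
        unfolding e using assms(3)[OF F single_in_forms[OF m]] F update(3) assms(2)[OF m] by blast
    qed
  qed
  then show ?thesis using assms(1) by blast
qed

lemma forms_mult:
  assumes "F \<in> forms d" "G \<in> forms e"
  shows "F * G \<in> forms (d + e)"
  using assms(1)
proof (induction rule: forms_induct)
  case (single m c)
  show ?case using assms(2)
    by (induction rule: forms_induct)
      (auto simp: mult_single distrib_left single mdeg_add intro!: single_in_forms forms_add)
qed (auto simp: distrib_right intro: forms_add)

lemma lookup_smul [simp]: "Poly_Mapping.lookup (smul c F) m = c * Poly_Mapping.lookup F m"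
  unfolding smul_def
  by (induction F rule: tpoly_induct)
    (auto simp: mult_single lookup_single when_def lookup_add distrib_left)

lemma smul_add: "smul c (F + G) = smul c F + smul c G"
  and smul_add_left: "smul (a + b) F = smul a F + smul b F"
  and smul_smul [simp]: "smul a (smul b F) = smul (a * b) F"
  and smul_one [simp]: "smul 1 F = F"
  and smul_zero [simp]: "smul 0 F = 0"
  and smul_zero_right [simp]: "smul c 0 = 0"
  and smul_diff: "smul c (F - G) = smul c F - smul c G"
  by (rule poly_mapping_eqI; simp add: lookup_add lookup_minus algebra_simps)+

lemma smul_mult_left: "smul c F * G = smul c (F * G)"
  and smul_mult_right: "F * smul c G = smul c (F * G)"
  by (simp_all add: smul_def mult_ac)

lemma smul_eq_0_iff [simp]: "smul c F = 0 \<longleftrightarrow> c = 0 \<or> F = 0"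
  by (auto simp: poly_mapping_eq_iff fun_eq_iff)

lemma forms_smul: "F \<in> forms d \<Longrightarrow> smul c F \<in> forms d"
  by (simp add: forms_iff)

subsection \<open>Evaluation\<close>

lemma tpoly_eval_add [simp]: "tpoly_eval (F + G) x = tpoly_eval F x + tpoly_eval G x"
  unfolding tpoly_eval_def
  by (rule setsum_keys_plus_distrib) (auto simp: distrib_right)

lemma tpoly_eval_single:
  "tpoly_eval (Poly_Mapping.single m c) x = c * (\<Prod>i\<in>UNIV. (x $ i) ^ Poly_Mapping.lookup m i)"
  by (simp add: tpoly_eval_def)

lemma tpoly_eval_mult [simp]: "tpoly_eval (F * G) x = tpoly_eval F x * tpoly_eval G x"
proof (induction F rule: tpoly_induct)
  case (single m c)
  show ?case
    by (induction G rule: tpoly_induct)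
      (simp_all add: mult_single tpoly_eval_single distrib_left lookup_add power_add prod.distrib)
qed (simp add: distrib_right)

lemma tpoly_eval_0 [simp]: "tpoly_eval 0 x = 0"
  by (simp add: tpoly_eval_def)

lemma tpoly_eval_const [simp]: "tpoly_eval (Poly_Mapping.single 0 c) x = c"
  by (simp add: tpoly_eval_single)

lemma tpoly_eval_1 [simp]: "tpoly_eval 1 x = 1"
  using tpoly_eval_const[of 1] by simp

lemma tpoly_eval_smul [simp]: "tpoly_eval (smul c F) x = c * tpoly_eval F x"
  by (simp add: smul_def)

lemma tpoly_eval_uminus [simp]: "tpoly_eval (- F) x = - tpoly_eval F x"
  using tpoly_eval_add[of F "- F" x] by (simp add: eq_neg_iff_add_eq_0 add.commute)

lemma tpoly_eval_diff [simp]: "tpoly_eval (F - G) x = tpoly_eval F x - tpoly_eval G x"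
  using tpoly_eval_add[of F "- G" x] by simp

lemma tpoly_eval_sum: "tpoly_eval (sum f A) x = (\<Sum>i\<in>A. tpoly_eval (f i) x)"
  by (induction A rule: infinite_finite_induct) auto

lemma tpoly_eval_prod: "tpoly_eval (prod f A) x = (\<Prod>i\<in>A. tpoly_eval (f i) x)"
  by (induction A rule: infinite_finite_induct) auto

lemma tpoly_eval_power: "tpoly_eval (F ^ n) x = tpoly_eval F x ^ n"
  by (induction n) auto

lemma tpoly_eval_scale:
  "F \<in> forms d \<Longrightarrow> tpoly_eval F (c *s x) = c ^ d * tpoly_eval F x"
  by (induction rule: forms_induct)
    (auto simp: tpoly_eval_single distrib_left power_mult_distrib prod.distrib
      mdeg_def power_sum)

lemma prod_3: "prod f (UNIV::3 set) = f 1 * f 2 * f (3::3)"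
  unfolding UNIV_3 by (simp add: mult_ac)

lemma mdeg_3: "mdeg m = Poly_Mapping.lookup m 1 + Poly_Mapping.lookup m 2 + Poly_Mapping.lookup m 3"
  by (simp add: mdeg_def sum_3)

lemma monomial_eqI:
  assumes "Poly_Mapping.lookup m 1 = Poly_Mapping.lookup n 1"
    "Poly_Mapping.lookup m 2 = Poly_Mapping.lookup n 2"
    "Poly_Mapping.lookup m 3 = Poly_Mapping.lookup n (3::3)"
  shows "m = n"
  by (rule poly_mapping_eqI) (metis assms exhaust_3)

text \<open>Kronecker substitution \<open>(t, t\<^sup>N, t\<^bsup>N\<^sup>2\<^esup>)\<close> separates the monomials of \<open>F\<close>
  once \<open>N\<close> exceeds their degrees.\<close>

lemma tpoly_eq_0:
  assumes "\<And>x. tpoly_eval F x = 0"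
  shows "F = 0"
proof -
  define N where "N = Suc (\<Sum>m\<in>Poly_Mapping.keys F. mdeg m)"
  define w where "w m = Poly_Mapping.lookup m 1 + N * (Poly_Mapping.lookup m 2 + N * Poly_Mapping.lookup m (3::3))" for m
  have lt: "Poly_Mapping.lookup m i < N" if "m \<in> Poly_Mapping.keys F" for m and i :: 3
  proof -
    have "mdeg m \<le> (\<Sum>m\<in>Poly_Mapping.keys F. mdeg m)"
      by (rule member_le_sum) (use that in auto)
    moreover have "Poly_Mapping.lookup m i \<le> mdeg m"
      unfolding mdeg_def by (rule member_le_sum) auto
    ultimately show ?thesis by (simp add: N_def)
  qed
  have inj: "inj_on w (Poly_Mapping.keys F)"
  proof (rule inj_onI)
    fix m n assume m: "m \<in> Poly_Mapping.keys F" and n: "n \<in> Poly_Mapping.keys F" and e: "w m = w n"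
    \<comment> \<open>The exponents of \<open>m\<close> are the base-\<open>N\<close> digits of
      \<open>w m\<close>; reduction modulo \<open>N\<close> reads off the lowest one.\<close>
    have 1: "Poly_Mapping.lookup m 1 = Poly_Mapping.lookup n 1"
      using arg_cong[OF e, of "\<lambda>k. k mod N"] lt[OF m, of 1] lt[OF n, of 1] by (simp add: w_def)
    then have e2: "Poly_Mapping.lookup m 2 + N * Poly_Mapping.lookup m 3 =
        Poly_Mapping.lookup n 2 + N * Poly_Mapping.lookup n 3"
      using e unfolding w_def 1 by (metis add_left_cancel mult_cancel1 N_def nat.distinct(1))
    have 2: "Poly_Mapping.lookup m 2 = Poly_Mapping.lookup n 2"
      using arg_cong[OF e2, of "\<lambda>k. k mod N"] lt[OF m, of 2] lt[OF n, of 2] by simp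
    have "Poly_Mapping.lookup m 3 = Poly_Mapping.lookup n 3"
      using e2 unfolding 2 by (metis add_left_cancel mult_cancel1 N_def nat.distinct(1))
    with 1 2 show "m = n" by (rule monomial_eqI)
  qed
  define P where "P = (\<Sum>m\<in>Poly_Mapping.keys F. monom (Poly_Mapping.lookup F m) (w m))"
  have "poly P t = tpoly_eval F (\<chi> i. if i = 1 then t else if i = 2 then t ^ N else t ^ (N * N))" for t
    unfolding P_def poly_sum tpoly_eval_def
    by (intro sum.cong refl)
      (simp add: poly_monom prod_3 w_def power_add power_mult distrib_left mult_ac)
  then have "P = 0" using assms poly_all_0_iff_0[of P] by simp
  have "Poly_Mapping.lookup F m = 0" if m: "m \<in> Poly_Mapping.keys F" for m
  proof -
    have "coeff P (w m) = (\<Sum>n\<in>Poly_Mapping.keys F. if n = m then Poly_Mapping.lookup F n else 0)"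
      unfolding P_def coeff_sum using inj m
      by (intro sum.cong refl) (auto simp: inj_on_def)
    also have "\<dots> = Poly_Mapping.lookup F m" using m by simp
    finally show ?thesis using \<open>P = 0\<close> by simp
  qed
  then show ?thesis by (metis in_keys_iff poly_mapping_eqI lookup_zero)
qed

lemma tpoly_eqI: "(\<And>x. tpoly_eval F x = tpoly_eval G x) \<Longrightarrow> F = G"
  using tpoly_eq_0[of "F - G"] by simp

subsection \<open>Derivatives\<close>

lemma pd_add: "pd i (F + G) = pd i F + pd i G"
  unfolding pd_def
  by (rule setsum_keys_plus_distrib) (auto simp: distrib_left single_add)

lemma pd_single:
  "pd i (Poly_Mapping.single m c) =
     Poly_Mapping.single (m - Poly_Mapping.single i 1) (of_nat (Poly_Mapping.lookup m i) * c)"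
  by (simp add: pd_def)

lemma pd_smul: "pd i (smul c F) = smul c (pd i F)"
  by (induction F rule: tpoly_induct)
    (simp_all add: pd_add pd_single smul_add, simp add: smul_def mult_single pd_single mult_ac)

lemma pd_commute: "pd i (pd j F) = pd j (pd i F)"
proof (induction F rule: tpoly_induct)
  case (single m c)
  have 1: "m - Poly_Mapping.single j (Suc 0) - Poly_Mapping.single i (Suc 0) = m - Poly_Mapping.single i (Suc 0) - Poly_Mapping.single j (Suc 0)"
    by (rule poly_mapping_eqI) (simp add: lookup_minus)
  show ?case
    by (cases "i = j") (simp_all add: pd_single 1 lookup_minus lookup_single when_def mult_ac)
qed (simp add: pd_add)

lemma pd_forms: "F \<in> forms (Suc d) \<Longrightarrow> pd i F \<in> forms d"
proof (induction rule: forms_induct)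
  case (single m c)
  show ?case
  proof (cases "Poly_Mapping.lookup m i = 0")
    case False
    have "m = (m - Poly_Mapping.single i 1) + Poly_Mapping.single i 1"
      by (rule poly_mapping_eqI) (use False in \<open>auto simp: lookup_add lookup_minus lookup_single when_def\<close>)
    then have "mdeg m = mdeg (m - Poly_Mapping.single i 1) + mdeg (Poly_Mapping.single i 1)"
      by (metis mdeg_add)
    moreover have "mdeg (Poly_Mapping.single i 1) = 1"
      by (simp add: mdeg_def lookup_single when_def)
    ultimately show ?thesis using single by (simp add: pd_single single_in_forms)
  qed (simp add: pd_single)
qed (auto simp: pd_add intro: forms_add)

lemma euler:
  assumes "F \<in> forms d"
  shows "(\<Sum>i\<in>UNIV. x $ i * tpoly_eval (pd i F) x) = of_nat d * tpoly_eval F x"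
  using assms
proof (induction rule: forms_induct)
  case (single m c)
  have "x $ i * tpoly_eval (pd i (Poly_Mapping.single m c)) x =
      of_nat (Poly_Mapping.lookup m i) * tpoly_eval (Poly_Mapping.single m c) x" for i
  proof (cases "Poly_Mapping.lookup m i = 0")
    case False
    have "(\<Prod>j\<in>UNIV. (x $ j) ^ Poly_Mapping.lookup m j) =
        x $ i * (\<Prod>j\<in>UNIV. (x $ j) ^ Poly_Mapping.lookup (m - Poly_Mapping.single i 1) j)"
      (is "?l = _ * ?r")
    proof -
      have "?l = x $ i ^ Poly_Mapping.lookup m i * (\<Prod>j\<in>UNIV - {i}. (x $ j) ^ Poly_Mapping.lookup m j)"
        by (subst prod.remove[of _ i]) auto
      moreover have "?r = x $ i ^ (Poly_Mapping.lookup m i - 1) * (\<Prod>j\<in>UNIV - {i}. (x $ j) ^ Poly_Mapping.lookup m j)"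
        by (subst prod.remove[of _ i]) (auto simp: lookup_minus lookup_single when_def intro!: prod.cong)
      moreover have "x $ i ^ Poly_Mapping.lookup m i = x $ i * x $ i ^ (Poly_Mapping.lookup m i - 1)"
        using False by (cases "Poly_Mapping.lookup m i") auto
      ultimately show ?thesis by (simp add: mult_ac)
    qed
    then show ?thesis by (simp add: pd_single tpoly_eval_single mult_ac)
  qed (simp add: pd_single)
  then have "(\<Sum>i\<in>UNIV. x $ i * tpoly_eval (pd i (Poly_Mapping.single m c)) x) =
     (\<Sum>i\<in>UNIV. of_nat (Poly_Mapping.lookup m i)) * tpoly_eval (Poly_Mapping.single m c) x"
    by (simp add: sum_distrib_right)
  then show ?case using single by (simp add: mdeg_def flip: of_nat_sum)
qed (simp add: pd_add distrib_left sum.distrib)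

lemma forms_0_const: "F \<in> forms 0 \<Longrightarrow> F = Poly_Mapping.single 0 (tpoly_eval F x)"
proof (induction rule: forms_induct)
  case (single m c)
  then have "m = 0" by (intro monomial_eqI) (auto simp: mdeg_3)
  then show ?case by simp
qed (simp add: single_add)

subsection \<open>Factors of forms\<close>

text \<open>The grading, as a ring homomorphism \<open>F \<mapsto> \<Sum> F\<^sub>d T\<^sup>d\<close> into polynomials over
  the ring of ternary polynomials.\<close>

definition graded :: "tpoly \<Rightarrow> tpoly poly" where
  "graded F = (\<Sum>m\<in>Poly_Mapping.keys F. monom (Poly_Mapping.single m (Poly_Mapping.lookup F m)) (mdeg m))"

lemma graded_add: "graded (F + G) = graded F + graded G"
  unfolding graded_def
  by (rule setsum_keys_plus_distrib) (auto simp: single_add add_monom)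

lemma graded_single: "graded (Poly_Mapping.single m c) = monom (Poly_Mapping.single m c) (mdeg m)"
  by (simp add: graded_def)

lemma graded_mult: "graded (F * G) = graded F * graded G"
proof (induction F rule: tpoly_induct)
  case (single m c)
  show ?case
    by (induction G rule: tpoly_induct)
      (auto simp: mult_single graded_single graded_add mult_monom mdeg_add distrib_left)
qed (simp add: graded_add distrib_right)

lemma lookup_graded:
  "Poly_Mapping.lookup (coeff (graded F) k) m = (if mdeg m = k then Poly_Mapping.lookup F m else 0)"
  by (induction F rule: tpoly_induct)
    (auto simp: graded_single graded_add lookup_add lookup_single when_def)

lemma graded_eq_monom_iff: "graded F = monom F d \<longleftrightarrow> F \<in> forms d"
proof
  assume *: "graded F = monom F d"
  show "F \<in> forms d"
    unfolding forms_iff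
  proof (intro allI impI)
    fix m assume m: "Poly_Mapping.lookup F m \<noteq> 0"
    have "coeff (graded F) (mdeg m) \<noteq> 0"
      using m lookup_graded[of F "mdeg m" m] by force
    then show "mdeg m = d" unfolding * by (auto split: if_splits)
  qed
next
  assume "F \<in> forms d"
  then show "graded F = monom F d"
    by (intro poly_eqI poly_mapping_eqI) (auto simp: lookup_graded forms_iff)
qed

text \<open>All homogeneous components of \<open>F\<close> outside degree \<open>d\<close> vanish,
  so the single coefficient \<open>c\<close> is already the whole of \<open>F\<close>.\<close>

lemma graded_eq_monomD:
  assumes "graded F = monom c d"
  shows "c = F"
proof (rule poly_mapping_eqI)
  fix m
  have 1: "Poly_Mapping.lookup c m = (if mdeg m = d then Poly_Mapping.lookup F m else 0)"
    unfolding lookup_graded[symmetric] by (simp only: assms coeff_monom if_True simp_thms)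
  have "Poly_Mapping.lookup (coeff (monom c d) (mdeg m)) m = Poly_Mapping.lookup F m"
    unfolding assms[symmetric] by (simp only: lookup_graded if_True simp_thms)
  then show "Poly_Mapping.lookup c m = Poly_Mapping.lookup F m"
    using 1 by (cases "mdeg m = d") simp_all
qed

lemma graded_neq_0: "F \<noteq> 0 \<Longrightarrow> graded F \<noteq> 0"
  using graded_eq_monomD[of F 0 0] by auto

text \<open>The order at 0 is the lowest exponent that occurs and the degree the highest; if they
  coincide, one term is left.\<close>

lemma poly_eq_monom_if_order_eq_degree:
  fixes p :: "'a::idom poly"
  assumes "p \<noteq> 0" "order 0 p = degree p"
  shows "\<exists>c. p = monom c (degree p)"
proof -
  have "monom 1 (order 0 p) dvd p"
    by (simp add: monom_1_dvd_iff assms(1))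
  then obtain q where q: "p = monom 1 (degree p) * q" using assms(2) by (auto elim: dvdE)
  have "q \<noteq> 0" using assms(1) q by auto
  then have "degree p = degree (monom (1::'a) (degree p)) + degree q"
    by (subst q, subst degree_mult_eq) auto
  then have "degree q = 0" by (simp add: degree_monom_eq)
  then obtain c where "q = [:c:]" by (auto elim: degree_eq_zeroE)
  then have "p = monom c (degree p)" by (subst q) (simp add: smult_monom)
  then show ?thesis by blast
qed

text \<open>In \<open>graded A * graded B = monom F d\<close> the degrees add up to
  \<open>d\<close>, and so do the orders at 0. As an order never exceeds the degree, the two agree
  for each factor, which is therefore concentrated in one degree.\<close>

lemma factor_of_form:
  assumes "F \<in> forms d" "F \<noteq> 0" "F = A * B"
  obtains k where "k \<le> d" "A \<in> forms k" "B \<in> forms (d - k)"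
proof -
  have nz: "A \<noteq> 0" "B \<noteq> 0" using assms by auto
  have pr: "graded A * graded B = monom F d"
    using assms graded_eq_monom_iff graded_mult by metis
  have gnz: "graded A \<noteq> 0" "graded B \<noteq> 0" using nz graded_neq_0 by auto
  have deg: "degree (graded A) + degree (graded B) = d"
    using degree_mult_eq[OF gnz] pr assms(2) by (simp add: degree_monom_eq)
  have "order 0 (monom F d) = d"
  proof -
    have "monom F d = smult F (monom 1 d)" by (simp add: smult_monom)
    then show ?thesis using assms(2) order_smult[of F 0 "monom 1 d"]
      by (metis order_0_monom)
  qed
  then have ord: "order 0 (graded A) + order 0 (graded B) = d"
    using order_mult[of "graded A" "graded B" 0] pr gnz assms(2) by simp
  have "order 0 (graded A) \<le> degree (graded A)" "order 0 (graded B) \<le> degree (graded B)"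
    using order_degree gnz by auto
  then have "order 0 (graded A) = degree (graded A)" "order 0 (graded B) = degree (graded B)"
    using deg ord by auto
  then obtain a b where "graded A = monom a (degree (graded A))" "graded B = monom b (degree (graded B))"
    using poly_eq_monom_if_order_eq_degree gnz by meson
  then have "A \<in> forms (degree (graded A))" "B \<in> forms (degree (graded B))"
    using graded_eq_monomD graded_eq_monom_iff by metis+
  then show thesis using that[of "degree (graded A)"] deg by auto
qed

lemma unit_form_0: "F \<in> forms 0 \<Longrightarrow> F \<noteq> 0 \<Longrightarrow> F dvd 1"
proof -
  assume "F \<in> forms 0" "F \<noteq> 0"
  then obtain c where "F = Poly_Mapping.single 0 c" "c \<noteq> 0"
    using forms_0_const by (metis single_zero)
  then have "F * Poly_Mapping.single 0 (1 / c) = 1" by (simp add: mult_single)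
  then show ?thesis by (metis dvd_triv_left)
qed

text \<open>A form of positive degree vanishes at the origin, where a unit cannot.\<close>

lemma form_not_unit: "F \<in> forms (Suc d) \<Longrightarrow> \<not> F dvd 1"
proof
  assume F: "F \<in> forms (Suc d)" "F dvd 1"
  then obtain G where "1 = F * G" by (auto elim: dvdE)
  then have "tpoly_eval F 0 * tpoly_eval G 0 = 1" by (metis tpoly_eval_mult tpoly_eval_1)
  moreover have "tpoly_eval F (0 *s 0) = 0 ^ Suc d * tpoly_eval F 0"
    using tpoly_eval_scale[OF F(1)] by blast
  ultimately show False by simp
qed

text \<open>By \<open>factor_of_form\<close> the factors are forms, and a factor of degree 0 would
  be a unit; hence both degrees are positive.\<close>

lemma reducible_form:
  assumes "F \<in> forms d" "F \<noteq> 0" "\<not> irreducible F" "d \<ge> 1"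
  obtains k A B where "1 \<le> k" "k < d" "A \<in> forms k" "B \<in> forms (d - k)" "F = A * B"
proof -
  have "\<not> F dvd 1" using form_not_unit[of F "d - 1"] assms by simp
  then obtain A B where AB: "F = A * B" "\<not> A dvd 1" "\<not> B dvd 1"
    using assms by (auto simp: irreducible_def)
  obtain k where k: "k \<le> d" "A \<in> forms k" "B \<in> forms (d - k)"
    using factor_of_form[OF assms(1,2) AB(1)] .
  have nz: "A \<noteq> 0" "B \<noteq> 0" using AB assms(2) by auto
  have "k \<noteq> 0"
  proof
    assume "k = 0"
    then have "A \<in> forms 0" using k(2) by simp
    then show False using nz(1) AB(2) unit_form_0[of A] by simp
  qed
  moreover have "k \<noteq> d"
  proof
    assume "k = d"
    then have "B \<in> forms 0" using k(3) by simp
    then show False using nz(2) AB(3) unit_form_0[of B] by simp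
  qed
  ultimately have "1 \<le> k" "k < d" using k(1) by linarith+
  then show thesis by (rule that[OF _ _ k(2,3) AB(1)])
qed

lemma reducible_cubic:
  assumes "F \<in> forms 3" "F \<noteq> 0" "\<not> irreducible F"
  obtains l Q where "l \<in> forms 1" "Q \<in> forms 2" "F = l * Q"
proof -
  obtain k A B where k: "1 \<le> k" "k < 3" "A \<in> forms k" "B \<in> forms (3 - k)" "F = A * B"
    using one_le_numeral by (rule reducible_form[OF assms])
  then consider "k = 1" | "k = 2" by linarith
  then show thesis
  proof cases
    case 1
    then have "A \<in> forms 1" "B \<in> forms 2" using k(3,4) by simp_all
    then show thesis using that k(5) by blast
  next
    case 2
    then have "A \<in> forms 2" "B \<in> forms 1" using k(3,4) by simp_all
    then show thesis using that[of B A] k(5) mult.commute[of A B] by simp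
  qed
qed

lemma reducible_conic:
  assumes "F \<in> forms 2" "F \<noteq> 0" "\<not> irreducible F"
  obtains l m where "l \<in> forms 1" "m \<in> forms 1" "F = l * m"
proof -
  obtain k A B where k: "1 \<le> k" "k < 2" "A \<in> forms k" "B \<in> forms (2 - k)" "F = A * B"
    using one_le_numeral by (rule reducible_form[OF assms])
  then have "k = 1" by linarith
  then have "A \<in> forms 1" "B \<in> forms 1" using k(3,4) by simp_all
  then show thesis using that k by blast
qed

lemma line_mult_not_irreducible:
  assumes "l \<in> forms 1" "Q \<in> forms (Suc d)"
  shows "\<not> irreducible (l * Q)"
proof
  assume "irreducible (l * Q)"
  then have "l dvd 1 \<or> Q dvd 1" by (auto simp: irreducible_def)
  then show False using form_not_unit[of l 0] form_not_unit[of Q d] assms by auto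
qed

lemma irreducible_smul:
  assumes "c \<noteq> 0" "irreducible F"
  shows "irreducible (smul c F)"
  unfolding irreducible_def
proof (intro conjI allI impI notI)
  show False if "smul c F = 0" using that assms by simp
  show False if "smul c F dvd 1"
  proof -
    have "F dvd smul c F" by (simp add: smul_def)
    then have "F dvd 1" using that by (rule dvd_trans)
    then show False using assms(2) by (simp add: irreducible_def)
  qed
  fix A B assume *: "smul c F = A * B"
  have "F = smul (1 / c) (smul c F)" using assms(1) by simp
  also have "\<dots> = smul (1 / c) A * B" by (simp add: * smul_mult_left)
  finally have "smul (1 / c) A dvd 1 \<or> B dvd 1" using assms(2) by (auto simp: irreducible_def)
  moreover have "A dvd smul (1 / c) A" by (simp add: smul_def)
  ultimately show "A dvd 1 \<or> B dvd 1" using dvd_trans by blast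
qed

section \<open>Vectors of the three-dimensional space\<close>

text \<open>The complex bilinear cross product. \<open>cr x y = 0\<close> expresses proportionality;
  otherwise \<open>cr x y\<close> is the coefficient vector of the line through \<open>x\<close> and
  \<open>y\<close>.\<close>

definition cr :: "complex ^ 3 \<Rightarrow> complex ^ 3 \<Rightarrow> complex ^ 3" where
  "cr a b = vector [a $ 2 * b $ 3 - a $ 3 * b $ 2, a $ 3 * b $ 1 - a $ 1 * b $ 3, a $ 1 * b $ 2 - a $ 2 * b $ 1]"

text \<open>The bilinear product without conjugation, so that \<open>dt a x = 0\<close> is the
  equation of a line. Isotropic vectors exist: \<open>dt x x = 0\<close> does not give
  \<open>x = 0\<close>.\<close>

definition dt :: "complex ^ 3 \<Rightarrow> complex ^ 3 \<Rightarrow> complex" where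
  "dt a b = a $ 1 * b $ 1 + a $ 2 * b $ 2 + a $ 3 * b $ 3"

definition det3 :: "complex ^ 3 \<Rightarrow> complex ^ 3 \<Rightarrow> complex ^ 3 \<Rightarrow> complex" where
  "det3 a b c = dt a (cr b c)"

lemma cr_nth [simp]:
  "cr a b $ 1 = a $ 2 * b $ 3 - a $ 3 * b $ 2"
  "cr a b $ 2 = a $ 3 * b $ 1 - a $ 1 * b $ 3"
  "cr a b $ 3 = a $ 1 * b $ 2 - a $ 2 * b $ 1"
  by (simp_all add: cr_def)

lemma vec3_eqI: "x $ 1 = y $ 1 \<Longrightarrow> x $ 2 = y $ 2 \<Longrightarrow> x $ 3 = y $ (3::3) \<Longrightarrow> x = y"
  by (simp add: vec_eq_iff forall_3)

lemma dt_add: "dt (a + b) c = dt a c + dt b c" "dt c (a + b) = dt c a + dt c b"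
  and dt_diff: "dt (a - b) c = dt a c - dt b c" "dt c (a - b) = dt c a - dt c b"
  and dt_scale: "dt (s *s a) c = s * dt a c" "dt c (s *s a) = s * dt c a"
  and dt_zero [simp]: "dt 0 c = 0" "dt c 0 = 0"
  by (simp_all add: dt_def algebra_simps)

lemma cr_add: "cr (a + b) c = cr a c + cr b c" "cr c (a + b) = cr c a + cr c b"
  and cr_diff: "cr (a - b) c = cr a c - cr b c" "cr c (a - b) = cr c a - cr c b"
  and cr_scale: "cr (s *s a) c = s *s cr a c" "cr c (s *s a) = s *s cr c a"
  and cr_zero [simp]: "cr 0 c = 0" "cr c 0 = 0"
  and cr_self [simp]: "cr a a = 0"
  by (rule vec3_eqI; simp add: algebra_simps)+

lemmas dt_lin = dt_add dt_diff dt_scale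
lemmas cr_lin = cr_add cr_diff cr_scale

lemma dt_commute: "dt a b = dt b a"
  by (simp add: dt_def)

lemma dt_axis: "dt x (axis i 1) = x $ i" "dt (axis i 1) x = x $ i"
  by (use exhaust_3[of i] in \<open>auto simp: dt_def axis_def\<close>)

lemma dt_nondegenerate: "(\<And>y. dt x y = 0) \<Longrightarrow> x = 0"
  by (simp add: vec_eq_iff flip: dt_axis(1))

lemma cr_cr: "cr a (cr b c) = dt a c *s b - dt a b *s c"
  by (rule vec3_eqI; simp add: dt_def algebra_simps)

lemma cr_cr_left: "cr (cr a b) c = dt a c *s b - dt b c *s a"
  by (rule vec3_eqI; simp add: dt_def algebra_simps)

lemma dt_cr_self [simp]: "dt a (cr a b) = 0" "dt a (cr b a) = 0" "dt (cr a b) a = 0" "dt (cr b a) a = 0"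
  by (simp_all add: dt_def algebra_simps)

lemma dt_cr_cr: "dt (cr a b) (cr c d) = dt a c * dt b d - dt a d * dt b c"
  by (simp add: dt_def algebra_simps)

lemma det3_add: "det3 (a + a') b c = det3 a b c + det3 a' b c"
    "det3 a (b + b') c = det3 a b c + det3 a b' c"
    "det3 a b (c + c') = det3 a b c + det3 a b c'"
  and det3_scale: "det3 (s *s a) b c = s * det3 a b c"
    "det3 a (s *s b) c = s * det3 a b c" "det3 a b (s *s c) = s * det3 a b c"
  and det3_same [simp]: "det3 a a b = 0" "det3 a b a = 0" "det3 a b b = 0"
  by (simp_all add: det3_def dt_def algebra_simps)

lemmas det3_lin = det3_add det3_scale

lemma det3_swap: "det3 b a c = - det3 a b c" "det3 a c b = - det3 a b c"
  by (simp_all add: det3_def dt_def algebra_simps)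

lemma det3_cramer: "det3 a b c *s x = det3 x b c *s a + det3 a x c *s b + det3 a b x *s c"
  by (rule vec3_eqI; simp add: det3_def dt_def algebra_simps)

lemma basis_expand:
  assumes "det3 a b c \<noteq> 0"
  obtains \<alpha> \<beta> \<gamma> where "x = \<alpha> *s a + \<beta> *s b + \<gamma> *s c"
proof -
  have "x = (1 / det3 a b c) *s (det3 a b c *s x)" using assms by simp
  also have "\<dots> = (det3 x b c / det3 a b c) *s a + (det3 a x c / det3 a b c) *s b + (det3 a b x / det3 a b c) *s c"
    by (subst det3_cramer) (simp add: vector_add_ldistrib)
  finally show thesis by (rule that)
qed

lemma det_singular_kernel:
  fixes A :: "complex ^ 'n ^ 'n"
  assumes "det A = 0"
  obtains x where "x \<noteq> 0" "A *v x = 0"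
proof -
  have "\<not> invertible A" using assms by (simp add: invertible_det_nz)
  then have "\<not> (\<forall>x. A *v x = 0 \<longrightarrow> x = 0)"
    by (simp add: matrix_left_invertible_ker[symmetric] invertible_left_inverse)
  then show thesis using that by blast
qed

lemma det_kernel_singular:
  fixes A :: "complex ^ 'n ^ 'n"
  assumes "A *v x = 0" "x \<noteq> 0"
  shows "det A = 0"
proof (rule ccontr)
  assume "det A \<noteq> 0"
  then have "\<exists>B. B ** A = mat 1" by (simp add: invertible_det_nz[symmetric] invertible_left_inverse)
  then have "x = 0" using assms(1) by (simp add: matrix_left_invertible_ker)
  then show False using assms(2) by simp
qed

text \<open>Two linear equations in three unknowns, padded by a zero row. Besides a common point of
  two lines it yields the coefficients of a member of a net of cubics through two prescribed
  points.\<close>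

lemma common_orthogonal:
  obtains x where "x \<noteq> 0" "dt a x = 0" "dt b x = 0"
proof -
  define A :: "complex ^ 3 ^ 3" where "A = vector [a, b, 0]"
  have "det A = 0" by (simp add: A_def det_3)
  then obtain x where x: "x \<noteq> 0" "A *v x = 0" by (rule det_singular_kernel)
  have "(A *v x) $ 1 = dt a x" "(A *v x) $ 2 = dt b x"
    by (simp_all add: A_def matrix_vector_mult_def sum_3 dt_def)
  then show thesis using that x by auto
qed

lemma cr_eq_0D:
  assumes "cr a b = 0" "a \<noteq> 0"
  obtains k where "b = k *s a"
proof -
  obtain i where i: "a $ i \<noteq> 0" using assms(2) by (auto simp: vec_eq_iff)
  have "cr (cr a b) (axis i 1) = 0" using assms by simp
  then have "a $ i *s b = b $ i *s a" by (simp add: cr_cr_left dt_axis)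
  then have "(1 / a $ i) *s (a $ i *s b) = (1 / a $ i) *s (b $ i *s a)" by simp
  then have "b = (b $ i / a $ i) *s a" using i by simp
  then show thesis by (rule that)
qed

lemma det3_eq_0_dependent:
  assumes "det3 a b c = 0"
  obtains k :: "complex ^ 3" where "k \<noteq> 0" "k $ 1 *s a + k $ 2 *s b + k $ 3 *s c = 0"
proof -
  define A :: "complex ^ 3 ^ 3" where "A = vector [a, b, c]"
  have "det (transpose A) = 0"
    using assms unfolding det_transpose by (simp add: A_def det_3 det3_def dt_def algebra_simps)
  then obtain k where k: "k \<noteq> 0" "transpose A *v k = 0" by (rule det_singular_kernel)
  have "k $ 1 *s a + k $ 2 *s b + k $ 3 *s c = transpose A *v k"
    by (simp add: A_def vec_eq_iff matrix_vector_mult_def transpose_def sum_3 mult_ac)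
  then show thesis using that k by simp
qed

section \<open>Polarization of cubics\<close>

text \<open>The third derivatives of a cubic are constants, hence their evaluation at 0. Nothing is
  divided out: for \<open>F \<in> forms 3\<close> the value at \<open>x\<close> is
  \<open>tri F x x x / 6\<close> and the derivative along \<open>v\<close> is
  \<open>tri F x x v / 2\<close>.\<close>

definition tri :: "tpoly \<Rightarrow> complex ^ 3 \<Rightarrow> complex ^ 3 \<Rightarrow> complex ^ 3 \<Rightarrow> complex" where
  "tri F x y z = (\<Sum>i\<in>UNIV. \<Sum>j\<in>UNIV. \<Sum>k\<in>UNIV.
     tpoly_eval (pd i (pd j (pd k F))) 0 * (x $ i * y $ j * z $ k))"

lemma tri_add1: "tri F (x + x') y z = tri F x y z + tri F x' y z"
  and tri_scale1: "tri F (c *s x) y z = c * tri F x y z"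
  by (simp_all add: tri_def sum_3 algebra_simps)

lemma tri_swap12: "tri F x y z = tri F y x z"
proof -
  have "tri F y x z = (\<Sum>j\<in>UNIV. \<Sum>i\<in>UNIV. \<Sum>k\<in>UNIV.
     tpoly_eval (pd i (pd j (pd k F))) 0 * (y $ i * x $ j * z $ k))"
    unfolding tri_def by (rule sum.swap)
  also have "\<dots> = tri F x y z"
    unfolding tri_def
    by (intro sum.cong refl) (simp add: pd_commute mult_ac)
  finally show ?thesis by simp
qed

lemma tri_swap23: "tri F x y z = tri F x z y"
proof -
  have "tri F x z y = (\<Sum>i\<in>UNIV. \<Sum>k\<in>UNIV. \<Sum>j\<in>UNIV.
     tpoly_eval (pd i (pd j (pd k F))) 0 * (x $ i * z $ j * y $ k))"
    unfolding tri_def by (intro sum.cong refl sum.swap)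
  also have "\<dots> = tri F x y z"
    unfolding tri_def
    by (intro sum.cong refl) (simp add: pd_commute mult_ac)
  finally show ?thesis by simp
qed

lemma tri_rotate: "tri F x y z = tri F y z x"
  by (metis tri_swap12 tri_swap23)

lemma tri_add2: "tri F y (x + x') z = tri F y x z + tri F y x' z"
  and tri_scale2: "tri F y (c *s x) z = c * tri F y x z"
  and tri_add3: "tri F y z (x + x') = tri F y z x + tri F y z x'"
  and tri_scale3: "tri F y z (c *s x) = c * tri F y z x"
  by (metis tri_add1 tri_scale1 tri_rotate)+

lemma tri_zero [simp]: "tri F 0 y z = 0" "tri F x 0 z = 0" "tri F x y 0 = 0"
  by (simp_all add: tri_def)

lemma tri_minus: "tri F (- x) y z = - tri F x y z" "tri F x (- y) z = - tri F x y z"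
    "tri F x y (- z) = - tri F x y z"
  by (simp_all add: tri_def sum_negf)

lemma tri_diff: "tri F (x - x') y z = tri F x y z - tri F x' y z"
  "tri F y (x - x') z = tri F y x z - tri F y x' z"
  "tri F y z (x - x') = tri F y z x - tri F y z x'"
  by (simp_all add: tri_add1 tri_add2 tri_add3 tri_minus diff_conv_add_uminus del: add_uminus_conv_diff)

lemmas tri_lin = tri_add1 tri_add2 tri_add3 tri_scale1 tri_scale2 tri_scale3 tri_diff tri_minus

lemma tri_plus: "tri (F + G) x y z = tri F x y z + tri G x y z"
  and tri_smul: "tri (smul c F) x y z = c * tri F x y z"
  by (simp_all add: tri_def pd_add pd_smul sum.distrib distrib_left distrib_right sum_distrib_left mult_ac)

lemma eval_form_0: "F \<in> forms 0 \<Longrightarrow> tpoly_eval F x = tpoly_eval F 0"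
  using forms_0_const[of F 0] by (metis tpoly_eval_const)

lemma pd_forms3: "F \<in> forms 3 \<Longrightarrow> pd i F \<in> forms 2"
  and pd_forms2: "F \<in> forms 2 \<Longrightarrow> pd i F \<in> forms 1"
  and pd_forms1: "F \<in> forms 1 \<Longrightarrow> pd i F \<in> forms 0"
  using pd_forms[of F 2 i] pd_forms[of F 1 i] pd_forms[of F 0 i] by (simp_all add: numeral_3_eq_3 numeral_2_eq_2)

lemma pd_pd_eval:
  assumes "F \<in> forms 3"
  shows "tpoly_eval (pd i (pd j F)) x = tri F x (axis i 1) (axis j 1)"
proof -
  have f1: "pd i (pd j F) \<in> forms 1" by (intro pd_forms2 pd_forms3 assms)
  have "tpoly_eval (pd i (pd j F)) x = (\<Sum>k\<in>UNIV. x $ k * tpoly_eval (pd k (pd i (pd j F))) x)"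
    using euler[OF f1] by simp
  also have "\<dots> = (\<Sum>k\<in>UNIV. tpoly_eval (pd k (pd i (pd j F))) 0 * x $ k)"
    by (intro sum.cong refl) (metis eval_form_0[OF pd_forms1[OF f1]] mult.commute)
  also have "\<dots> = tri F x (axis i 1) (axis j 1)"
    using exhaust_3[of i] exhaust_3[of j] by (auto simp: tri_def sum_3 axis_def)
  finally show ?thesis .
qed

lemma vec_axis_sum: "x = (\<Sum>i\<in>UNIV. x $ i *s axis i (1::complex))" for x :: "complex ^ 3"
  by (simp add: vec_eq_iff axis_def if_distrib cong: if_cong)

lemma tri_sum1: "tri F (\<Sum>i\<in>A. f i) y z = (\<Sum>i\<in>A. tri F (f i) y z)"
  by (induction A rule: infinite_finite_induct) (auto simp: tri_lin)

lemma tri_expand: "tri F x y z = (\<Sum>i\<in>UNIV. x $ i * tri F (axis i 1) y z)"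
  by (subst vec_axis_sum[of x]) (simp add: tri_sum1 tri_lin)

lemma pd_eval:
  assumes "F \<in> forms 3"
  shows "tpoly_eval (pd i F) x = tri F x x (axis i 1) / 2"
proof -
  have "2 * tpoly_eval (pd i F) x = (\<Sum>j\<in>UNIV. x $ j * tpoly_eval (pd j (pd i F)) x)"
    using euler[OF pd_forms3[OF assms]] by simp
  also have "\<dots> = tri F x x (axis i 1)"
    by (subst tri_expand) (simp add: pd_pd_eval[OF assms] tri_swap12[of F _ x])
  finally show ?thesis by (simp add: mult.commute)
qed

lemma eval_tri:
  assumes "F \<in> forms 3"
  shows "tpoly_eval F x = tri F x x x / 6"
proof -
  have "3 * tpoly_eval F x = (\<Sum>i\<in>UNIV. x $ i * tpoly_eval (pd i F) x)"
    using euler[OF assms] by simp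
  also have "\<dots> = (\<Sum>i\<in>UNIV. x $ i * tri F (axis i 1) x x) / 2"
    unfolding sum_divide_distrib
    by (intro sum.cong refl) (simp add: pd_eval[OF assms] tri_rotate[of F "axis _ 1"])
  also have "\<dots> = tri F x x x / 2" by (simp flip: tri_expand)
  finally show ?thesis by (simp add: mult.commute)
qed

lemma eval_tri_add:
  assumes "F \<in> forms 3"
  shows "tpoly_eval F (x + v) = tpoly_eval F x + tri F x x v / 2 + tri F x v v / 2 + tpoly_eval F v"
proof -
  have "tri F x v x = tri F x x v" "tri F v x x = tri F x x v" "tri F v x v = tri F x v v" "tri F v v x = tri F x v v"
    by (metis tri_rotate tri_swap23)+
  then show ?thesis by (simp add: eval_tri[OF assms] tri_lin add_divide_distrib)
qed

definition grad :: "tpoly \<Rightarrow> complex ^ 3 \<Rightarrow> complex ^ 3 \<Rightarrow> complex ^ 3" where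
  "grad F x y = (\<chi> k. tri F x y (axis k 1))"

lemma dt_grad: "dt (grad F x y) z = tri F x y z"
proof -
  have "tri F x y z = (\<Sum>i\<in>UNIV. z $ i * tri F (axis i 1) x y)"
    by (metis tri_rotate tri_expand)
  also have "\<dots> = dt (grad F x y) z"
    by (simp add: sum_3 dt_def grad_def tri_rotate[of F "axis _ 1"])
  finally show ?thesis by simp
qed

lemma grad_lin: "grad F (x + x') y = grad F x y + grad F x' y" "grad F y (x + x') = grad F y x + grad F y x'"
  "grad F (c *s x) y = c *s grad F x y" "grad F y (c *s x) = c *s grad F y x"
  and grad_commute: "grad F x y = grad F y x"
  by (simp_all add: grad_def vec_eq_iff tri_lin tri_swap12)

lemma grad_eq_0_iff: "grad F x y = 0 \<longleftrightarrow> (\<forall>z. tri F x y z = 0)"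
  by (metis dt_grad dt_nondegenerate dt_zero(1))

text \<open>Only the gradient is required to vanish; for a cubic the value then vanishes by
  \<open>eval_tri\<close>. The vector 0 is not excluded here.\<close>

definition sing_at :: "tpoly \<Rightarrow> complex ^ 3 \<Rightarrow> bool" where
  "sing_at F x \<longleftrightarrow> (\<forall>v. tri F x x v = 0)"

lemma singular_form_iff:
  assumes "F \<in> forms 3"
  shows "singular_form F \<longleftrightarrow> (\<exists>x. x \<noteq> 0 \<and> sing_at F x)"
proof -
  have "(tpoly_eval F x = 0 \<and> (\<forall>i. tpoly_eval (pd i F) x = 0)) \<longleftrightarrow> sing_at F x" for x
  proof
    assume "tpoly_eval F x = 0 \<and> (\<forall>i. tpoly_eval (pd i F) x = 0)"
    then have "grad F x x = 0" by (simp add: grad_def vec_eq_iff pd_eval[OF assms])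
    then show "sing_at F x" by (simp add: grad_eq_0_iff sing_at_def)
  qed (simp add: sing_at_def pd_eval[OF assms] eval_tri[OF assms])
  then show ?thesis by (simp add: singular_form_def)
qed

subsection \<open>A linear vector field tangent to a cubic\<close>

lemma cubic_coeffs_0:
  fixes a b c d :: complex
  assumes "\<And>t. a + t * b + t ^ 2 * c + t ^ 3 * d = 0"
  shows "a = 0" "b = 0" "c = 0" "d = 0"
proof -
  have "poly [:a, b, c, d:] t = 0" for t
    using assms[of t] by (simp add: algebra_simps power2_eq_square power3_eq_cube)
  then have "[:a, b, c, d:] = 0" using poly_all_0_iff_0 by blast
  then show "a = 0" "b = 0" "c = 0" "d = 0" by simp_all
qed

text \<open>Tangency at every point means that the derivation induced by \<open>B\<close>
  annihilates the cubic form, hence also its polarization. The coefficient of \<open>t\<close> at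
  \<open>x + t *s y\<close> and then the mixed part at \<open>x + z\<close> carry this out.\<close>

lemma tangent_polarized:
  assumes "\<And>x. tri F x x (B *v x) = 0"
  shows "tri F (B *v x) y z + tri F x (B *v y) z + tri F x y (B *v z) = 0"
proof -
  have 1: "2 * tri F x y (B *v x) + tri F x x (B *v y) = 0" for x y
  proof (rule cubic_coeffs_0(2)[of "tri F x x (B *v x)" _ "tri F y y (B *v x) + 2 * tri F x y (B *v y)" "tri F y y (B *v y)"])
    fix t
    have "tri F (x + t *s y) (x + t *s y) (B *v (x + t *s y)) = 0" by (rule assms)
    then show "tri F x x (B *v x) + t * (2 * tri F x y (B *v x) + tri F x x (B *v y)) +
        t\<^sup>2 * (tri F y y (B *v x) + 2 * tri F x y (B *v y)) + t ^ 3 * tri F y y (B *v y) = 0"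
      by (simp add: tri_lin vec.add vec.scale algebra_simps power2_eq_square power3_eq_cube tri_swap12[of F y x])
  qed
  have "2 * tri F (x + z) y (B *v (x + z)) + tri F (x + z) (x + z) (B *v y) = 0" by (rule 1)
  then have "(2 * tri F x y (B *v x) + tri F x x (B *v y)) + (2 * tri F z y (B *v z) + tri F z z (B *v y)) +
      2 * (tri F x y (B *v z) + tri F z y (B *v x) + tri F x z (B *v y)) = 0"
    by (simp add: tri_lin vec.add algebra_simps tri_swap12[of F z x])
  then have "2 * (tri F x y (B *v z) + tri F z y (B *v x) + tri F x z (B *v y)) = 0"
    unfolding 1 by simp
  then have "tri F x y (B *v z) + tri F z y (B *v x) + tri F x z (B *v y) = 0"
    by (simp only: mult_eq_0_iff) simp
  moreover have "tri F z y (B *v x) = tri F (B *v x) y z" "tri F x z (B *v y) = tri F x (B *v y) z"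
    by (metis tri_rotate tri_swap12 tri_swap23)+
  ultimately show ?thesis by (simp add: add_ac)
qed

lemma sub_mat_mult: "(B - mat c) *v w = B *v w - c *s w" for B :: "complex ^ 3 ^ 3"
  by (rule vec3_eqI; simp add: matrix_vector_mult_def sum_3 mat_def algebra_simps)

text \<open>The linear form \<open>tri F v v\<close> is an eigenvector of the transpose of \<open>B\<close> for \<open>-2 l\<close>.\<close>

lemma tangent_eigenvalue:
  assumes inv: "\<And>x. tri F x x (B *v x) = 0"
    and "B *v v = l *s v" "v \<noteq> 0" "\<not> sing_at F v"
  shows "\<exists>w. w \<noteq> 0 \<and> B *v w = (- 2 * l) *s w"
proof -
  define f where "f = grad F v v"
  have "f \<noteq> 0" using assms(4) by (simp add: f_def grad_eq_0_iff sing_at_def)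
  have f: "dt f (B *v z) = - 2 * l * dt f z" for z
  proof -
    have "l * tri F v v z + l * tri F v v z + tri F v v (B *v z) = 0"
      using tangent_polarized[OF inv, of v v z] unfolding assms(2) by (simp only: tri_lin)
    then show ?thesis unfolding f_def dt_grad by algebra
  qed
  define C where "C = transpose B - mat (- 2 * l)"
  have fi: "f $ 1 * B $ 1 $ i + f $ 2 * B $ 2 $ i + f $ 3 * B $ 3 $ i = - 2 * l * f $ i" for i
    using f[of "axis i 1"] exhaust_3[of i]
    by (auto simp: dt_def matrix_vector_mult_def sum_3 axis_def)
  have "(C *v f) $ i = (f $ 1 * B $ 1 $ i + f $ 2 * B $ 2 $ i + f $ 3 * B $ 3 $ i) + 2 * l * f $ i" for i
  proof -
    have "(C *v f) $ i = (transpose B *v f) $ i - (- 2 * l) * f $ i"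
      unfolding C_def sub_mat_mult by simp
    then show ?thesis by (simp add: matrix_vector_mult_def sum_3 transpose_def mult_ac)
  qed
  then have "C *v f = 0" unfolding fi by (simp add: vec_eq_iff)
  then have "det C = 0" using \<open>f \<noteq> 0\<close> by (rule det_kernel_singular)
  moreover have "C = transpose (B - mat (- 2 * l))"
    by (simp add: C_def transpose_def mat_def vec_eq_iff)
  ultimately have "det (B - mat (- 2 * l)) = 0" by (simp add: det_transpose)
  then obtain w where w: "w \<noteq> 0" "(B - mat (- 2 * l)) *v w = 0" by (rule det_singular_kernel)
  have "B *v w - (- 2 * l) *s w = 0" using w(2) by (simp only: sub_mat_mult)
  then have "B *v w = (- 2 * l) *s w" by (simp only: right_minus_eq)
  then show ?thesis by (intro exI[of _ w] conjI w(1))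
qed

definition trace3 :: "complex ^ 3 ^ 3 \<Rightarrow> complex" where
  "trace3 B = B $ 1 $ 1 + B $ 2 $ 2 + B $ 3 $ 3"

definition minors3 :: "complex ^ 3 ^ 3 \<Rightarrow> complex" where
  "minors3 B = B $ 1 $ 1 * B $ 2 $ 2 - B $ 1 $ 2 * B $ 2 $ 1 + B $ 1 $ 1 * B $ 3 $ 3 - B $ 1 $ 3 * B $ 3 $ 1
     + B $ 2 $ 2 * B $ 3 $ 3 - B $ 2 $ 3 * B $ 3 $ 2"

lemma charpoly3: "det (B - mat l) = - (l ^ 3 - trace3 B * l ^ 2 + minors3 B * l - det B)"
  by (simp add: det_3 mat_def trace3_def minors3_def algebra_simps power2_eq_square power3_eq_cube)

lemma cayley_hamilton3:
  "B *v (B *v (B *v x)) - trace3 B *s (B *v (B *v x)) + minors3 B *s (B *v x) - det B *s x = 0"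
  by (rule vec3_eqI; simp add: matrix_vector_mult_def sum_3 det_3 trace3_def minors3_def algebra_simps)

text \<open>On a smooth cubic \<open>tangent_eigenvalue\<close> makes the set of eigenvalues stable
  under multiplication by -2. Being finite, it is {0}; the characteristic polynomial is then a pure
  cube and Cayley-Hamilton applies.\<close>

lemma tangent_nilpotent:
  assumes inv: "\<And>x. tri F x x (B *v x) = 0"
    and ns: "\<And>x. x \<noteq> 0 \<Longrightarrow> \<not> sing_at F x"
  shows "B *v (B *v (B *v x)) = 0"
proof -
  define p where "p = [:- det B, minors3 B, - trace3 B, 1:]"
  have p: "poly p l = - det (B - mat l)" for l
    unfolding charpoly3 p_def by (simp add: algebra_simps power2_eq_square power3_eq_cube)
  have step: "poly p (- 2 * l) = 0" if l: "poly p l = 0" for l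
  proof -
    have "det (B - mat l) = 0" using l p by simp
    then obtain v where v: "v \<noteq> 0" "(B - mat l) *v v = 0" by (rule det_singular_kernel)
    then have "B *v v = l *s v" by (simp add: sub_mat_mult)
    then obtain w where w: "w \<noteq> 0" "B *v w = (- 2 * l) *s w"
      using tangent_eigenvalue[OF inv _ v(1) ns[OF v(1)], of l] by auto
    have "(B - mat (- 2 * l)) *v w = 0"
      using w(2) by (simp add: sub_mat_mult)
    then show ?thesis using det_kernel_singular[OF _ w(1)] p by simp
  qed
  have p0: "p \<noteq> 0" by (simp add: p_def)
  have root0: "l = 0" if "poly p l = 0" for l
  proof (rule ccontr)
    assume "l \<noteq> 0"
    \<comment> \<open>An eigenvalue of largest modulus would be doubled in modulus.\<close>
    define R where "R = norm ` {l. poly p l = 0}"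
    have R: "finite R" "R \<noteq> {}" using poly_roots_finite[OF p0] that by (auto simp: R_def)
    have "Max R \<in> R" by (rule Max_in[OF R])
    then obtain m where m: "poly p m = 0" "norm m = Max R" unfolding R_def by force
    have "norm l \<le> norm m" using that R m(2) by (auto simp: R_def)
    then have "norm m > 0" using \<open>l \<noteq> 0\<close> by auto
    moreover have "norm (- 2 * m) \<le> Max R"
      by (intro Max_ge R(1)) (unfold R_def, rule imageI, use step[OF m(1)] in simp)
    ultimately show False using m(2) by (simp add: norm_mult)
  qed
  have "det B = 0"
  proof -
    obtain l where "poly p l = 0"
      using alg_closed_imp_poly_has_root[of p] by (auto simp: p_def)
    then show ?thesis using root0[of l] by (simp add: p_def)
  qed
  \<comment> \<open>With \<open>det B = 0\<close> a factor of the variable splits off from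
    \<open>p\<close>; any root of the quotient is a root of \<open>p\<close> and thus 0
    again.\<close>
  moreover have "minors3 B = 0"
  proof -
    obtain l where l: "poly [:minors3 B, - trace3 B, 1:] l = 0"
      using alg_closed_imp_poly_has_root[of "[:minors3 B, - trace3 B, 1:]"] by auto
    then have "poly p l = 0" using \<open>det B = 0\<close> by (simp add: p_def)
    then show ?thesis using root0[of l] l by simp
  qed
  moreover have "trace3 B = 0"
    using root0[of "trace3 B"] calculation by (simp add: p_def)
  ultimately show ?thesis using cayley_hamilton3[of B x] by simp
qed

text \<open>A smooth cubic would make \<open>B\<close> nilpotent. If the square of \<open>B\<close>
  is 0, the image of \<open>B\<close> consists of singular points; otherwise the image of the square
  contains a nonzero one.\<close>

lemma tangent_field_singular:
  assumes inv: "\<And>x. tri F x x (B *v x) = 0" and "B \<noteq> 0"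
  shows "\<exists>x. x \<noteq> 0 \<and> sing_at F x"
proof (rule ccontr)
  assume "\<not> ?thesis"
  then have ns: "x \<noteq> 0 \<Longrightarrow> \<not> sing_at F x" for x by blast
  note P = tangent_polarized[OF inv]
  have B3: "B *v (B *v (B *v x)) = 0" for x by (rule tangent_nilpotent[OF inv ns])
  show False
  proof (cases "\<forall>x. B *v (B *v x) = 0")
    case True
    \<comment> \<open>\<open>g\<close> is symmetric in its first two arguments and, as the square of
      \<open>B\<close> is 0, antisymmetric in the last two. Alternating the two rules returns to the
      same arguments with the opposite sign.\<close>
    define g where "g x y z = tri F (B *v x) (B *v y) z" for x y z
    have anti: "g x y z = - g x z y" for x y z
    proof -
      have "tri F (B *v x) (B *v y) z + tri F (B *v x) y (B *v z) = 0"
        using P[of "B *v x" y z] True by simp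
      then show ?thesis
        unfolding g_def tri_swap23[of F "B *v x" y "B *v z"] by (rule eq_neg_iff_add_eq_0[THEN iffD2])
    qed
    have sym: "g x y z = g y x z" for x y z by (simp add: g_def tri_swap12)
    have "g x y z = 0" for x y z
    proof -
      have "g x y z = - g z x y" using anti[of x y z] sym[of x z y] by simp
      also have "\<dots> = g y z x" using anti[of z x y] sym[of z y x] by simp
      also have "\<dots> = - g x y z" using anti[of y z x] sym[of y x z] by simp
      finally have "2 * g x y z = 0" by simp
      then show ?thesis by simp
    qed
    then have "tri F (B *v x) (B *v y) z = 0" for x y z by (simp add: g_def)
    then have "sing_at F (B *v x)" for x by (simp add: sing_at_def)
    then have "B *v x = 0" for x using ns by blast
    then have "B *v x = 0 *v x" for x by simp
    then have "B = 0" by (simp only: matrix_eq) simp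
    then show False using \<open>B \<noteq> 0\<close> by simp
  next
    case False
    then obtain x where x: "B *v (B *v x) \<noteq> 0" by blast
    \<comment> \<open>\<open>x\<close>, \<open>y\<close>, \<open>v\<close> form a Jordan chain and
      hence a basis. Suitable members of it inserted in \<open>P\<close> show that
      \<open>tri F v v\<close> vanishes on all three, so that \<open>v\<close> is a singular
      point.\<close>
    define y where "y = B *v x"
    define v where "v = B *v y"
    have v0: "v \<noteq> 0" and Bx: "B *v x = y" and By: "B *v y = v" and Bv: "B *v v = 0"
      using x B3 by (simp_all add: y_def v_def)
    have "tri F v y y + tri F y v y + tri F y y v = 0"
      using P[of y y y] By by simp
    then have "3 * tri F y y v = 0"
      unfolding tri_rotate[of F v y y] tri_swap23[of F y v y] by simp
    then have yyv: "tri F y y v = 0" by simp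
    have vvx: "tri F v v x = 0"
    proof -
      have "tri F y y v + tri F x v v + tri F x y 0 = 0"
        using P[of x y v] Bx By Bv by simp
      then show ?thesis using yyv tri_rotate[of F x v v] by simp
    qed
    have vvB: "tri F v v (B *v z) = 0" for z using P[of v v z] Bv by simp
    have vvy: "tri F v v y = 0" and vvv: "tri F v v v = 0" using vvB[of x] vvB[of y] Bx By by auto
    have "det3 x y v \<noteq> 0"
    proof
      assume "det3 x y v = 0"
      then obtain c :: "complex ^ 3" where c: "c \<noteq> 0" and e: "c $ 1 *s x + c $ 2 *s y + c $ 3 *s v = 0"
        by (rule det3_eq_0_dependent)
      have "B *v (B *v (c $ 1 *s x + c $ 2 *s y + c $ 3 *s v)) = 0" unfolding e by simp
      then have c1: "c $ 1 = 0" using v0 by (simp add: vec.add vec.scale Bx By Bv)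
      have "B *v (c $ 1 *s x + c $ 2 *s y + c $ 3 *s v) = 0" unfolding e by simp
      then have c2: "c $ 2 = 0" using v0 c1 by (simp add: vec.add vec.scale Bx By Bv)
      have "c $ 3 = 0" using e c1 c2 v0 by simp
      then have "c = 0" using c1 c2 by (intro vec3_eqI) auto
      then show False using c by simp
    qed
    then have "tri F v v z = 0" for z
      by (rule basis_expand[of x y v z]) (simp add: tri_lin vvx vvy vvv)
    then show False using ns[OF v0] by (simp add: sing_at_def)
  qed
qed


section \<open>The discriminant vanishes exactly on the singular cubics\<close>

lemma det3_det: "det3 a b c = det (vector [a, b, c] :: complex ^ 3 ^ 3)"
  by (simp add: det_3 det3_def dt_def algebra_simps)

lemma det3_orthogonal:
  assumes "dt a x = 0" "dt b x = 0" "dt c x = 0" "x \<noteq> 0"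
  shows "det3 a b c = 0"
proof -
  have "(vector [a, b, c] :: complex ^ 3 ^ 3) *v x = 0"
    using assms by (simp add: vec_eq_iff forall_3 matrix_vector_mult_def sum_3 dt_def)
  then show ?thesis unfolding det3_det using assms(4) by (rule det_kernel_singular)
qed

lemma basis_exists:
  assumes "x \<noteq> 0"
  obtains v w where "det3 x v w \<noteq> 0"
proof -
  have "det3 x (axis 2 1) (axis 3 1) = x $ 1" "det3 x (axis 3 1) (axis 1 1) = x $ 2"
    "det3 x (axis 1 1) (axis 2 1) = x $ 3"
    by (simp_all add: det3_def dt_def axis_def)
  moreover have "x $ 1 \<noteq> 0 \<or> x $ 2 \<noteq> 0 \<or> x $ 3 \<noteq> 0"
    using assms by (auto intro: vec3_eqI)
  ultimately show thesis using that by metis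
qed

section \<open>The Hessian of a cubic and its derivative\<close>

lemma hessian_forms:
  assumes "F \<in> forms 3"
  shows "hessian F \<in> forms 3"
proof -
  have 1: "pd i (pd j F) \<in> forms 1" for i j by (intro pd_forms2 pd_forms3 assms)
  have p: "A * B * C \<in> forms 3" if "A \<in> forms 1" "B \<in> forms 1" "C \<in> forms 1" for A B C
    using forms_mult[OF forms_mult[OF that(1,2)] that(3)] by (simp add: numeral_3_eq_3)
  then show ?thesis
    unfolding hessian_def det_3 by (simp, intro forms_add forms_diff p 1)
qed

lemma hessian_eval:
  assumes "F \<in> forms 3"
  shows "tpoly_eval (hessian F) x = det (\<chi> i j. tri F x (axis i 1) (axis j 1))"
  by (simp add: hessian_def det_3 pd_pd_eval[OF assms])

text \<open>The three gradients are the rows of the matrix with rows \<open>u\<close>,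
  \<open>v\<close>, \<open>w\<close> times the Hessian matrix at \<open>x\<close>. This frees the
  Hessian from the coordinate axes, so that the frame can be adapted to a given point.\<close>

lemma hessian_det3:
  assumes "F \<in> forms 3"
  shows "tpoly_eval (hessian F) x * det3 u v w = det3 (grad F x u) (grad F x v) (grad F x w)"
proof -
  define M :: "complex ^ 3 ^ 3" where "M = (\<chi> i j. tri F x (axis i 1) (axis j 1))"
  have g: "grad F x u $ k = (\<Sum>i\<in>UNIV. u $ i * M $ i $ k)" for u k
  proof -
    have "tri F x u (axis k 1) = tri F u x (axis k 1)" by (rule tri_swap12)
    also have "\<dots> = (\<Sum>i\<in>UNIV. u $ i * tri F (axis i 1) x (axis k 1))" by (rule tri_expand)
    finally show ?thesis by (simp add: grad_def M_def tri_swap12[of F x])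
  qed
  have "vector [grad F x u, grad F x v, grad F x w] = (vector [u, v, w] :: complex ^ 3 ^ 3) ** M"
    by (simp add: vec_eq_iff forall_3 matrix_matrix_mult_def g)
  then show ?thesis
    unfolding det3_det hessian_eval[OF assms] M_def[symmetric] by (simp add: det_mul)
qed

text \<open>The product rule for the determinant in \<open>hessian_det3\<close>: both sides are the
  coefficient of \<open>t\<close> at \<open>x + t *s b\<close>.\<close>

lemma hessian_derivative:
  assumes "F \<in> forms 3"
  shows "tri (hessian F) x x b / 2 * det3 u v w =
    det3 (grad F b u) (grad F x v) (grad F x w) + det3 (grad F x u) (grad F b v) (grad F x w)
    + det3 (grad F x u) (grad F x v) (grad F b w)" (is "?l = ?r")
proof -
  let ?H = "hessian F" and ?d = "det3 u v w"
  have "?l - ?r = 0"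
  proof (rule cubic_coeffs_0(2))
    fix t
    have H: "tpoly_eval ?H (x + t *s b) =
        tpoly_eval ?H x + t * (tri ?H x x b / 2) + t\<^sup>2 * (tri ?H x b b / 2) + t ^ 3 * tpoly_eval ?H b"
      unfolding eval_tri_add[OF hessian_forms[OF assms]] tpoly_eval_scale[OF hessian_forms[OF assms]]
      by (simp add: tri_lin power2_eq_square)
    have "tpoly_eval ?H (x + t *s b) * ?d =
        det3 (grad F (x + t *s b) u) (grad F (x + t *s b) v) (grad F (x + t *s b) w)"
      by (rule hessian_det3[OF assms])
    moreover have "(tpoly_eval ?H x * ?d - det3 (grad F x u) (grad F x v) (grad F x w)) + t * (?l - ?r)
      + t\<^sup>2 * (tri ?H x b b / 2 * ?d - (det3 (grad F b u) (grad F b v) (grad F x w)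
          + det3 (grad F b u) (grad F x v) (grad F b w) + det3 (grad F x u) (grad F b v) (grad F b w)))
      + t ^ 3 * (tpoly_eval ?H b * ?d - det3 (grad F b u) (grad F b v) (grad F b w)) =
      tpoly_eval ?H (x + t *s b) * ?d -
        det3 (grad F (x + t *s b) u) (grad F (x + t *s b) v) (grad F (x + t *s b) w)"
      unfolding H grad_lin det3_lin
      by (simp add: algebra_simps power2_eq_square power3_eq_cube)
    ultimately show "(tpoly_eval ?H x * ?d - det3 (grad F x u) (grad F x v) (grad F x w)) + t * (?l - ?r)
      + t\<^sup>2 * (tri ?H x b b / 2 * ?d - (det3 (grad F b u) (grad F b v) (grad F x w)
          + det3 (grad F b u) (grad F x v) (grad F b w) + det3 (grad F x u) (grad F b v) (grad F b w)))
      + t ^ 3 * (tpoly_eval ?H b * ?d - det3 (grad F b u) (grad F b v) (grad F b w)) = 0"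
      by simp
  qed
  then show ?thesis by simp
qed

text \<open>In \<open>hessian_derivative\<close> with \<open>u = x\<close>, two summands contain
  \<open>grad F x x = 0\<close>; in the remaining one all three gradients are orthogonal to
  \<open>x\<close>.\<close>

lemma hessian_sing_at:
  assumes "F \<in> forms 3" "sing_at F x" "x \<noteq> 0"
  shows "sing_at (hessian F) x"
  unfolding sing_at_def
proof
  fix b
  obtain v w where vw: "det3 x v w \<noteq> 0" using basis_exists[OF assms(3)] .
  have s: "tri F x x z = 0" for z using assms(2) by (simp add: sing_at_def)
  have 0: "grad F x x = 0" by (simp add: grad_eq_0_iff s)
  have "det3 (grad F b x) (grad F x v) (grad F x w) = 0"
    by (rule det3_orthogonal[OF _ _ _ assms(3)])
      (simp_all add: dt_grad s tri_rotate[of F b] tri_swap23[of F x _ x])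
  moreover have "det3 0 p q = 0" for p q by (simp add: det3_def)
  ultimately have "tri (hessian F) x x b / 2 * det3 x v w = 0"
    unfolding hessian_derivative[OF assms(1)] 0 by simp
  then show "tri (hessian F) x x b = 0" using vw by simp
qed

text \<open>The relation says that for every \<open>y\<close> the linear vector field
  \<open>x \<mapsto> det(b, y, x) a / 2 + M(x)b \<times> M(b)y + M(b)b \<times> M(x)y\<close>, where \<open>M(x)\<close> is the Hessian matrix of
  \<open>F\<close>, is tangent to the cubic. Hence these fields vanish, and \<open>b\<close> leads to a singular point.\<close>

lemma row_relation_singular:
  assumes F: "F \<in> forms 3"
    and ab: "a \<noteq> 0 \<or> b \<noteq> 0"
    and rel: "\<And>x. tri F x x a + tri (hessian F) x x b = 0"
  shows "\<exists>x. x \<noteq> 0 \<and> sing_at F x"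
proof (cases "b = 0")
  case True
  \<comment> \<open>Here the derivative of \<open>F\<close> along \<open>a\<close> vanishes
    identically, so the cubic is a cone with vertex \<open>a\<close>.\<close>
  then have r: "tri F x x a = 0" for x using rel[of x] by simp
  have "tri F x y a = 0" for x y
  proof -
    have "tri F (x + y) (x + y) a = tri F x x a + tri F y y a + 2 * tri F x y a"
      by (simp add: tri_lin tri_swap12[of F y x])
    then show ?thesis using r by simp
  qed
  then have "sing_at F a" unfolding sing_at_def by (metis tri_rotate)
  then show ?thesis using ab True by blast
next
  case False
  show ?thesis
  proof (rule ccontr)
    assume "\<not> ?thesis"
    then have ns: "x \<noteq> 0 \<Longrightarrow> \<not> sing_at F x" for x by blast
    define f where "f y x = (det3 b y x / 2) *s a + cr (grad F x b) (grad F b y) + cr (grad F b b) (grad F x y)" for x y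
    have tang: "tri F x x (f y x) = 0" for x y
    proof -
      let ?m = "grad F x" and ?n = "grad F b"
      have "tri F x x (f y x) = dt (?m x) (f y x)" by (simp add: dt_grad)
      then have 1: "tri F x x (f y x) = det3 b y x / 2 * tri F x x a
          + (det3 (?m x) (?m b) (?n y) + det3 (?m x) (?n b) (?m y))"
        unfolding f_def dt_lin by (simp add: dt_grad det3_def)
      \<comment> \<open>In \<open>hessian_derivative\<close> for the triple \<open>x\<close>,
        \<open>b\<close>, \<open>y\<close> the first summand drops out, because
        \<open>grad F b x\<close> and \<open>grad F x b\<close> are the same vector.\<close>
      have 2: "det3 (?m x) (?m b) (?n y) + det3 (?m x) (?n b) (?m y) = tri (hessian F) x x b / 2 * det3 x b y"
        unfolding hessian_derivative[OF F] by (simp add: grad_commute[of F b x])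
      have 3: "det3 x b y = det3 b y x"
        by (simp add: det3_def dt_def algebra_simps)
      have "tri F x x (f y x) = (tri F x x a + tri (hessian F) x x b) * det3 b y x / 2"
        unfolding 1 2 3 by (simp add: algebra_simps add_divide_distrib)
      then show ?thesis by (simp add: rel)
    qed
    have f0: "f y x = 0" for x y
    proof -
      define B :: "complex ^ 3 ^ 3" where "B = (\<chi> i j. f y (axis j 1) $ i)"
      have fadd: "f y (p + q) = f y p + f y q" for p q
        unfolding f_def grad_lin cr_lin det3_lin
        by (simp add: vec_eq_iff algebra_simps add_divide_distrib)
      have fsc: "f y (c *s p) = c *s f y p" for c p
        unfolding f_def grad_lin cr_lin det3_lin
        by (simp add: vec_eq_iff algebra_simps)
      have fB: "f y x = B *v x" for x
      proof -
        have "f y x = f y (x $ 1 *s axis 1 1 + x $ 2 *s axis 2 1 + x $ 3 *s axis 3 1)"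
          by (rule arg_cong[of _ _ "f y"]) (rule vec3_eqI; simp add: axis_def)
        also have "\<dots> = B *v x"
          unfolding fadd fsc by (simp add: vec_eq_iff B_def matrix_vector_mult_def sum_3 mult_ac)
        finally show ?thesis .
      qed
      have "B = 0"
        using tangent_field_singular[of F B] tang[of _ y] ns unfolding fB by blast
      then show ?thesis by (simp add: fB)
    qed
    define n where "n = grad F b b"
    have n0: "n \<noteq> 0" using ns[OF False] by (auto simp: n_def grad_eq_0_iff sing_at_def)
    \<comment> \<open>At \<open>x = b\<close> the term with \<open>a\<close> vanishes and the two
      cross products coincide, so every \<open>grad F b y\<close> is proportional to
      \<open>n\<close>.\<close>
    have cn: "cr n (grad F b y) = 0" for y
    proof -
      have "f y b = 2 *s cr n (grad F b y)" by (simp add: f_def n_def vec_eq_iff)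
      then show ?thesis using f0[of y b] by simp
    qed
    \<comment> \<open>Proportionality of all \<open>grad F b y\<close> to \<open>n\<close> means
      that the quadratic form \<open>tri F b\<close> is, up to a factor, the square of the linear
      form \<open>n\<close>.\<close>
    have key: "tri F b b b * tri F b y z = tri F b b y * tri F b b z" for y z
    proof -
      have "dt (cr n (grad F b y)) (cr b z) = 0" by (simp add: cn)
      then show ?thesis by (simp add: dt_cr_cr n_def dt_grad tri_rotate[of F b y b, symmetric] tri_swap23[of F b y b] mult_ac)
    qed
    have bbb: "tri F b b b \<noteq> 0"
    proof
      assume "tri F b b b = 0"
      then have "tri F b b y = 0" for y using key[of y y] by simp
      then show False using n0 by (simp add: n_def grad_eq_0_iff)
    qed
    \<comment> \<open>The first condition on \<open>y\<close> puts it into the kernel of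
      \<open>tri F b\<close>; the second makes \<open>a\<close>, \<open>b\<close>, \<open>y\<close>
      dependent, so that pairing \<open>f y x\<close> with \<open>cr b y\<close> removes the term
      with \<open>a\<close>.\<close>
    obtain y where y: "y \<noteq> 0" "dt n y = 0" "dt (cr a b) y = 0" by (rule common_orthogonal)
    have bby: "tri F b b y = 0" using y(2) by (simp add: n_def dt_grad)
    then have by0: "tri F b y z = 0" for z using key[of y z] bbb by simp
    have "tri F y y x = 0" for x
    proof -
      have gby: "grad F b y = 0" by (simp add: grad_eq_0_iff by0)
      have fyx: "f y x = (det3 b y x / 2) *s a + cr n (grad F x y)"
        by (simp add: f_def gby n_def)
      then have "dt ((det3 b y x / 2) *s a + cr n (grad F x y)) (cr b y) = 0"
        by (simp flip: fyx add: f0)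
      moreover have "dt a (cr b y) = 0"
        using y(3) by (simp add: dt_def algebra_simps)
      ultimately have "dt (cr n (grad F x y)) (cr b y) = 0" by (simp add: dt_lin)
      then have "tri F b b b * tri F x y y - tri F b b y * tri F x y b = 0"
        unfolding dt_cr_cr by (simp add: n_def dt_grad)
      then have "tri F x y y = 0" using bby bbb by simp
      then show ?thesis by (metis tri_rotate)
    qed
    then have "sing_at F y" by (simp add: sing_at_def)
    then show False using ns[OF y(1)] by blast
  qed
qed

subsection \<open>Quadrics by their coefficients\<close>

lemma lookup_quad_monom:
  "Poly_Mapping.lookup (quad_monom (Inl j)) i = (if i = j then 2 else 0)"
  "Poly_Mapping.lookup (quad_monom (Inr j)) i = (if i = j then 0 else 1)"
  using exhaust_3[of i] exhaust_3[of j]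
  by (auto simp: quad_monom_def lookup_add lookup_single when_def)

lemma quad_monom_inj: "inj quad_monom"
proof (rule injI)
  fix s t :: "3 + 3"
  assume e: "quad_monom s = quad_monom t"
  have *: "Poly_Mapping.lookup (quad_monom s) i = Poly_Mapping.lookup (quad_monom t) i" for i
    by (simp add: e)
  show "s = t"
  proof (cases s)
    case (Inl j)
    then show ?thesis using *[of j] by (cases t) (simp_all add: lookup_quad_monom split: if_splits)
  next
    case (Inr j)
    then show ?thesis using *[of j] *[of "case t of Inl k \<Rightarrow> k | Inr k \<Rightarrow> k"]
      by (cases t) (simp_all add: lookup_quad_monom split: if_splits)
  qed
qed

lemma quad_monom_surj:
  assumes "mdeg m = 2"
  obtains s where "m = quad_monom s"
proof -
  let ?l = "Poly_Mapping.lookup m"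
  have sm: "?l 1 + ?l 2 + ?l 3 = 2" using assms by (simp add: mdeg_3)
  then have "?l 1 = 0 \<or> ?l 1 = 1 \<or> ?l 1 = 2" "?l 2 = 0 \<or> ?l 2 = 1 \<or> ?l 2 = 2" by linarith+
  then consider "?l 1 = 2" "?l 2 = 0" "?l 3 = 0" | "?l 1 = 0" "?l 2 = 2" "?l 3 = 0"
    | "?l 1 = 0" "?l 2 = 0" "?l 3 = 2" | "?l 1 = 0" "?l 2 = 1" "?l 3 = 1"
    | "?l 1 = 1" "?l 2 = 0" "?l 3 = 1" | "?l 1 = 1" "?l 2 = 1" "?l 3 = 0"
    using sm by (elim disjE) simp_all
  then show thesis
  proof cases
    case 1 show thesis by (rule that[of "Inl 1"], rule monomial_eqI) (simp_all add: lookup_quad_monom 1)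
  next
    case 2 show thesis by (rule that[of "Inl 2"], rule monomial_eqI) (simp_all add: lookup_quad_monom 2)
  next
    case 3 show thesis by (rule that[of "Inl 3"], rule monomial_eqI) (simp_all add: lookup_quad_monom 3)
  next
    case 4 show thesis by (rule that[of "Inr 1"], rule monomial_eqI) (simp_all add: lookup_quad_monom 4)
  next
    case 5 show thesis by (rule that[of "Inr 2"], rule monomial_eqI) (simp_all add: lookup_quad_monom 5)
  next
    case 6 show thesis by (rule that[of "Inr 3"], rule monomial_eqI) (simp_all add: lookup_quad_monom 6)
  qed
qed

definition quad_value :: "3 + 3 \<Rightarrow> complex ^ 3 \<Rightarrow> complex" where
  "quad_value s x = tpoly_eval (Poly_Mapping.single (quad_monom s) 1) x"

lemma quad_value_Inl: "quad_value (Inl j) x = (x $ j) ^ 2"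
  using exhaust_3[of j] by (auto simp: quad_value_def tpoly_eval_single prod_3 lookup_quad_monom)

lemma quadric_eval:
  assumes "Q \<in> forms 2"
  shows "tpoly_eval Q x = (\<Sum>s\<in>UNIV. Poly_Mapping.lookup Q (quad_monom s) * quad_value s x)"
  using assms
proof (induction rule: forms_induct)
  case (single m c)
  then obtain s where s: "m = quad_monom s" by (rule quad_monom_surj)
  have "(\<Sum>t\<in>UNIV. Poly_Mapping.lookup (Poly_Mapping.single m c) (quad_monom t) * quad_value t x) =
      (\<Sum>t\<in>UNIV. if t = s then c * quad_value s x else 0)"
    by (intro sum.cong refl) (auto simp: s lookup_single when_def inj_eq[OF quad_monom_inj])
  then show ?case by (simp add: quad_value_def s tpoly_eval_single)
qed (simp add: lookup_add distrib_right sum.distrib)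

definition disc_quadric :: "tpoly \<Rightarrow> 3 + 3 \<Rightarrow> tpoly" where
  "disc_quadric F r = (case r of Inl i \<Rightarrow> pd i F | Inr i \<Rightarrow> pd i (hessian F))"

lemma disc_quadric_forms: "F \<in> forms 3 \<Longrightarrow> disc_quadric F r \<in> forms 2"
  by (cases r) (simp_all add: disc_quadric_def pd_forms3 hessian_forms)

lemma sum_UNIV_Plus: "(\<Sum>r\<in>UNIV. f r) = (\<Sum>i\<in>UNIV. f (Inl i)) + (\<Sum>i\<in>UNIV. f (Inr i))"
  for f :: "'a::finite + 'b::finite \<Rightarrow> 'c::comm_monoid_add"
  by (simp add: UNIV_Plus_UNIV[symmetric] sum.Plus del: UNIV_Plus_UNIV)

text \<open>A singular point is a common zero of the six quadrics, so the vector of its quadratic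
  monomials lies in the kernel of the coefficient matrix; it is nonzero because it contains the
  squares. Conversely a kernel vector of the transpose is a relation between the rows, and its
  halves are the vectors \<open>a\<close> and \<open>b\<close> of
  \<open>row_relation_singular\<close>.\<close>

theorem discriminant_0_iff:
  assumes F: "F \<in> forms 3"
  shows "discriminant F = 0 \<longleftrightarrow> singular_form F"
proof -
  define D :: "complex ^ (3 + 3) ^ (3 + 3)" where
    "D = (\<chi> r s. Poly_Mapping.lookup (disc_quadric F r) (quad_monom s))"
  have disc: "discriminant F = det D" by (simp add: discriminant_def D_def disc_quadric_def)
  have ev: "tpoly_eval (disc_quadric F r) x = (\<Sum>s\<in>UNIV. D $ r $ s * quad_value s x)" for r x
    using quadric_eval[OF disc_quadric_forms[OF F]] by (simp add: D_def)
  show ?thesis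
  proof
    assume "singular_form F"
    then obtain x where x: "x \<noteq> 0" "sing_at F x" using singular_form_iff[OF F] by blast
    have "tpoly_eval (disc_quadric F r) x = 0" for r
      using x hessian_sing_at[OF F x(2,1)]
      by (cases r) (simp_all add: disc_quadric_def pd_eval[OF F] pd_eval[OF hessian_forms[OF F]] sing_at_def)
    then have "D *v (\<chi> s. quad_value s x) = 0"
      by (simp add: vec_eq_iff matrix_vector_mult_def flip: ev)
    moreover have "(\<chi> s. quad_value s x) \<noteq> 0"
    proof
      assume "(\<chi> s. quad_value s x) = 0"
      then have "quad_value (Inl j) x = 0" for j by (simp add: vec_eq_iff)
      then show False using x(1) by (simp add: quad_value_Inl vec_eq_iff)
    qed
    ultimately show "discriminant F = 0" unfolding disc by (rule det_kernel_singular)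
  next
    assume "discriminant F = 0"
    then have "det (transpose D) = 0" by (simp add: disc det_transpose)
    then obtain c where c: "c \<noteq> 0" "transpose D *v c = 0" by (rule det_singular_kernel)
    define a b where "a = (\<chi> i. c $ Inl i)" and "b = (\<chi> i. c $ Inr i)"
    have "a \<noteq> 0 \<or> b \<noteq> 0"
    proof (rule ccontr)
      assume "\<not> ?thesis"
      then have z: "c $ Inl i = 0" "c $ Inr i = 0" for i by (simp_all add: a_def b_def vec_eq_iff)
      have "c $ r = 0" for r using z by (cases r) simp_all
      then show False using c(1) by (simp add: vec_eq_iff)
    qed
    moreover have "tri F x x a + tri (hessian F) x x b = 0" for x
    proof -
      have e: "tri G x x (\<chi> i. d i) = 2 * (\<Sum>i\<in>UNIV. d i * tpoly_eval (pd i G) x)" if "G \<in> forms 3" for G d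
      proof -
        have "tri G x x (\<chi> i. d i) = (\<Sum>i\<in>UNIV. d i * tri G (axis i 1) x x)"
          by (subst tri_rotate, subst tri_rotate, subst tri_expand) simp
        also have "\<dots> = (\<Sum>i\<in>UNIV. 2 * (d i * tpoly_eval (pd i G) x))"
          by (intro sum.cong refl) (simp add: pd_eval[OF that] tri_rotate[of G "axis _ 1"])
        finally show ?thesis by (simp add: sum_distrib_left)
      qed
      have "(\<Sum>r\<in>UNIV. c $ r * tpoly_eval (disc_quadric F r) x) =
          (\<Sum>r\<in>UNIV. \<Sum>s\<in>UNIV. c $ r * (D $ r $ s * quad_value s x))"
        by (simp add: ev sum_distrib_left)
      also have "\<dots> = (\<Sum>s\<in>UNIV. \<Sum>r\<in>UNIV. c $ r * (D $ r $ s * quad_value s x))"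
        by (rule sum.swap)
      also have "\<dots> = (\<Sum>s\<in>UNIV. (transpose D *v c) $ s * quad_value s x)"
        by (simp add: matrix_vector_mult_def transpose_def sum_distrib_left mult_ac)
      also have "\<dots> = 0" by (simp only: c(2)) simp
      finally have "(\<Sum>i\<in>UNIV. c $ Inl i * tpoly_eval (pd i F) x) +
          (\<Sum>i\<in>UNIV. c $ Inr i * tpoly_eval (pd i (hessian F)) x) = 0"
        by (simp add: sum_UNIV_Plus disc_quadric_def)
      then show ?thesis
        unfolding a_def b_def e[OF F] e[OF hessian_forms[OF F]] by (simp flip: distrib_left)
    qed
    ultimately show "singular_form F"
      using row_relation_singular[OF F] singular_form_iff[OF F] by blast
  qed
qed


section \<open>Lines\<close>

definition lf :: "complex ^ 3 \<Rightarrow> tpoly" where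
  "lf a = (\<Sum>i\<in>UNIV. Poly_Mapping.single (Poly_Mapping.single i 1) (a $ i))"

lemma mdeg_single: "mdeg (Poly_Mapping.single i n) = n"
  by (simp add: mdeg_def lookup_single when_def)

lemma lf_forms [simp]: "lf a \<in> forms 1"
  unfolding lf_def by (intro forms_sum single_in_forms mdeg_single)

lemma eval_lf [simp]: "tpoly_eval (lf a) x = dt a x"
proof -
  have "tpoly_eval (Poly_Mapping.single (Poly_Mapping.single i 1) (a $ i)) x = a $ i * x $ i" for i :: 3
    using exhaust_3[of i] by (auto simp: tpoly_eval_single prod_3 lookup_single when_def)
  then show ?thesis by (simp add: lf_def tpoly_eval_sum sum_3 dt_def)
qed

lemma lf_0_iff [simp]: "lf a = 0 \<longleftrightarrow> a = 0"
proof
  assume "lf a = 0"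
  then have "dt a y = 0" for y by (metis eval_lf tpoly_eval_0)
  then show "a = 0" by (rule dt_nondegenerate)
qed (simp add: lf_def)

lemma lf_add: "lf (a + b) = lf a + lf b" and lf_scale: "lf (c *s a) = smul c (lf a)"
  by (rule tpoly_eqI; simp add: dt_lin)+

lemma forms_1_lf:
  assumes "l \<in> forms 1"
  obtains a where "l = lf a"
proof
  show "l = lf (\<chi> i. tpoly_eval (pd i l) 0)"
  proof (rule tpoly_eqI)
    fix x
    have "tpoly_eval l x = (\<Sum>i\<in>UNIV. x $ i * tpoly_eval (pd i l) x)"
      using euler[OF assms, of x] by simp
    also have "\<dots> = (\<Sum>i\<in>UNIV. x $ i * tpoly_eval (pd i l) 0)"
      by (intro sum.cong refl) (metis eval_form_0[OF pd_forms1[OF assms]])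
    finally show "tpoly_eval l x = tpoly_eval (lf (\<chi> i. tpoly_eval (pd i l) 0)) x"
      by (simp add: sum_3 dt_def mult_ac)
  qed
qed

section \<open>Restriction of a form to a line\<close>

lemma coeff_mult_top:
  assumes "degree p \<le> d" "degree q \<le> e"
  shows "coeff (p * q) (d + e) = coeff p d * coeff q e"
proof -
  have "coeff (p * q) (d + e) = (\<Sum>i\<le>d + e. if i = d then coeff p d * coeff q e else 0)"
    unfolding coeff_mult
  proof (rule sum.cong[OF refl])
    fix i assume "i \<in> {..d + e}"
    consider "i < d" | "i = d" | "i > d" by linarith
    then show "coeff p i * coeff q (d + e - i) = (if i = d then coeff p d * coeff q e else 0)"
    proof cases
      case 1
      then have "coeff q (d + e - i) = 0" using assms(2) by (intro coeff_eq_0) simp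
      then show ?thesis using 1 by simp
    next
      case 3
      then have "coeff p i = 0" using assms(1) by (intro coeff_eq_0) simp
      then show ?thesis using 3 by simp
    qed simp
  qed
  then show ?thesis by simp
qed

lemma degree_coeff_power:
  fixes a b :: complex
  shows "degree ([:a, b:] ^ n) \<le> n \<and> coeff ([:a, b:] ^ n) n = b ^ n"
proof (induction n)
  case (Suc n)
  have "degree [:a, b:] \<le> 1" by simp
  then show ?case
    using Suc coeff_mult_top[of "[:a, b:]" 1 "[:a, b:] ^ n" n] degree_mult_le[of "[:a, b:]" "[:a, b:] ^ n"]
    by (simp del: degree_pCons_eq_if)
qed simp

text \<open>The parametrization misses the point \<open>v\<close> of the line. The coefficient of
  degree \<open>d\<close> is recorded because it is the value there, so a zero at \<open>v\<close>
  shows up as a drop of the degree.\<close>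

lemma restrict_to_line:
  assumes "F \<in> forms d"
  shows "\<exists>p. degree p \<le> d \<and> coeff p d = tpoly_eval F v \<and> (\<forall>t. poly p t = tpoly_eval F (x + t *s v))"
  using assms
proof (induction rule: forms_induct)
  case (single m c)
  define P where "P i = [:x $ i, v $ i:] ^ Poly_Mapping.lookup m i" for i
  have P: "degree (P i) \<le> Poly_Mapping.lookup m i" "coeff (P i) (Poly_Mapping.lookup m i) = v $ i ^ Poly_Mapping.lookup m i" for i
    using degree_coeff_power unfolding P_def by blast+
  have d12: "degree (P 1 * P 2) \<le> Poly_Mapping.lookup m 1 + Poly_Mapping.lookup m 2"
    using degree_mult_le[of "P 1" "P 2"] P(1)[of 1] P(1)[of 2] by linarith
  have d123: "degree (P 1 * P 2 * P 3) \<le> d"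
    using degree_mult_le[of "P 1 * P 2" "P 3"] P(1)[of 3] d12 single by (simp add: mdeg_3)
  have "coeff (P 1 * P 2 * P 3) d = v $ 1 ^ Poly_Mapping.lookup m 1 * v $ 2 ^ Poly_Mapping.lookup m 2 * v $ 3 ^ Poly_Mapping.lookup m 3"
    using coeff_mult_top[OF d12 P(1)[of 3]] coeff_mult_top[OF P(1)[of 1] P(1)[of 2]] P(2) single
    by (simp add: mdeg_3)
  moreover have "poly (P 1 * P 2 * P 3) t = (\<Prod>i\<in>UNIV. (x + t *s v) $ i ^ Poly_Mapping.lookup m i)" for t
    by (simp add: P_def prod_3 poly_power mult_ac)
  ultimately show ?case using d123
    by (intro exI[of _ "smult c (P 1 * P 2 * P 3)"])
      (simp add: tpoly_eval_single prod_3 order_trans[OF degree_smult_le])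
next
  case (add F G)
  then obtain p q where "degree p \<le> d" "coeff p d = tpoly_eval F v" "\<forall>t. poly p t = tpoly_eval F (x + t *s v)"
    "degree q \<le> d" "coeff q d = tpoly_eval G v" "\<forall>t. poly q t = tpoly_eval G (x + t *s v)"
    by blast
  then show ?case by (intro exI[of _ "p + q"]) (simp add: degree_add_le)
qed

text \<open>Vectors stand for projective points. Excluding proportional pairs makes the cardinality
  of the set the number of points.\<close>

definition distinct_points :: "(complex ^ 3) set \<Rightarrow> bool" where
  "distinct_points S \<longleftrightarrow> 0 \<notin> S \<and> (\<forall>x\<in>S. \<forall>y\<in>S. x \<noteq> y \<longrightarrow> cr x y \<noteq> 0)"

lemma distinct_points_subset: "distinct_points S \<Longrightarrow> T \<subseteq> S \<Longrightarrow> distinct_points T"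
  by (auto simp: distinct_points_def)

lemma cr_swap: "cr b a = - cr a b"
  by (rule vec3_eqI; simp)

lemma line_span:
  assumes "cr a b \<noteq> 0" "l \<noteq> 0" "dt l a = 0" "dt l b = 0" "dt l x = 0"
  obtains \<alpha> \<beta> where "x = \<alpha> *s a + \<beta> *s b"
proof -
  have "det3 a b x = 0"
    by (rule det3_orthogonal[of _ l]) (use assms dt_commute in metis)+
  then obtain k :: "complex ^ 3" where k: "k \<noteq> 0" "k $ 1 *s a + k $ 2 *s b + k $ 3 *s x = 0"
    by (rule det3_eq_0_dependent)
  have "k $ 3 \<noteq> 0"
  proof
    assume k3: "k $ 3 = 0"
    have "cr a (k $ 1 *s a + k $ 2 *s b) = 0" "cr (k $ 1 *s a + k $ 2 *s b) b = 0" using k(2) k3 by simp_all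
    then have "k $ 2 = 0" "k $ 1 = 0" using assms(1) by (simp_all add: cr_lin)
    then show False using k(1) k3 by (auto intro: vec3_eqI)
  qed
  moreover have "k $ 3 *s x = - (k $ 1 *s a + k $ 2 *s b)"
    using minus_unique[OF k(2)] by simp
  ultimately have "x = (1 / k $ 3) *s (- (k $ 1 *s a + k $ 2 *s b))"
    by (metis (no_types, lifting) divide_self_if times_divide_eq_left mult_1 vector_smult_assoc vector_smult_lid)
  also have "\<dots> = (- k $ 1 / k $ 3) *s a + (- k $ 2 / k $ 3) *s b"
    by (rule vec3_eqI; simp add: algebra_simps add_divide_distrib diff_divide_distrib)
  finally show thesis by (rule that)
qed

text \<open>A binary form of degree \<open>d\<close> with more than \<open>d\<close> zeros is 0. One
  point \<open>b\<close> of \<open>S\<close> is placed at infinity, where its zero lowers the degree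
  of the restriction below \<open>d\<close>; the others give at least \<open>d\<close>
  roots.\<close>

lemma line_vanish:
  assumes F: "F \<in> forms d" and S: "distinct_points S" "finite S" "card S > d" and "d > 0"
    and l: "l \<noteq> 0" "\<And>x. x \<in> S \<Longrightarrow> dt l x = 0" and FS: "\<And>x. x \<in> S \<Longrightarrow> tpoly_eval F x = 0"
    and x: "dt l x = 0"
  shows "tpoly_eval F x = 0"
proof -
  have "S \<noteq> {}" using S by auto
  then obtain b where b: "b \<in> S" by blast
  have "S - {b} \<noteq> {}" using S b \<open>d > 0\<close> by (auto simp: subset_singleton_iff)
  then obtain a where a: "a \<in> S" "a \<noteq> b" by blast
  have ab: "cr a b \<noteq> 0" using S(1) a b by (auto simp: distinct_points_def)
  obtain p where p: "degree p \<le> d" "coeff p d = tpoly_eval F b" "\<And>t. poly p t = tpoly_eval F (a + t *s b)"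
    using restrict_to_line[OF F, of b a] by blast
  have "\<exists>\<alpha> \<beta>. s = \<alpha> *s a + \<beta> *s b" if "s \<in> S" for s
    using line_span[OF ab l(1) l(2)[OF a(1)] l(2)[OF b] l(2)[OF that]] by metis
  then obtain \<alpha> \<beta> where ex: "\<And>s. s \<in> S \<Longrightarrow> s = \<alpha> s *s a + \<beta> s *s b" by metis
  have \<alpha>0: "\<alpha> s \<noteq> 0" if "s \<in> S - {b}" for s
  proof
    assume "\<alpha> s = 0"
    then have "s = \<beta> s *s b" using ex that by force
    then have "cr s b = 0" by (metis cr_scale(1) cr_self vector_smult_rzero)
    then show False using S(1) that b by (auto simp: distinct_points_def)
  qed
  define \<tau> where "\<tau> s = \<beta> s / \<alpha> s" for s
  have s: "s = \<alpha> s *s (a + \<tau> s *s b)" if "s \<in> S - {b}" for s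
    using ex[of s] \<alpha>0[OF that] that by (simp add: \<tau>_def vector_add_ldistrib)
  have inj: "inj_on \<tau> (S - {b})"
  proof (rule inj_onI)
    fix s t assume st: "s \<in> S - {b}" "t \<in> S - {b}" "\<tau> s = \<tau> t"
    have "cr s t = cr (\<alpha> s *s (a + \<tau> s *s b)) (\<alpha> t *s (a + \<tau> s *s b))"
      using s[OF st(1)] s[OF st(2)] st(3) by simp
    then have "cr s t = 0" by (simp only: cr_scale cr_self vector_smult_rzero)
    then show "s = t" using S(1) st by (auto simp: distinct_points_def)
  qed
  have root: "poly p (\<tau> s) = 0" if "s \<in> S - {b}" for s
  proof -
    have "tpoly_eval F s = tpoly_eval F (\<alpha> s *s (a + \<tau> s *s b))"
      by (rule arg_cong[OF s[OF that]])
    also have "\<dots> = \<alpha> s ^ d * poly p (\<tau> s)" by (simp only: tpoly_eval_scale[OF F] p(3))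
    finally show ?thesis using \<alpha>0[OF that] FS[of s] that by simp
  qed
  have "p = 0"
  proof (rule ccontr)
    assume "p \<noteq> 0"
    have "coeff p d = 0" using p(2) FS[OF b] by simp
    then have "degree p \<noteq> d" using \<open>p \<noteq> 0\<close> leading_coeff_0_iff by blast
    then have "degree p < d" using p(1) by simp
    have "card (S - {b}) = card (\<tau> ` (S - {b}))" using card_image[OF inj] by simp
    also have "\<dots> \<le> card {t. poly p t = 0}"
      using root by (intro card_mono poly_roots_finite[OF \<open>p \<noteq> 0\<close>]) auto
    also have "\<dots> \<le> degree p" by (rule card_poly_roots_bound[OF \<open>p \<noteq> 0\<close>])
    finally show False using \<open>degree p < d\<close> S b by simp
  qed
  obtain \<mu> \<nu> where x': "x = \<mu> *s a + \<nu> *s b"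
    using line_span[OF ab l(1) l(2)[OF a(1)] l(2)[OF b] x] .
  show ?thesis
  proof (cases "\<mu> = 0")
    case True
    then show ?thesis using x' FS[OF b] by (simp add: tpoly_eval_scale[OF F])
  next
    case False
    then have "x = \<mu> *s (a + (\<nu> / \<mu>) *s b)" using x' by (simp add: vector_add_ldistrib)
    then have "tpoly_eval F x = \<mu> ^ d * poly p (\<nu> / \<mu>)" by (simp only: tpoly_eval_scale[OF F] p(3))
    then show ?thesis using \<open>p = 0\<close> by simp
  qed
qed

text \<open>Modulo the linear form \<open>a\<close>, every polynomial is congruent to its composition with a
  projection onto the line \<open>a = 0\<close>.\<close>

lemma line_divides:
  assumes F: "F \<in> forms (Suc d)" and a: "a \<noteq> 0"
    and van: "\<And>x. dt a x = 0 \<Longrightarrow> tpoly_eval F x = 0"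
  obtains Q where "Q \<in> forms d" "F = lf a * Q"
proof -
  obtain w where w: "dt a w = 1"
  proof -
    obtain i where "a $ i \<noteq> 0" using a by (auto simp: vec_eq_iff)
    then have "dt a ((1 / a $ i) *s axis i 1) = 1" by (simp add: dt_lin dt_axis)
    then show thesis by (rule that)
  qed
  \<comment> \<open>\<open>Y i\<close> is the \<open>i\<close>-th coordinate of the projection
    \<open>x - dt a x *s w\<close> and is congruent to the \<open>i\<close>-th variable modulo
    \<open>lf a\<close>.\<close>
  define Y where "Y i = lf (axis i 1) - smul (w $ i) (lf a)" for i
  have evY: "tpoly_eval (Y i) x = (x - dt a x *s w) $ i" for i x
    by (simp add: Y_def dt_axis)
  have "\<exists>G. lf a dvd F - G \<and> (\<forall>x. tpoly_eval G x = tpoly_eval F (x - dt a x *s w))"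
  proof (induction F rule: tpoly_induct)
    case (single m c)
    have single: "Poly_Mapping.single m c = smul c (\<Prod>i\<in>UNIV. lf (axis i 1) ^ Poly_Mapping.lookup m i)"
      by (rule tpoly_eqI) (simp add: tpoly_eval_single tpoly_eval_prod tpoly_eval_power dt_axis)
    have pow: "lf a dvd A ^ n - B ^ n" if "lf a dvd A - B" for A B :: tpoly and n
      using that
    proof (induction n)
      case (Suc n)
      have "A ^ Suc n - B ^ Suc n = A * (A ^ n - B ^ n) + (A - B) * B ^ n" by (simp add: algebra_simps)
      then show ?case using Suc by (metis dvd_add dvd_mult dvd_mult2)
    qed simp
    have mul: "lf a dvd A * C - B * D" if "lf a dvd A - B" "lf a dvd C - D" for A B C D :: tpoly
    proof -
      have "A * C - B * D = A * (C - D) + (A - B) * D" by (simp add: algebra_simps)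
      then show ?thesis using that by (metis dvd_add dvd_mult dvd_mult2)
    qed
    have 1: "lf a dvd lf (axis i 1) - Y i" for i
      by (simp add: Y_def smul_def)
    define G where "G = smul c (\<Prod>i\<in>UNIV. Y i ^ Poly_Mapping.lookup m i)"
    have "lf a dvd (\<Prod>i\<in>UNIV. lf (axis i 1) ^ Poly_Mapping.lookup m i) - (\<Prod>i\<in>UNIV. Y i ^ Poly_Mapping.lookup m i)"
      unfolding prod_3 by (intro mul pow 1)
    then have "lf a dvd Poly_Mapping.single m c - G"
      unfolding single G_def smul_diff[symmetric] by (simp add: smul_def)
    moreover have "tpoly_eval G x = tpoly_eval (Poly_Mapping.single m c) (x - dt a x *s w)" for x
      by (simp add: G_def tpoly_eval_prod tpoly_eval_power evY tpoly_eval_single)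
    ultimately show ?case by blast
  next
    case (add F G)
    then obtain F' G' where "lf a dvd F - F'" "\<forall>x. tpoly_eval F' x = tpoly_eval F (x - dt a x *s w)"
      "lf a dvd G - G'" "\<forall>x. tpoly_eval G' x = tpoly_eval G (x - dt a x *s w)" by blast
    then show ?case by (intro exI[of _ "F' + G'"]) (simp add: add_diff_add)
  qed
  then obtain G where G: "lf a dvd F - G" "\<And>x. tpoly_eval G x = tpoly_eval F (x - dt a x *s w)" by blast
  have "dt a (x - dt a x *s w) = 0" for x by (simp add: dt_lin w)
  then have "tpoly_eval G x = 0" for x using G(2) van by simp
  then have "G = 0" by (rule tpoly_eq_0)
  then obtain Q where Q: "F = lf a * Q" using G(1) by (auto elim: dvdE)
  show thesis
  proof (cases "F = 0")
    case True
    then show thesis using that[of 0] by simp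
  next
    case False
    obtain k where k: "k \<le> Suc d" "Q \<in> forms k" "lf a \<in> forms (Suc d - k)"
      using factor_of_form[OF F False, of Q "lf a"] Q by (metis mult.commute)
    have "lf a \<noteq> 0" using a by simp
    then obtain m where "Poly_Mapping.lookup (lf a) m \<noteq> 0" by (metis poly_mapping_eqI lookup_zero)
    then have "Suc d - k = 1" using k(3) lf_forms[of a] unfolding forms_iff by metis
    then have "k = d" by simp
    then show thesis using that Q k(2) by simp
  qed
qed

subsection \<open>Forms through given points\<close>

text \<open>Gaussian elimination: equation \<open>j\<close> is solved for the unknown with index
  \<open>k\<close> and substituted into the others, whose coefficients become
  \<open>g\<close>.\<close>

lemma underdetermined:
  fixes f :: "'j \<Rightarrow> 'i \<Rightarrow> complex"
  assumes "finite J" "finite I" "card J < card I"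
  shows "\<exists>c. (\<exists>i\<in>I. c i \<noteq> 0) \<and> (\<forall>j\<in>J. (\<Sum>i\<in>I. c i * f j i) = 0)"
  using assms
proof (induction J arbitrary: I f rule: finite_induct)
  case empty
  then have "I \<noteq> {}" by auto
  then show ?case by (intro exI[of _ "\<lambda>_. 1"]) auto
next
  case (insert j J)
  show ?case
  proof (cases "\<forall>i\<in>I. f j i = 0")
    case True
    obtain c where c: "\<exists>i\<in>I. c i \<noteq> 0" "\<forall>j\<in>J. (\<Sum>i\<in>I. c i * f j i) = 0"
      using insert.IH[of I f] insert.prems insert.hyps by auto
    then show ?thesis using True by (intro exI[of _ c]) auto
  next
    case False
    then obtain k where k: "k \<in> I" "f j k \<noteq> 0" by blast
    define g where "g j' i = f j' i - f j' k / f j k * f j i" for j' i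
    have "card J < card (I - {k})" using insert.prems insert.hyps k by simp
    then obtain c where c: "\<exists>i\<in>I - {k}. c i \<noteq> 0" "\<forall>j'\<in>J. (\<Sum>i\<in>I - {k}. c i * g j' i) = 0"
      using insert.IH[of "I - {k}" g] insert.prems by auto
    define S where "S j' = (\<Sum>i\<in>I - {k}. c i * f j' i)" for j'
    define c' where "c' i = (if i = k then - S j / f j k else c i)" for i
    have sum: "(\<Sum>i\<in>I. c' i * f j' i) = S j' - S j / f j k * f j' k" for j'
    proof -
      have "(\<Sum>i\<in>I. c' i * f j' i) = c' k * f j' k + (\<Sum>i\<in>I - {k}. c' i * f j' i)"
        using insert.prems k by (intro sum.remove) auto
      also have "(\<Sum>i\<in>I - {k}. c' i * f j' i) = S j'"
        unfolding S_def by (intro sum.cong) (auto simp: c'_def)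
      finally show ?thesis by (simp add: c'_def)
    qed
    have "S j' - S j / f j k * f j' k = 0" if "j' \<in> J" for j'
    proof -
      have "(\<Sum>i\<in>I - {k}. c i * g j' i) = S j' - f j' k / f j k * S j"
        by (simp add: g_def S_def sum_subtractf sum_distrib_left algebra_simps)
      then show ?thesis using c(2) that by (simp add: mult_ac)
    qed
    moreover have "S j - S j / f j k * f j k = 0" using k by simp
    moreover have "\<exists>i\<in>I. c' i \<noteq> 0" using c(1) by (auto simp: c'_def)
    ultimately show ?thesis using sum by (intro exI[of _ c']) auto
  qed
qed

text \<open>The pairs are the exponents of the first two variables in the monomials of degree
  \<open>d\<close>; there are 6 of them for conics and 10 for cubics, more than the conditions
  imposed.\<close>

lemma form_through_points:
  assumes "finite S" "card S < card {(a, b). a + b \<le> d}"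
  obtains F where "F \<in> forms d" "F \<noteq> 0" "\<And>x. x \<in> S \<Longrightarrow> tpoly_eval F x = 0"
proof -
  define I where "I = {(a, b). a + b \<le> d}"
  define mon where "mon = (\<lambda>(a, b). Poly_Mapping.single 1 a + Poly_Mapping.single 2 b + Poly_Mapping.single (3::3) (d - a - b))"
  have "I \<subseteq> {..d} \<times> {..d}" by (auto simp: I_def)
  then have "finite I" by (rule finite_subset) simp
  have lk: "Poly_Mapping.lookup (mon i) 1 = fst i" "Poly_Mapping.lookup (mon i) 2 = snd i"
    "Poly_Mapping.lookup (mon i) 3 = d - fst i - snd i" for i
    by (simp_all add: mon_def lookup_add lookup_single when_def split: prod.split)
  have inj: "mon i = mon j \<longleftrightarrow> i = j" for i j
  proof
    assume e: "mon i = mon j"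
    show "i = j"
      using lk(1)[of i] lk(1)[of j] lk(2)[of i] lk(2)[of j] e by (simp add: prod_eq_iff)
  qed simp
  have "card S < card I" using assms(2) by (simp only: I_def)
  from underdetermined[OF assms(1) \<open>finite I\<close> this, of "\<lambda>x i. tpoly_eval (Poly_Mapping.single (mon i) 1) x"]
  obtain c where c: "\<exists>i\<in>I. c i \<noteq> 0"
    "\<forall>x\<in>S. (\<Sum>i\<in>I. c i * tpoly_eval (Poly_Mapping.single (mon i) 1) x) = 0"
    by blast
  define F where "F = (\<Sum>i\<in>I. Poly_Mapping.single (mon i) (c i))"
  have "F \<in> forms d"
    unfolding F_def
    by (intro forms_sum single_in_forms) (auto simp: I_def mdeg_3 lk)
  moreover have "F \<noteq> 0"
  proof -
    obtain k where k: "k \<in> I" "c k \<noteq> 0" using c(1) by blast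
    have "Poly_Mapping.lookup F (mon k) = (\<Sum>i\<in>I. if i = k then c i else 0)"
      unfolding F_def lookup_sum by (intro sum.cong refl) (auto simp: lookup_single when_def inj)
    also have "\<dots> = c k" using k \<open>finite I\<close> by simp
    finally show ?thesis using k(2) by auto
  qed
  moreover have "tpoly_eval F x = 0" if "x \<in> S" for x
  proof -
    have "tpoly_eval F x = (\<Sum>i\<in>I. c i * tpoly_eval (Poly_Mapping.single (mon i) 1) x)"
      unfolding F_def tpoly_eval_sum by (intro sum.cong refl) (simp add: tpoly_eval_single)
    then show ?thesis using c(2) that by simp
  qed
  ultimately show thesis by (rule that)
qed

lemma pairs_le_eq: "{(a, b). a + b \<le> d} = Sigma {..d} (\<lambda>a. {..d - a})" for d :: nat
  by auto

lemma conic_through_five: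
  assumes "finite S" "card S \<le> 5"
  obtains Q where "Q \<in> forms 2" "Q \<noteq> 0" "\<And>x. x \<in> S \<Longrightarrow> tpoly_eval Q x = 0"
proof (rule form_through_points[OF assms(1), of 2])
  show "card S < card {(a, b). a + b \<le> (2::nat)}"
    unfolding pairs_le_eq using assms(2) by (simp add: numeral_2_eq_2 atMost_Suc)
qed (use that in auto)

lemma cubic_through_nine:
  assumes "finite S" "card S \<le> 9"
  obtains Q where "Q \<in> forms 3" "Q \<noteq> 0" "\<And>x. x \<in> S \<Longrightarrow> tpoly_eval Q x = 0"
proof (rule form_through_points[OF assms(1), of 3])
  show "card S < card {(a, b). a + b \<le> (3::nat)}"
    unfolding pairs_le_eq using assms(2) by (simp add: numeral_3_eq_3 atMost_Suc)
qed (use that in auto)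

subsection \<open>Reducible cubics are singular\<close>

lemma line_basis:
  assumes "a \<noteq> 0"
  obtains b c where "cr b c \<noteq> 0" "dt a b = 0" "dt a c = 0"
proof -
  obtain b where b: "b \<noteq> 0" "dt a b = 0" using common_orthogonal[of a 0] by metis
  obtain i where i: "b $ i \<noteq> 0" using b(1) by (auto simp: vec_eq_iff)
  \<comment> \<open>The vanishing \<open>i\<close>-th coordinate, where \<open>b\<close> does not
    vanish, makes \<open>c\<close> independent of \<open>b\<close>.\<close>
  obtain c where c: "c \<noteq> 0" "dt a c = 0" "c $ i = 0"
    using common_orthogonal[of a "axis i 1"] by (metis dt_axis(2))
  have "cr b c \<noteq> 0"
  proof
    assume "cr b c = 0"
    then obtain k where k: "c = k *s b" using b(1) by (rule cr_eq_0D)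
    then have "k = 0" using c(3) i by simp
    then show False using k c(1) by simp
  qed
  then show thesis using that b c by blast
qed

text \<open>If the point \<open>c\<close> at infinity of the parametrized line is not a zero, the
  restriction has exact degree \<open>d\<close> and therefore a root.\<close>

lemma line_meets_form:
  assumes "Q \<in> forms d" "d > 0" "a \<noteq> 0"
  obtains x where "x \<noteq> 0" "dt a x = 0" "tpoly_eval Q x = 0"
proof -
  obtain b c where bc: "cr b c \<noteq> 0" "dt a b = 0" "dt a c = 0" using line_basis[OF assms(3)] .
  obtain p where p: "degree p \<le> d" "coeff p d = tpoly_eval Q c" "\<And>t. poly p t = tpoly_eval Q (b + t *s c)"
    using restrict_to_line[OF assms(1), of c b] by blast
  show thesis
  proof (cases "tpoly_eval Q c = 0")
    case True
    have "c \<noteq> 0" using bc(1) by auto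
    then show thesis using that[of c] bc True by auto
  next
    case False
    then have "degree p = d" using p by (metis le_antisym le_degree)
    then obtain t where t: "poly p t = 0" using alg_closed_imp_poly_has_root[of p] assms(2) by auto
    have "b + t *s c \<noteq> 0"
    proof
      assume "b + t *s c = 0"
      then have "cr (b + t *s c) c = 0" by simp
      then show False using bc(1) by (simp add: cr_lin)
    qed
    then show thesis using that[of "b + t *s c"] bc t p(3) by (simp add: dt_lin)
  qed
qed

text \<open>Along \<open>x + t *s v\<close> both factors vanish at \<open>t = 0\<close>, so the
  coefficient of \<open>t\<close> in the product, which is the derivative along \<open>v\<close>, is
  0.\<close>

lemma sing_at_line_conic:
  assumes "Q \<in> forms 2" "dt a x = 0" "tpoly_eval Q x = 0"
  shows "sing_at (lf a * Q) x"
  unfolding sing_at_def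
proof
  fix v
  let ?F = "lf a * Q"
  have F: "?F \<in> forms 3" using forms_mult[OF lf_forms assms(1)] by (simp add: numeral_3_eq_3)
  obtain p where p: "\<And>t. poly p t = tpoly_eval Q (x + t *s v)"
    using restrict_to_line[OF assms(1), of v x] by blast
  have "poly [:0, tri ?F x x v / 2, tri ?F x v v / 2, tpoly_eval ?F v:] t = poly ([:0, dt a v:] * p) t" for t
  proof -
    have "poly ([:0, dt a v:] * p) t = tpoly_eval ?F (x + t *s v)"
      by (simp add: p dt_lin assms(2))
    also have "\<dots> = poly [:0, tri ?F x x v / 2, tri ?F x v v / 2, tpoly_eval ?F v:] t"
      unfolding eval_tri_add[OF F] tpoly_eval_scale[OF F]
      by (simp add: assms tri_lin algebra_simps power3_eq_cube)
    finally show ?thesis by (rule sym)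
  qed
  then have "[:0, tri ?F x x v / 2, tri ?F x v v / 2, tpoly_eval ?F v:] = [:0, dt a v:] * p"
    by (simp add: poly_eq_poly_eq_iff[symmetric] fun_eq_iff)
  then have "coeff [:0, tri ?F x x v / 2, tri ?F x v v / 2, tpoly_eval ?F v:] 1 = coeff ([:0, dt a v:] * p) 1"
    by simp
  moreover have "coeff p 0 = 0" using p[of 0] assms(3) by (simp add: poly_0_coeff_0)
  ultimately show "tri ?F x x v = 0" by simp
qed

lemma reducible_imp_singular:
  assumes "F \<in> forms 3" "F \<noteq> 0" "\<not> irreducible F"
  shows "singular_form F"
proof -
  obtain l Q where lQ: "l \<in> forms 1" "Q \<in> forms 2" "F = l * Q" using reducible_cubic[OF assms] .
  obtain a where a: "l = lf a" using forms_1_lf[OF lQ(1)] .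
  have "a \<noteq> 0" using assms(2) lQ a by auto
  then obtain x where "x \<noteq> 0" "dt a x = 0" "tpoly_eval Q x = 0"
    using line_meets_form[OF lQ(2), of a] by auto
  then show ?thesis
    using sing_at_line_conic[OF lQ(2)] singular_form_iff[OF assms(1)] lQ a by metis
qed


section \<open>Cubics through eight points\<close>

definition vanishes_on :: "tpoly \<Rightarrow> (complex ^ 3) set \<Rightarrow> bool" where
  "vanishes_on F S \<longleftrightarrow> (\<forall>x\<in>S. tpoly_eval F x = 0)"

text \<open>The substitute for irreducibility: a plane cubic can only factor with a line as a
  component, and the absence of lines persists under small perturbations
  (\<open>no_line_open\<close>).\<close>

definition no_line :: "tpoly \<Rightarrow> bool" where
  "no_line F \<longleftrightarrow> (\<forall>a. a \<noteq> 0 \<longrightarrow> (\<exists>x. dt a x = 0 \<and> tpoly_eval F x \<noteq> 0))"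

definition on_line :: "complex ^ 3 \<Rightarrow> (complex ^ 3) set \<Rightarrow> (complex ^ 3) set" where
  "on_line l S = {x \<in> S. dt l x = 0}"

lemma irreducible_imp_no_line:
  assumes "F \<in> forms 3" "irreducible F"
  shows "no_line F"
  unfolding no_line_def
proof (intro allI impI, rule ccontr)
  fix a :: "complex ^ 3"
  assume a: "a \<noteq> 0" and "\<nexists>x. dt a x = 0 \<and> tpoly_eval F x \<noteq> 0"
  then obtain Q where "Q \<in> forms 2" "F = lf a * Q"
    using line_divides[of F 2 a] assms(1) by (auto simp: numeral_3_eq_3)
  then show False using line_mult_not_irreducible[OF lf_forms, of Q 1 a] assms(2)
    by (simp add: numeral_2_eq_2)
qed

lemma no_line_on_line:
  assumes "F \<in> forms 3" "no_line F" "vanishes_on F S" "distinct_points S" "finite S" "l \<noteq> 0"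
  shows "card (on_line l S) \<le> 3"
proof (rule ccontr)
  assume "\<not> ?thesis"
  then have c: "card (on_line l S) > 3" by simp
  have "tpoly_eval F x = 0" if "dt l x = 0" for x
    by (rule line_vanish[OF assms(1) _ _ c _ assms(6) _ _ that])
      (use assms in \<open>auto simp: on_line_def vanishes_on_def intro: distinct_points_subset\<close>)
  then show False using assms(2,6) unfolding no_line_def by blast
qed

lemma line_divides_if_points:
  assumes "F \<in> forms (Suc d)" "l \<noteq> 0" "distinct_points T" "finite T" "card T > Suc d"
    "T \<subseteq> {x. dt l x = 0}" "vanishes_on F T"
  obtains Q where "Q \<in> forms d" "F = lf l * Q"
proof (rule line_divides[OF assms(1,2)])
  fix x assume "dt l x = 0"
  then show "tpoly_eval F x = 0"
    by (rule line_vanish[OF assms(1,3,4,5) _ assms(2), rotated 3]) (use assms(6,7) in \<open>auto simp: vanishes_on_def\<close>)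
qed (rule that)

section \<open>Auxiliary points on a line\<close>

lemma distinct_points_insert:
  assumes "distinct_points S" "q \<noteq> 0" "\<And>s. s \<in> S \<Longrightarrow> cr s q \<noteq> 0"
  shows "distinct_points (insert q S)"
proof -
  have "cr q s \<noteq> 0" if "s \<in> S" for s using assms(3)[OF that] cr_swap[of q s] by simp
  then show ?thesis using assms by (auto simp: distinct_points_def)
qed

text \<open>Each point of \<open>S\<close> excludes at most one parameter of
  \<open>a + t *s b\<close>: two would make \<open>a\<close> and \<open>b\<close> both proportional
  to it. Further points on a line serve to force the line into a member of a linear system via
  \<open>line_divides_if_points\<close>.\<close>

lemma extra_point:
  assumes "distinct_points S" "finite S" "l \<noteq> 0"
  obtains q where "dt l q = 0" "q \<notin> S" "distinct_points (insert q S)"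
proof -
  obtain a b where ab: "cr a b \<noteq> 0" "dt l a = 0" "dt l b = 0" using line_basis[OF assms(3)] .
  have uniq: "t = t'" if st: "s \<in> S" "cr s (a + t *s b) = 0" "cr s (a + t' *s b) = 0" for s t t'
  proof (rule ccontr)
    assume "t \<noteq> t'"
    have s0: "s \<noteq> 0" using st(1) assms(1) by (auto simp: distinct_points_def)
    have "(t - t') *s cr s b = cr s (a + t *s b) - cr s (a + t' *s b)"
      by (simp add: cr_lin vector_sub_rdistrib)
    then have b: "cr s b = 0" using st \<open>t \<noteq> t'\<close> by simp
    then have a: "cr s a = 0" using st(2) by (simp add: cr_lin)
    obtain k where "a = k *s s" using cr_eq_0D[OF a s0] .
    moreover obtain m where "b = m *s s" using cr_eq_0D[OF b s0] .
    ultimately show False using ab(1) by (simp add: cr_lin)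
  qed
  have "finite {t. cr s (a + t *s b) = 0}" if "s \<in> S" for s
  proof (cases "\<exists>t. cr s (a + t *s b) = 0")
    case True
    then obtain t where "cr s (a + t *s b) = 0" by blast
    then have "{t. cr s (a + t *s b) = 0} \<subseteq> {t}" using uniq[OF that] by auto
    then show ?thesis by (rule finite_subset) simp
  qed simp
  then have "finite (\<Union>s\<in>S. {t. cr s (a + t *s b) = 0})" using assms(2) by blast
  then obtain t where t: "t \<notin> (\<Union>s\<in>S. {t. cr s (a + t *s b) = 0})"
    using ex_new_if_finite[OF infinite_UNIV_char_0] by blast
  define q where "q = a + t *s b"
  have q: "cr s q \<noteq> 0" if "s \<in> S" for s using t that by (auto simp: q_def)
  have "q \<noteq> 0"
  proof
    assume "q = 0"
    then have "cr q b = 0" by simp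
    then show False using ab(1) by (simp add: q_def cr_lin)
  qed
  moreover have "q \<notin> S" using q[of q] by auto
  ultimately show thesis
    using that[of q] distinct_points_insert[OF assms(1)] q ab by (simp add: q_def dt_lin)
qed

lemma two_extra_points:
  assumes "distinct_points S" "finite S" "l \<noteq> 0"
  obtains q q' where "dt l q = 0" "dt l q' = 0" "q \<notin> S" "q' \<notin> S" "q \<noteq> q'" "distinct_points (insert q (insert q' S))"
proof -
  obtain q' where q': "dt l q' = 0" "q' \<notin> S" "distinct_points (insert q' S)"
    using extra_point[OF assms] .
  obtain q where q: "dt l q = 0" "q \<notin> insert q' S" "distinct_points (insert q (insert q' S))"
    using extra_point[OF q'(3) _ assms(3)] assms(2) by auto
  show thesis by (rule that[of q q']) (use q q' in auto)
qed

section \<open>Conics through five points\<close>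

lemma orthogonal_two_proportional:
  assumes "dt m x = 0" "dt m y = 0" "cr x y \<noteq> 0"
  obtains k where "m = k *s cr x y"
proof -
  have "cr (cr x y) m = 0" using assms by (simp add: cr_cr_left dt_commute)
  then show thesis using assms(3) that by (rule cr_eq_0D)
qed

lemma combination2:
  obtains \<alpha> \<beta> :: complex where "\<alpha> \<noteq> 0 \<or> \<beta> \<noteq> 0" "\<alpha> * u + \<beta> * v = 0"
proof (cases "u = 0 \<and> v = 0")
  case True
  then show thesis using that[of 1 0] by simp
next
  case False
  then show thesis using that[of v "- u"] by (auto simp: mult.commute)
qed

lemma pick_two:
  assumes "card S \<ge> 2"
  obtains x y where "x \<in> S" "y \<in> S" "x \<noteq> y"
proof -
  obtain T where "T \<subseteq> S" "card T = 2" using obtain_subset_with_card_n[OF assms] by metis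
  then show thesis using that by (auto simp: card_2_iff)
qed

text \<open>If a line carries three of the points, it splits off from both conics and the residual
  lines are the line through the other two points. Otherwise the member of the pencil through a
  third point of the line \<open>x y\<close> contains that line; its residual line would carry the
  other three points, so this member is 0.\<close>

lemma conics_through_five_dependent:
  assumes S: "distinct_points S" "card S = 5"
    and no4: "\<And>l. l \<noteq> 0 \<Longrightarrow> card (on_line l S) \<le> 3"
    and Q: "Q \<in> forms 2" "vanishes_on Q S" and Q': "Q' \<in> forms 2" "vanishes_on Q' S"
  obtains \<alpha> \<beta> where "\<alpha> \<noteq> 0 \<or> \<beta> \<noteq> 0" "smul \<alpha> Q + smul \<beta> Q' = 0"
proof -
  have fin: "finite S" using S(2) by (simp add: card_ge_0_finite)
  have fin': "finite (on_line l S)" "on_line l S \<subseteq> S" for l using fin by (auto simp: on_line_def)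
  have S2: "Q \<in> forms (Suc 1)" "Q' \<in> forms (Suc 1)" using Q Q' by (simp_all add: numeral_2_eq_2)
  show thesis
  proof (cases "\<exists>l. l \<noteq> 0 \<and> card (on_line l S) = 3")
    case True
    then obtain l where l: "l \<noteq> 0" "card (on_line l S) = 3" by blast
    have dist: "distinct_points (on_line l S)" using S(1) fin'(2) by (rule distinct_points_subset)
    have "card (S - on_line l S) = 2" using card_Diff_subset[OF fin'(1,2)] S(2) l(2) by simp
    then obtain x y where xy: "x \<in> S - on_line l S" "y \<in> S - on_line l S" "x \<noteq> y"
      using pick_two by (metis order_refl)
    have cxy: "cr x y \<noteq> 0" using xy S(1) by (auto simp: distinct_points_def)
    have fac: "\<exists>k. R = lf l * lf (k *s cr x y)" if R: "R \<in> forms (Suc 1)" "vanishes_on R S" for R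
    proof -
      obtain M where M: "M \<in> forms 1" "R = lf l * M"
        by (rule line_divides_if_points[OF R(1) l(1) dist fin'(1)])
          (use l R(2) in \<open>auto simp: on_line_def vanishes_on_def\<close>)
      obtain m where m: "M = lf m" using forms_1_lf[OF M(1)] .
      have "dt m x = 0" "dt m y = 0"
        using R(2) xy unfolding M(2) m by (auto simp: vanishes_on_def on_line_def)
      then show ?thesis using orthogonal_two_proportional[OF _ _ cxy] M(2) m by metis
    qed
    obtain k k' where k: "Q = lf l * lf (k *s cr x y)" "Q' = lf l * lf (k' *s cr x y)"
      using fac[OF S2(1) Q(2)] fac[OF S2(2) Q'(2)] by blast
    obtain \<alpha> \<beta> where ab: "\<alpha> \<noteq> 0 \<or> \<beta> \<noteq> 0" "\<alpha> * k + \<beta> * k' = 0" by (rule combination2)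
    have "smul \<alpha> Q + smul \<beta> Q' = smul (\<alpha> * k + \<beta> * k') (lf l * lf (cr x y))"
      unfolding k by (simp add: lf_scale smul_mult_right smul_add_left)
    then show thesis using that ab by simp
  next
    case False
    have no3: "card (on_line l S) \<le> 2" if "l \<noteq> 0" for l
      using no4[OF that] False that by (metis le_SucE numeral_3_eq_3 numeral_2_eq_2)
    obtain x y where xy: "x \<in> S" "y \<in> S" "x \<noteq> y" using pick_two[of S] S(2) by auto
    define l where "l = cr x y"
    have l0: "l \<noteq> 0" using xy S(1) by (auto simp: distinct_points_def l_def)
    have lxy: "dt l x = 0" "dt l y = 0" by (simp_all add: l_def)
    have lS: "on_line l S = {x, y}"
    proof -
      have "{x, y} \<subseteq> on_line l S" using xy lxy by (auto simp: on_line_def)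
      moreover have "card (on_line l S) \<le> card {x, y}" using no3[OF l0] xy(3) by simp
      ultimately show ?thesis using card_seteq[OF fin'(1)] by metis
    qed
    obtain q where q: "dt l q = 0" "q \<notin> S" "distinct_points (insert q S)"
      using extra_point[OF S(1) fin l0] .
    obtain \<alpha> \<beta> where ab: "\<alpha> \<noteq> 0 \<or> \<beta> \<noteq> 0" "\<alpha> * tpoly_eval Q q + \<beta> * tpoly_eval Q' q = 0"
      by (rule combination2)
    define H where "H = smul \<alpha> Q + smul \<beta> Q'"
    have H: "H \<in> forms (Suc 1)" unfolding H_def by (intro forms_add forms_smul S2)
    have HS: "vanishes_on H S" using Q(2) Q'(2) by (simp add: H_def vanishes_on_def)
    have card3: "card {q, x, y} > Suc 1" using xy q(2) by (auto simp: card_insert_if)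
    obtain M where M: "M \<in> forms 1" "H = lf l * M"
    proof (rule line_divides_if_points[OF H l0 _ _ card3])
      show "distinct_points {q, x, y}" using q(3) by (rule distinct_points_subset) (use xy in auto)
      show "vanishes_on H {q, x, y}" using HS xy ab(2) by (simp add: vanishes_on_def H_def)
    qed (use q lxy in auto)
    obtain m where m: "M = lf m" using forms_1_lf[OF M(1)] .
    have "S - {x, y} \<subseteq> on_line m S"
    proof
      fix s assume s: "s \<in> S - {x, y}"
      then have "dt l s \<noteq> 0" using lS by (auto simp: on_line_def)
      moreover have "dt l s * dt m s = 0" using HS s unfolding M(2) m by (simp add: vanishes_on_def)
      ultimately show "s \<in> on_line m S" using s by (simp add: on_line_def)
    qed
    then have "card (S - {x, y}) \<le> card (on_line m S)" by (rule card_mono[OF fin'(1)])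
    moreover have "card (S - {x, y}) = 3" using xy S(2) by (subst card_Diff_subset) auto
    ultimately have "m = 0" using no3[of m] by fastforce
    then have "H = 0" using M(2) m by simp
    then show thesis using that ab(1) by (simp add: H_def)
  qed
qed

text \<open>With the coefficients packed into a vector, vanishing at a point is orthogonality to the
  vector of the three values, and \<open>common_orthogonal\<close> finds a member through two
  points.\<close>

definition comb3 :: "tpoly \<Rightarrow> tpoly \<Rightarrow> tpoly \<Rightarrow> complex ^ 3 \<Rightarrow> tpoly" where
  "comb3 A B C k = smul (k $ 1) A + smul (k $ 2) B + smul (k $ 3) C"

lemma eval_comb3: "tpoly_eval (comb3 A B C k) x = dt (vector [tpoly_eval A x, tpoly_eval B x, tpoly_eval C x]) k"
  by (simp add: comb3_def dt_def mult_ac)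

lemma comb3_add: "comb3 A B C (k + k') = comb3 A B C k + comb3 A B C k'"
  and comb3_scale: "comb3 A B C (c *s k) = smul c (comb3 A B C k)"
  by (simp_all add: comb3_def smul_add_left smul_add)

lemma comb3_forms: "A \<in> forms d \<Longrightarrow> B \<in> forms d \<Longrightarrow> C \<in> forms d \<Longrightarrow> comb3 A B C k \<in> forms d"
  by (simp add: comb3_def forms_add forms_smul)

lemma comb3_vanishes_on: "vanishes_on A S \<Longrightarrow> vanishes_on B S \<Longrightarrow> vanishes_on C S \<Longrightarrow> vanishes_on (comb3 A B C k) S"
  by (simp add: comb3_def vanishes_on_def)

lemma mult_linear_not_irreducible: "Q \<in> forms 2 \<Longrightarrow> \<not> irreducible (Q * lf a)"
  using line_mult_not_irreducible[OF lf_forms, of Q 1 a] by (simp add: numeral_2_eq_2 mult.commute)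

text \<open>The net spanned by \<open>F\<close> and by the products of \<open>Q\<close> with the lines through \<open>z\<close> has a member that
  contains the line through two of the seven points; its residual conic must be \<open>Q\<close>.\<close>

lemma seven_on_conic_imp_reducible:
  assumes P: "distinct_points P" "card P = 8"
    and no3: "\<And>l. l \<noteq> 0 \<Longrightarrow> card (on_line l P) \<le> 2"
    and F: "F \<in> forms 3" "irreducible F" "vanishes_on F P"
    and Q: "Q \<in> forms 2" "Q \<noteq> 0" "vanishes_on Q (P - {z})" and z: "z \<in> P"
  shows False
proof -
  have fin: "finite P" using P(2) by (simp add: card_ge_0_finite)
  have fin': "finite (on_line l P)" for l using fin by (auto simp: on_line_def)
  \<comment> \<open>\<open>lf c\<close> and \<open>lf c'\<close> span the lines through
    \<open>z\<close>, so their products with \<open>Q\<close> vanish on all of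
    \<open>P\<close>.\<close>
  obtain c c' where c: "cr c c' \<noteq> 0" "dt z c = 0" "dt z c' = 0"
    using line_basis[of z] z P(1) by (metis distinct_points_def)
  have "card (P - {z}) \<ge> 2" using P z by simp
  then obtain x y where xy: "x \<in> P - {z}" "y \<in> P - {z}" "x \<noteq> y" by (rule pick_two)
  define l where "l = cr x y"
  have l0: "l \<noteq> 0" using xy P(1) by (auto simp: distinct_points_def l_def)
  have lxy: "dt l x = 0" "dt l y = 0" by (simp_all add: l_def)
  have lP: "on_line l P = {x, y}"
  proof -
    have "{x, y} \<subseteq> on_line l P" using xy lxy by (auto simp: on_line_def)
    moreover have "card (on_line l P) \<le> card {x, y}" using no3[OF l0] xy(3) by simp
    ultimately show ?thesis using card_seteq[OF fin'] by metis
  qed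
  then have lz: "dt l z \<noteq> 0" using z xy by (auto simp: on_line_def)
  obtain q q' where q: "dt l q = 0" "dt l q' = 0" "q \<notin> P" "q' \<notin> P" "q \<noteq> q'"
    "distinct_points (insert q (insert q' P))"
    using two_extra_points[OF P(1) fin l0] .
  have Qq: "tpoly_eval Q p \<noteq> 0" if p: "dt l p = 0" "p \<notin> P" "distinct_points (insert p P)" for p
  proof
    assume "tpoly_eval Q p = 0"
    have Q2: "Q \<in> forms (Suc 1)" using Q(1) by (simp add: numeral_2_eq_2)
    have card3: "card {p, x, y} > Suc 1" using xy p(2) by (auto simp: card_insert_if)
    obtain M where M: "M \<in> forms 1" "Q = lf l * M"
    proof (rule line_divides_if_points[OF Q2 l0 _ _ card3])
      show "distinct_points {p, x, y}" using p(3) by (rule distinct_points_subset) (use xy in auto)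
      show "vanishes_on Q {p, x, y}" using Q(3) xy \<open>tpoly_eval Q p = 0\<close> by (simp add: vanishes_on_def)
    qed (use p lxy in auto)
    obtain m where m: "M = lf m" using forms_1_lf[OF M(1)] .
    have m0: "m \<noteq> 0" using M m Q(2) by auto
    have "P - {x, y, z} \<subseteq> on_line m P"
    proof
      fix s assume s: "s \<in> P - {x, y, z}"
      then have "dt l s \<noteq> 0" using lP by (auto simp: on_line_def)
      moreover have "dt l s * dt m s = 0" using Q(3) s unfolding M(2) m by (simp add: vanishes_on_def)
      ultimately show "s \<in> on_line m P" using s by (simp add: on_line_def)
    qed
    then have "card (P - {x, y, z}) \<le> card (on_line m P)" by (rule card_mono[OF fin'])
    moreover have "card (P - {x, y, z}) = 5" using xy z P(2) by (subst card_Diff_subset) auto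
    ultimately show False using no3[OF m0] by simp
  qed
  have dq: "distinct_points (insert q P)" "distinct_points (insert q' P)"
    using distinct_points_subset[OF q(6)] by auto
  have Qq1: "tpoly_eval Q q \<noteq> 0" by (rule Qq[OF q(1,3) dq(1)])
  have Qq2: "tpoly_eval Q q' \<noteq> 0" by (rule Qq[OF q(2,4) dq(2)])
  define ev where "ev p = (vector [tpoly_eval F p, tpoly_eval (Q * lf c) p, tpoly_eval (Q * lf c') p] :: complex ^ 3)" for p
  obtain k where k: "k \<noteq> 0" "dt (ev q) k = 0" "dt (ev q') k = 0" by (rule common_orthogonal)
  define H where "H = comb3 F (Q * lf c) (Q * lf c') k"
  define m where "m = k $ 2 *s c + k $ 3 *s c'"
  have Hm: "H = smul (k $ 1) F + Q * lf m"
    by (simp add: H_def comb3_def m_def lf_add lf_scale smul_mult_right distrib_left add.assoc)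
  have Qc: "Q * lf d \<in> forms 3" for d
    using forms_mult[OF Q(1) lf_forms[of d]] by (simp add: numeral_3_eq_3 numeral_2_eq_2)
  have H3: "H \<in> forms (Suc 2)" using comb3_forms[OF F(1) Qc Qc] by (simp add: H_def numeral_3_eq_3 numeral_2_eq_2)
  have zm: "dt m z = 0" using c by (simp add: m_def dt_lin dt_commute[of _ z])
  have HP: "vanishes_on H P"
    unfolding Hm vanishes_on_def
  proof
    fix s assume "s \<in> P"
    then show "tpoly_eval (smul (k $ 1) F + Q * lf m) s = 0"
      using F(3) Q(3) zm by (cases "s = z") (simp_all add: vanishes_on_def)
  qed
  have Hq: "tpoly_eval H q = 0" "tpoly_eval H q' = 0"
    using k by (simp_all add: H_def eval_comb3 ev_def)
  have card4: "card {q, q', x, y} > Suc 2" using xy(1-3) q(3-5) by (auto simp: card_insert_if)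
  obtain R where R: "R \<in> forms 2" "H = lf l * R"
  proof (rule line_divides_if_points[OF H3 l0 _ _ card4])
    show "distinct_points {q, q', x, y}" using q(6) by (rule distinct_points_subset) (use xy in auto)
    show "vanishes_on H {q, q', x, y}" using HP Hq xy by (simp add: vanishes_on_def)
  qed (use q lxy in auto)
  define S where "S = P - {x, y, z}"
  have RS: "vanishes_on R S"
    unfolding vanishes_on_def
  proof
    fix s assume s: "s \<in> S"
    then have "dt l s \<noteq> 0" using lP by (auto simp: on_line_def S_def)
    moreover have "dt l s * tpoly_eval R s = 0" using HP s unfolding R(2) by (simp add: vanishes_on_def S_def)
    ultimately show "tpoly_eval R s = 0" by simp
  qed
  have S: "distinct_points S" "card S = 5" "S \<subseteq> P"
    using distinct_points_subset[OF P(1)] xy z P(2) by (auto simp: S_def card_Diff_subset)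
  have "card (on_line d S) \<le> 3" if "d \<noteq> 0" for d
  proof -
    have "card (on_line d S) \<le> card (on_line d P)"
      by (rule card_mono[OF fin']) (use S(3) in \<open>auto simp: on_line_def\<close>)
    then show ?thesis using no3[OF that] by simp
  qed
  moreover have "vanishes_on Q S" using Q(3) by (auto simp: vanishes_on_def S_def)
  ultimately obtain \<alpha> \<beta> where ab: "\<alpha> \<noteq> 0 \<or> \<beta> \<noteq> 0" "smul \<alpha> Q + smul \<beta> R = 0"
    using conics_through_five_dependent[OF S(1,2) _ Q(1) _ R(1) RS] by blast
  have "\<beta> \<noteq> 0" using ab Q(2) by auto
  define \<mu> where "\<mu> = - \<alpha> / \<beta>"
  have "smul (1 / \<beta>) (smul \<alpha> Q + smul \<beta> R) = 0" using ab by simp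
  then have "smul (\<alpha> / \<beta>) Q + R = 0" using \<open>\<beta> \<noteq> 0\<close> by (simp add: smul_add)
  then have "R = - smul (\<alpha> / \<beta>) Q" by (rule minus_unique[symmetric])
  then have R\<mu>: "R = smul \<mu> Q" by (simp add: \<mu>_def poly_mapping_eq_iff fun_eq_iff)
  have kF: "smul (k $ 1) F = Q * lf (\<mu> *s l - m)"
  proof (rule tpoly_eqI)
    fix p
    have "tpoly_eval H p = dt l p * (\<mu> * tpoly_eval Q p)" using R(2) R\<mu> by simp
    then show "tpoly_eval (smul (k $ 1) F) p = tpoly_eval (Q * lf (\<mu> *s l - m)) p"
      unfolding Hm by (simp add: dt_lin algebra_simps eq_diff_eq)
  qed
  show False
  proof (cases "k $ 1 = 0")
    case False
    then show False
      using irreducible_smul[OF False F(2)] mult_linear_not_irreducible[OF Q(1)] unfolding kF by blast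
  next
    case True
    \<comment> \<open>\<open>F\<close> has dropped out and, after cancelling \<open>Q\<close>, a
      relation between lines remains. As \<open>m\<close> passes through \<open>z\<close> and
      \<open>l\<close> does not, evaluation at \<open>z\<close> gives \<mu> = 0.\<close>
    then have e: "\<mu> *s l - m = 0" using kF Q(2) by simp
    then have "dt (\<mu> *s l - m) z = 0" by simp
    then have "\<mu> = 0" using lz zm by (simp add: dt_lin)
    then have "m = 0" using e by simp
    then have "cr m c' = 0" "cr c m = 0" by simp_all
    then have "k $ 2 = 0" "k $ 3 = 0" using c(1) by (simp_all add: m_def cr_lin)
    then show False using k(1) True by (auto intro: vec3_eqI)
  qed
qed

text \<open>A net allows two more conditions. They are spent on two further points of the line
  through \<open>x\<close> and \<open>y\<close>, which then meets the chosen cubic in four points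
  and is a component; the quotient passes through the other points of \<open>P\<close>.\<close>

lemma residual_conic:
  assumes P: "distinct_points P" "finite P"
    and xy: "x \<in> P" "y \<in> P" "x \<noteq> y" "on_line (cr x y) P = {x, y}"
    and A: "A \<in> forms 3" "vanishes_on A P" and B: "B \<in> forms 3" "vanishes_on B P"
    and C: "C \<in> forms 3" "vanishes_on C P"
    and ind: "\<And>k. k \<noteq> 0 \<Longrightarrow> comb3 A B C k \<noteq> 0"
  obtains Q where "Q \<in> forms 2" "Q \<noteq> 0" "vanishes_on Q (P - {x, y})"
proof -
  define l where "l = cr x y"
  have l0: "l \<noteq> 0" using xy(1-3) P(1) by (auto simp: distinct_points_def l_def)
  have lxy: "dt l x = 0" "dt l y = 0" by (simp_all add: l_def)
  obtain q q' where q: "dt l q = 0" "dt l q' = 0" "q \<notin> P" "q' \<notin> P" "q \<noteq> q'"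
    "distinct_points (insert q (insert q' P))"
    using two_extra_points[OF P(1,2) l0] .
  define ev where "ev p = (vector [tpoly_eval A p, tpoly_eval B p, tpoly_eval C p] :: complex ^ 3)" for p
  obtain k where k: "k \<noteq> 0" "dt (ev q) k = 0" "dt (ev q') k = 0" by (rule common_orthogonal)
  define H where "H = comb3 A B C k"
  have H3: "H \<in> forms (Suc 2)" using comb3_forms[OF A(1) B(1) C(1)] by (simp add: H_def numeral_3_eq_3 numeral_2_eq_2)
  have HP: "vanishes_on H P" unfolding H_def by (intro comb3_vanishes_on A B C)
  have Hq: "tpoly_eval H q = 0" "tpoly_eval H q' = 0"
    using k by (simp_all add: H_def eval_comb3 ev_def)
  have card4: "card {q, q', x, y} > Suc 2" using xy(1-3) q(3-5) by (auto simp: card_insert_if)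
  obtain R where R: "R \<in> forms 2" "H = lf l * R"
  proof (rule line_divides_if_points[OF H3 l0 _ _ card4])
    show "distinct_points {q, q', x, y}" using q(6) by (rule distinct_points_subset) (use xy(1-3) in auto)
    show "vanishes_on H {q, q', x, y}" using HP Hq xy(1,2) by (simp add: vanishes_on_def)
  qed (use q lxy in auto)
  have "vanishes_on R (P - {x, y})"
    unfolding vanishes_on_def
  proof
    fix s assume s: "s \<in> P - {x, y}"
    then have "dt l s \<noteq> 0" using xy(4) by (auto simp: on_line_def l_def)
    moreover have "dt l s * tpoly_eval R s = 0" using HP s unfolding R(2) by (simp add: vanishes_on_def)
    ultimately show "tpoly_eval R s = 0" by simp
  qed
  moreover have "R \<noteq> 0" using ind[OF k(1)] R(2) by (auto simp: H_def)
  ultimately show thesis using that R(1) by blast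
qed

text \<open>Suppose the three cubics were independent. If three points are collinear, one more point
  on their line leaves a pencil containing the line, hence two independent conics through the other
  five points. If not, splitting off the lines \<open>x y\<close> and \<open>x z\<close> gives
  conics through the same five points, therefore proportional, and so a conic through seven
  points.\<close>

theorem cubics_through_eight_dependent:
  assumes P: "distinct_points P" "card P = 8"
    and F: "F \<in> forms 3" "irreducible F" "vanishes_on F P"
    and A: "A \<in> forms 3" "vanishes_on A P" and B: "B \<in> forms 3" "vanishes_on B P"
    and C: "C \<in> forms 3" "vanishes_on C P"
  shows "\<exists>k. k \<noteq> 0 \<and> comb3 A B C k = 0"
proof (rule ccontr)
  assume "\<not> ?thesis"
  then have ind: "comb3 A B C k \<noteq> 0" if "k \<noteq> 0" for k using that by blast
  have fin: "finite P" using P(2) by (simp add: card_ge_0_finite)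
  have fin': "finite (on_line l P)" "on_line l P \<subseteq> P" for l using fin by (auto simp: on_line_def)
  have no4: "card (on_line l P) \<le> 3" if "l \<noteq> 0" for l
    using no_line_on_line[OF F(1) irreducible_imp_no_line[OF F(1,2)] F(3) P(1) fin that] .
  show False
  proof (cases "\<exists>l. l \<noteq> 0 \<and> card (on_line l P) = 3")
    case True
    then obtain l where l: "l \<noteq> 0" "card (on_line l P) = 3" by blast
    let ?T = "on_line l P"
    obtain q where q: "dt l q = 0" "q \<notin> P" "distinct_points (insert q P)"
      using extra_point[OF P(1) fin l(1)] .
    define g where "g = (vector [tpoly_eval A q, tpoly_eval B q, tpoly_eval C q] :: complex ^ 3)"
    \<comment> \<open>Vanishing at \<open>q\<close> is one linear condition on three coefficients
      and leaves two independent solutions.\<close>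
    have "\<exists>k k'. cr k k' \<noteq> 0 \<and> dt g k = 0 \<and> dt g k' = 0"
    proof (cases "g = 0")
      case True
      have "cr (axis 1 1) (axis 2 1 :: complex ^ 3) $ 3 = 1" by (simp add: axis_def)
      then have "cr (axis 1 1) (axis 2 1 :: complex ^ 3) \<noteq> 0" by (metis zero_index zero_neq_one)
      then show ?thesis using True by (metis dt_zero(1))
    next
      case False
      obtain k k' where "cr k k' \<noteq> 0" "dt g k = 0" "dt g k' = 0" using line_basis[OF False] .
      then show ?thesis by blast
    qed
    then obtain k k' where k: "cr k k' \<noteq> 0" "dt g k = 0" "dt g k' = 0" by blast
    define S where "S = P - ?T"
    have S: "distinct_points S" "card S = 5" "S \<subseteq> P"
      using distinct_points_subset[OF P(1), of S] P(2) l(2) card_Diff_subset[OF fin'(1,2)[of l]]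
      by (auto simp: S_def)
    have fac: "\<exists>R. R \<in> forms 2 \<and> vanishes_on R S \<and> comb3 A B C h = lf l * R" if h: "dt g h = 0" for h
    proof -
      let ?H = "comb3 A B C h"
      have H3: "?H \<in> forms (Suc 2)" using comb3_forms[OF A(1) B(1) C(1)] by (simp add: numeral_3_eq_3 numeral_2_eq_2)
      have HP: "vanishes_on ?H P" by (intro comb3_vanishes_on A B C)
      have Hq: "tpoly_eval ?H q = 0" using h by (simp add: eval_comb3 g_def)
      have "q \<notin> ?T" using q(2) by (simp add: on_line_def)
      then have card4: "card (insert q ?T) > Suc 2" using l(2) fin'(1) by simp
      obtain R where R: "R \<in> forms 2" "?H = lf l * R"
      proof (rule line_divides_if_points[OF H3 l(1) _ _ card4])
        show "distinct_points (insert q ?T)" using q(3) by (rule distinct_points_subset) (auto simp: on_line_def)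
        show "vanishes_on ?H (insert q ?T)" using HP Hq by (auto simp: vanishes_on_def on_line_def)
      qed (use q fin' in \<open>auto simp: on_line_def\<close>)
      have "vanishes_on R S"
        unfolding vanishes_on_def
      proof
        fix s assume s: "s \<in> S"
        then have "dt l s \<noteq> 0" by (auto simp: on_line_def S_def)
        moreover have "dt l s * tpoly_eval R s = 0" using HP s unfolding R(2) by (simp add: vanishes_on_def S_def)
        ultimately show "tpoly_eval R s = 0" by simp
      qed
      then show ?thesis using R by blast
    qed
    obtain R where R: "R \<in> forms 2" "vanishes_on R S" "comb3 A B C k = lf l * R" using fac[OF k(2)] by blast
    obtain R' where R': "R' \<in> forms 2" "vanishes_on R' S" "comb3 A B C k' = lf l * R'" using fac[OF k(3)] by blast
    have no4S: "card (on_line d S) \<le> 3" if "d \<noteq> 0" for d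
    proof -
      have "card (on_line d S) \<le> card (on_line d P)"
        by (rule card_mono[OF fin'(1)]) (use S(3) in \<open>auto simp: on_line_def\<close>)
      then show ?thesis using no4[OF that] by simp
    qed
    obtain \<alpha> \<beta> where ab: "\<alpha> \<noteq> 0 \<or> \<beta> \<noteq> 0" "smul \<alpha> R + smul \<beta> R' = 0"
      using conics_through_five_dependent[OF S(1,2) no4S R(1,2) R'(1,2)] by blast
    have "comb3 A B C (\<alpha> *s k + \<beta> *s k') = lf l * (smul \<alpha> R + smul \<beta> R')"
      by (simp add: comb3_add comb3_scale R R' smul_mult_right distrib_left)
    then have "comb3 A B C (\<alpha> *s k + \<beta> *s k') = 0" using ab(2) by simp
    then have e: "\<alpha> *s k + \<beta> *s k' = 0" using ind by blast
    then have "cr (\<alpha> *s k + \<beta> *s k') k' = 0" "cr k (\<alpha> *s k + \<beta> *s k') = 0" by simp_all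
    then have "\<alpha> = 0" "\<beta> = 0" using k(1) by (simp_all add: cr_lin)
    then show False using ab(1) by simp
  next
    case False
    have no3: "card (on_line l P) \<le> 2" if "l \<noteq> 0" for l
      using no4[OF that] False that by (metis le_SucE numeral_3_eq_3 numeral_2_eq_2)
    have pair: "on_line (cr x y) P = {x, y}" if "x \<in> P" "y \<in> P" "x \<noteq> y" for x y
    proof -
      have "{x, y} \<subseteq> on_line (cr x y) P" using that by (auto simp: on_line_def)
      moreover have "cr x y \<noteq> 0" using that P(1) by (auto simp: distinct_points_def)
      then have "card (on_line (cr x y) P) \<le> card {x, y}" using no3 that(3) by (simp add: numeral_2_eq_2)
      ultimately show ?thesis using card_seteq[OF fin'(1)] by metis
    qed
    obtain T where T: "T \<subseteq> P" "card T = 3" using obtain_subset_with_card_n[of 3 P] P(2) by auto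
    then obtain x y z where xyz: "T = {x, y, z}" "x \<noteq> y" "x \<noteq> z" "y \<noteq> z" by (auto simp: card_3_iff)
    have xyz': "x \<in> P" "y \<in> P" "z \<in> P" using T xyz by auto
    obtain Q where Q: "Q \<in> forms 2" "Q \<noteq> 0" "vanishes_on Q (P - {x, y})"
      by (rule residual_conic[OF P(1) fin xyz'(1,2) xyz(2) pair[OF xyz'(1,2) xyz(2)] A B C ind])
    obtain R where R: "R \<in> forms 2" "R \<noteq> 0" "vanishes_on R (P - {x, z})"
      by (rule residual_conic[OF P(1) fin xyz'(1,3) xyz(3) pair[OF xyz'(1,3) xyz(3)] A B C ind])
    define S where "S = P - {x, y, z}"
    have S: "distinct_points S" "card S = 5" "S \<subseteq> P"
      using distinct_points_subset[OF P(1)] xyz xyz' P(2) by (auto simp: S_def card_Diff_subset)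
    have no4S: "card (on_line d S) \<le> 3" if "d \<noteq> 0" for d
    proof -
      have "card (on_line d S) \<le> card (on_line d P)"
        by (rule card_mono[OF fin'(1)]) (use S(3) in \<open>auto simp: on_line_def\<close>)
      then show ?thesis using no4[OF that] by simp
    qed
    have "vanishes_on Q S" "vanishes_on R S" using Q(3) R(3) by (auto simp: S_def vanishes_on_def)
    then obtain \<alpha> \<beta> where ab: "\<alpha> \<noteq> 0 \<or> \<beta> \<noteq> 0" "smul \<alpha> Q + smul \<beta> R = 0"
      using conics_through_five_dependent[OF S(1,2) no4S Q(1) _ R(1)] by blast
    have "\<alpha> \<noteq> 0" using ab R(2) by auto
    \<comment> \<open>The conic \<open>R\<close> omits \<open>x\<close> and \<open>z\<close> but
      passes through \<open>y\<close>; as \<open>Q\<close> is proportional to it, \<open>Q\<close>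
      passes through \<open>y\<close> as well.\<close>
    have "vanishes_on Q (P - {x})"
      unfolding vanishes_on_def
    proof
      fix s assume s: "s \<in> P - {x}"
      show "tpoly_eval Q s = 0"
      proof (cases "s = y")
        case False
        then show ?thesis using Q(3) s by (auto simp: vanishes_on_def)
      next
        case True
        then have "tpoly_eval R s = 0" using R(3) s xyz by (auto simp: vanishes_on_def)
        moreover have "\<alpha> * tpoly_eval Q s + \<beta> * tpoly_eval R s = 0"
          using arg_cong[OF ab(2), of "\<lambda>G. tpoly_eval G s"] by simp
        ultimately show ?thesis using \<open>\<alpha> \<noteq> 0\<close> by simp
      qed
    qed
    then show False
      by (intro seven_on_conic_imp_reducible[OF P _ F Q(1,2) _ xyz'(1)] no3)
  qed
qed


section \<open>Common points of two cubics\<close>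

lemma forms3_decompose:
  assumes "F \<in> forms 3"
  shows "tpoly_eval F (g *s s + y) =
    g ^ 3 * tpoly_eval F s + g\<^sup>2 * (tri F s s y / 2) + g * (tri F s y y / 2) + tpoly_eval F y"
  unfolding eval_tri_add[OF assms] tpoly_eval_scale[OF assms] by (simp add: tri_lin power2_eq_square)

lemma sing_at_eval: "F \<in> forms 3 \<Longrightarrow> sing_at F s \<Longrightarrow> tpoly_eval F s = 0"
  by (simp add: eval_tri sing_at_def)

lemma no_line_neq_0: "no_line F \<Longrightarrow> F \<noteq> 0"
proof
  assume "no_line F" "F = 0"
  then have "\<exists>x. dt (axis 1 1) x = 0 \<and> tpoly_eval F x \<noteq> 0"
    unfolding no_line_def by (metis axis_eq_0_iff zero_neq_one)
  then show False using \<open>F = 0\<close> by simp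
qed

lemma no_line_span:
  assumes "no_line F" "cr a b \<noteq> 0" "\<And>\<alpha> \<beta>. tpoly_eval F (\<alpha> *s a + \<beta> *s b) = 0"
  shows False
proof -
  obtain x where x: "dt (cr a b) x = 0" "tpoly_eval F x \<noteq> 0"
    using assms(1,2) unfolding no_line_def by blast
  obtain \<alpha> \<beta> where "x = \<alpha> *s a + \<beta> *s b"
    using line_span[OF assms(2,2) _ _ x(1)] by auto
  then show False using assms(3) x(2) by simp
qed

text \<open>At a double point \<open>s\<close> the two leading terms of
  \<open>forms3_decompose\<close> vanish. If \<open>y\<close> lies on the tangent cone and on the
  cubic, the other two vanish as well, and the line through \<open>s\<close> and \<open>y\<close> is
  contained in the cubic.\<close>

lemma no_line_tangent_cone:
  assumes "F \<in> forms 3" "no_line F" "sing_at F s" "cr s y \<noteq> 0"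
    "tri F s y y = 0" "tpoly_eval F y = 0"
  shows False
proof (rule no_line_span[OF assms(2,4)])
  fix \<alpha> \<beta>
  show "tpoly_eval F (\<alpha> *s s + \<beta> *s y) = 0"
    unfolding forms3_decompose[OF assms(1)] tpoly_eval_scale[OF assms(1)]
    using assms(3,5,6) sing_at_eval[OF assms(1,3)] by (simp add: tri_lin sing_at_def)
qed

lemma coprime_if_no_common_root:
  fixes p q :: "complex poly"
  assumes "p \<noteq> 0" "\<And>x. poly p x = 0 \<Longrightarrow> poly q x \<noteq> 0"
  shows "coprime p q"
proof (rule coprimeI)
  fix h assume h: "h dvd p" "h dvd q"
  have h0: "h \<noteq> 0" using h(1) assms(1) by auto
  have "degree h = 0"
  proof (rule ccontr)
    assume "degree h \<noteq> 0"
    then obtain x where x: "poly h x = 0" using alg_closed_imp_poly_has_root[of h] by auto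
    have "poly p x = 0" "poly q x = 0" using h x by (auto elim!: dvdE)
    then show False using assms(2) by blast
  qed
  then show "h dvd 1" using is_unit_iff_degree[OF h0] by simp
qed

text \<open>The given points form the affine chart where the coordinate along \<open>w\<close> is 1.
  Moving \<open>x\<close> by \<open>t *s w\<close> reaches a multiple of a chart point unless
  \<open>\<omega> + t = 0\<close>; the factor \<open>[:\<omega>, 1:]\<close> takes care of this one
  exception.\<close>

lemma form_vanishes_if_open:
  assumes F: "F \<in> forms d" and b: "det3 s w u \<noteq> 0"
    and z: "\<And>g \<beta>. tpoly_eval F (g *s s + (w + \<beta> *s u)) = 0"
  shows "F = 0"
proof (rule tpoly_eq_0)
  fix x
  obtain \<gamma> \<omega> \<upsilon> where x: "x = \<gamma> *s s + \<omega> *s w + \<upsilon> *s u" using basis_expand[OF b] .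
  obtain p where p: "\<And>t. poly p t = tpoly_eval F (x + t *s w)" using restrict_to_line[OF F, of w x] by blast
  have e: "poly ([:\<omega>, 1:] * p) t = (\<omega> + t) * poly p t" for t by (simp only: poly_mult poly_pCons poly_0) simp
  have "(\<omega> + t) * poly p t = 0" for t
  proof (cases "\<omega> + t = 0")
    case False
    define D where "D = \<omega> + t"
    have "D \<noteq> 0" using False by (simp add: D_def)
    have "x + t *s w = \<gamma> *s s + D *s w + \<upsilon> *s u"
      unfolding x D_def by (rule vec3_eqI; simp add: algebra_simps)
    also have "\<dots> = D *s ((\<gamma> / D) *s s + (w + (\<upsilon> / D) *s u))"
      using \<open>D \<noteq> 0\<close> by (simp add: vector_add_ldistrib add.assoc)
    finally have "tpoly_eval F (x + t *s w) = D ^ d * tpoly_eval F ((\<gamma> / D) *s s + (w + (\<upsilon> / D) *s u))"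
      using tpoly_eval_scale[OF F] by metis
    then have "poly p t = 0" unfolding p z by simp
    then show ?thesis by simp
  qed simp
  then have "poly ([:\<omega>, 1:] * p) t = 0" for t unfolding e .
  then have "[:\<omega>, 1:] * p = 0" by (intro poly_all_0_iff_0[THEN iffD1] allI)
  then have "p = 0" by (simp only: mult_eq_0_iff pCons_eq_0_iff) simp
  then show "tpoly_eval F x = 0" using p[of 0] by simp
qed

text \<open>Projecting from the double point \<open>s\<close>, \<open>F = g q + c\<close> and \<open>G = g\<^sup>2 g\<^sub>1 + g g\<^sub>2 + g\<^sub>3\<close>. The
  resultant \<open>g\<^sub>1 c\<^sup>2 - g\<^sub>2 c q + g\<^sub>3 q\<^sup>2\<close> has degree 7, and if \<open>g\<^sub>1 = 0\<close> it is \<open>q\<close> times a polynomial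
  of degree 5.\<close>

lemma common_points_bound:
  assumes F: "F \<in> forms 3" "no_line F" "sing_at F s" and G: "G \<in> forms 3" "tpoly_eval G s = 0"
    and X: "distinct_points (insert s X)" "s \<notin> X" "finite X" "vanishes_on F X" "vanishes_on G X"
    and many: "card X \<ge> 8 \<or> card X \<ge> 7 \<and> sing_at G s"
  shows "\<exists>k. G = smul k F"
proof -
  have s0: "s \<noteq> 0" using X(1) by (auto simp: distinct_points_def)
  obtain a a' where aa: "det3 s a a' \<noteq> 0" using basis_exists[OF s0] .
  have quad: "poly [:tri H s w w / 2, tri H s w u, tri H s u u / 2:] \<beta> = tri H s (w + \<beta> *s u) (w + \<beta> *s u) / 2" for H w u \<beta>
    by (simp add: tri_lin algebra_simps add_divide_distrib tri_swap23[of H s u w])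
  have q0: "[:tri F s a a / 2, tri F s a a', tri F s a' a' / 2:] \<noteq> 0"
  proof
    assume 0: "[:tri F s a a / 2, tri F s a a', tri F s a' a' / 2:] = 0"
    have "cr a a' \<noteq> 0" using aa by (auto simp: det3_def)
    then obtain y where y: "y \<noteq> 0" "dt (cr a a') y = 0" "tpoly_eval F y = 0"
      using line_meets_form[OF F(1), of "cr a a'"] by auto
    obtain \<alpha> \<beta> where ab: "y = \<alpha> *s a + \<beta> *s a'"
      using line_span[OF \<open>cr a a' \<noteq> 0\<close> \<open>cr a a' \<noteq> 0\<close> _ _ y(2)] by auto
    have "tri F s y y = 0"
      using 0 unfolding ab by (simp add: tri_lin tri_swap23[of F s a' a])
    moreover have "cr s y \<noteq> 0"
    proof
      assume "cr s y = 0"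
      then obtain k where k: "y = k *s s" using s0 by (rule cr_eq_0D)
      then have "k \<noteq> 0" using y(1) by auto
      moreover have "k * det3 s a a' = 0"
        using k y(2) unfolding det3_def by (simp add: dt_lin dt_commute)
      ultimately show False using aa by simp
    qed
    ultimately show False using no_line_tangent_cone[OF F] y(3) by blast
  qed
  have dir0: "[:det3 s x a, det3 s x a':] \<noteq> 0" if "x \<in> X" for x
  proof
    assume "[:det3 s x a, det3 s x a':] = 0"
    then have z: "dt (cr s x) a = 0" "dt (cr s x) a' = 0"
      by (simp_all add: det3_def dt_def algebra_simps)
    have "dt (cr s x) y = 0" for y
      by (rule basis_expand[OF aa, of y]) (simp add: dt_lin z)
    then have "cr s x = 0" by (rule dt_nondegenerate)
    then show False using X(1,2) that by (auto simp: distinct_points_def)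
  qed
  \<comment> \<open>A generic direction: if \<tau> is a root of neither \<open>A\<close> nor
    \<open>B\<close>, the point \<open>u\<close> lies off the tangent cone at \<open>s\<close>, so
    that \<open>q\<close> has exact degree 2, and off the lines joining \<open>s\<close> to
    \<open>X\<close>, so that every point of \<open>X\<close> has a finite parameter.\<close>
  define A where "A = [:tri F s a a / 2, tri F s a a', tri F s a' a' / 2:]"
  define B where "B = (\<Prod>x\<in>X. [:det3 s x a, det3 s x a':])"
  have "A * B \<noteq> 0" using q0 dir0 X(3) by (simp only: A_def B_def mult_eq_0_iff prod_zero_iff) blast
  then have "\<not> (\<forall>t. poly (A * B) t = 0)" unfolding poly_all_0_iff_0 .
  then obtain \<tau> where \<tau>: "poly A \<tau> \<noteq> 0" "poly B \<tau> \<noteq> 0" by auto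
  define u where "u = a + \<tau> *s a'"
  define w where "w = a'"
  have qu: "tri F s u u \<noteq> 0"
  proof
    assume "tri F s u u = 0"
    then have "poly A \<tau> = 0" unfolding A_def quad u_def by simp
    then show False using \<tau>(1) by simp
  qed
  have xu: "det3 s x u \<noteq> 0" if "x \<in> X" for x
  proof -
    have "(\<Prod>x\<in>X. poly [:det3 s x a, det3 s x a':] \<tau>) \<noteq> 0"
      using \<tau>(2) unfolding B_def poly_prod .
    then have "poly [:det3 s x a, det3 s x a':] \<tau> \<noteq> 0" using that X(3) by (simp only: prod_zero_iff) blast
    then show ?thesis by (simp add: u_def det3_lin)
  qed
  have "det3 s w u = - det3 s a a'"
    by (simp add: u_def w_def det3_lin det3_swap(2)[of s a' a])
  then have swu: "det3 s w u \<noteq> 0" using aa by simp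
  define y where "y \<beta> = w + \<beta> *s u" for \<beta>
  have sy: "cr s (y \<beta>) \<noteq> 0" for \<beta>
  proof
    assume "cr s (y \<beta>) = 0"
    moreover have "det3 s (y \<beta>) u = dt (cr s (y \<beta>)) u" by (simp add: det3_def dt_def algebra_simps)
    ultimately have "det3 s w u = 0" by (simp add: y_def det3_lin)
    then show False using swu by simp
  qed
  define q where "q = [:tri F s w w / 2, tri F s w u, tri F s u u / 2:]"
  define g2 where "g2 = [:tri G s w w / 2, tri G s w u, tri G s u u / 2:]"
  define g1 where "g1 = [:tri G s s w / 2, tri G s s u / 2:]"
  obtain c where c: "degree c \<le> 3" "\<And>\<beta>. poly c \<beta> = tpoly_eval F (y \<beta>)"
    using restrict_to_line[OF F(1), of u w] unfolding y_def by blast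
  obtain g3 where g3: "degree g3 \<le> 3" "\<And>\<beta>. poly g3 \<beta> = tpoly_eval G (y \<beta>)"
    using restrict_to_line[OF G(1), of u w] unfolding y_def by blast
  have pq: "poly q \<beta> = tri F s (y \<beta>) (y \<beta>) / 2" for \<beta> unfolding q_def y_def by (rule quad)
  have pg2: "poly g2 \<beta> = tri G s (y \<beta>) (y \<beta>) / 2" for \<beta> unfolding g2_def y_def by (rule quad)
  have pg1: "poly g1 \<beta> = tri G s s (y \<beta>) / 2" for \<beta>
    by (simp add: g1_def y_def tri_lin add_divide_distrib)
  \<comment> \<open>On the line through \<open>s\<close> with parameter \<beta> the double point
    leaves \<open>F\<close> of degree at most 1 in \<open>g\<close>, and
    \<open>tpoly_eval G s = 0\<close> removes the cubic term from \<open>G\<close>.\<close>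
  have Fe: "tpoly_eval F (g *s s + y \<beta>) = g * poly q \<beta> + poly c \<beta>" for g \<beta>
    unfolding forms3_decompose[OF F(1)] pq c(2)
    using F(3) sing_at_eval[OF F(1,3)] by (simp add: sing_at_def)
  have Ge: "tpoly_eval G (g *s s + y \<beta>) = g\<^sup>2 * poly g1 \<beta> + g * poly g2 \<beta> + poly g3 \<beta>" for g \<beta>
    unfolding forms3_decompose[OF G(1)] pg1 pg2 g3(2) using G(2) by simp
  have dq: "degree q = 2" "q \<noteq> 0" using qu by (simp_all add: q_def)
  have dg: "degree g1 \<le> 1" "degree g2 \<le> 2" by (simp_all add: g1_def g2_def)
  have noroot: "poly c \<beta> \<noteq> 0" if "poly q \<beta> = 0" for \<beta>
    using no_line_tangent_cone[OF F sy] that by (auto simp: pq c(2))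
  have cop: "coprime q c" by (rule coprime_if_no_common_root[OF dq(2) noroot])
  have "\<exists>\<omega> g \<beta>. \<omega> \<noteq> 0 \<and> x = \<omega> *s (g *s s + y \<beta>)" if x: "x \<in> X" for x
  proof -
    obtain \<gamma> \<omega> \<upsilon> where e: "x = \<gamma> *s s + \<omega> *s w + \<upsilon> *s u" using basis_expand[OF swu] .
    have "det3 s x u = \<omega> * det3 s w u" unfolding e by (simp add: det3_lin)
    then have "\<omega> \<noteq> 0" using xu[OF x] by auto
    then have "x = \<omega> *s ((\<gamma> / \<omega>) *s s + y (\<upsilon> / \<omega>))"
      unfolding e y_def by (simp add: vector_add_ldistrib add_ac)
    then show ?thesis using \<open>\<omega> \<noteq> 0\<close> by blast
  qed
  then obtain \<omega> g \<beta> where xe: "\<And>x. x \<in> X \<Longrightarrow> \<omega> x \<noteq> 0 \<and> x = \<omega> x *s (g x *s s + y (\<beta> x))"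
    by metis
  have zF: "g x * poly q (\<beta> x) + poly c (\<beta> x) = 0" if "x \<in> X" for x
  proof -
    have "tpoly_eval F (\<omega> x *s (g x *s s + y (\<beta> x))) = 0"
      using X(4) xe[OF that] that by (metis vanishes_on_def)
    then have "\<omega> x ^ 3 * (g x * poly q (\<beta> x) + poly c (\<beta> x)) = 0"
      by (simp only: tpoly_eval_scale[OF F(1)] Fe)
    moreover have "\<omega> x ^ 3 \<noteq> 0" using xe[OF that] by simp
    ultimately show ?thesis by (simp only: mult_eq_0_iff) blast
  qed
  have zG: "(g x)\<^sup>2 * poly g1 (\<beta> x) + g x * poly g2 (\<beta> x) + poly g3 (\<beta> x) = 0" if "x \<in> X" for x
  proof -
    have "tpoly_eval G (\<omega> x *s (g x *s s + y (\<beta> x))) = 0"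
      using X(5) xe[OF that] that by (metis vanishes_on_def)
    then have "\<omega> x ^ 3 * ((g x)\<^sup>2 * poly g1 (\<beta> x) + g x * poly g2 (\<beta> x) + poly g3 (\<beta> x)) = 0"
      by (simp only: tpoly_eval_scale[OF G(1)] Ge)
    moreover have "\<omega> x ^ 3 \<noteq> 0" using xe[OF that] by simp
    ultimately show ?thesis by (simp only: mult_eq_0_iff) blast
  qed
  have qx: "poly q (\<beta> x) \<noteq> 0" if "x \<in> X" for x
    using zF[OF that] noroot[of "\<beta> x"] by auto
  \<comment> \<open>On each such line \<open>F\<close> has at most one zero of this form, where
    \<open>g\<close> is the quotient of \<open>- c\<close> by \<open>q\<close>; so points of
    \<open>X\<close> with equal parameter coincide.\<close>
  have inj: "inj_on \<beta> X"
  proof (rule inj_onI)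
    fix x x' assume xx: "x \<in> X" "x' \<in> X" "\<beta> x = \<beta> x'"
    have "(g x - g x') * poly q (\<beta> x) =
        (g x * poly q (\<beta> x) + poly c (\<beta> x)) - (g x' * poly q (\<beta> x') + poly c (\<beta> x'))"
      using xx(3) by (simp add: algebra_simps)
    then have "(g x - g x') * poly q (\<beta> x) = 0" using zF[OF xx(1)] zF[OF xx(2)] by simp
    then have "g x = g x'" using qx[OF xx(1)] by simp
    then have "cr x x' = cr (\<omega> x *s (g x *s s + y (\<beta> x))) (\<omega> x' *s (g x *s s + y (\<beta> x)))"
      using xe[OF xx(1)] xe[OF xx(2)] xx(3) by metis
    then have "cr x x' = 0" by (simp only: cr_scale cr_self vector_smult_rzero)
    then show "x = x'" using X(1) xx by (auto simp: distinct_points_def)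
  qed
  have roots: "r = 0" if r: "degree r < card X" "\<And>x. x \<in> X \<Longrightarrow> poly r (\<beta> x) = 0" for r
  proof (rule ccontr)
    assume "r \<noteq> 0"
    have "card X = card (\<beta> ` X)" using card_image[OF inj] by simp
    also have "\<dots> \<le> card {t. poly r t = 0}"
      using r(2) by (intro card_mono poly_roots_finite[OF \<open>r \<noteq> 0\<close>]) auto
    also have "\<dots> \<le> degree r" by (rule card_poly_roots_bound[OF \<open>r \<noteq> 0\<close>])
    finally show False using r(1) by simp
  qed
  define R where "R = g1 * c ^ 2 - g2 * c * q + g3 * q ^ 2"
  define R' where "R' = g3 * q - g2 * c"
  have R0: "poly R (\<beta> x) = 0" if "x \<in> X" for x
  proof -
    have "poly c (\<beta> x) = - (g x * poly q (\<beta> x))" using zF[OF that] by (simp add: eq_neg_iff_add_eq_0 add.commute)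
    then have "poly R (\<beta> x) = (poly q (\<beta> x))\<^sup>2 *
        ((g x)\<^sup>2 * poly g1 (\<beta> x) + g x * poly g2 (\<beta> x) + poly g3 (\<beta> x))"
      by (simp add: R_def poly_power algebra_simps power2_eq_square)
    then show ?thesis using zG[OF that] by simp
  qed
  have deg: "degree (p * r) \<le> m + n" if "degree p \<le> m" "degree r \<le> n" for p r :: "complex poly" and m n
    using degree_mult_le[of p r] that by linarith
  have dc2: "degree (c ^ 2) \<le> 6" and dq2: "degree (q ^ 2) \<le> 4"
    using deg[OF c(1) c(1)] deg[of q 2 q 2] dq(1) by (simp_all add: power2_eq_square)
  have dgc: "degree (g2 * c) \<le> 5" and dg3q: "degree (g3 * q) \<le> 5"
    using deg[OF dg(2) c(1)] deg[of g3 3 q 2] g3(1) dq(1) by simp_all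
  have "R = 0"
    using many
  proof
    assume "card X \<ge> 8"
    moreover have "degree R \<le> 7"
      unfolding R_def
      using deg[OF dg(1) dc2] deg[OF dgc, of q 2] dq(1) deg[OF g3(1) dq2]
      by (intro degree_add_le degree_diff_le) simp_all
    ultimately show "R = 0" by (intro roots R0) simp
  next
    assume s: "card X \<ge> 7 \<and> sing_at G s"
    then have "g1 = 0" by (simp add: g1_def sing_at_def)
    then have RR: "R = q * R'" by (simp add: R_def R'_def power2_eq_square algebra_simps)
    have "degree R' \<le> 5" unfolding R'_def using dgc dg3q by (intro degree_diff_le) simp_all
    moreover have "poly R' (\<beta> x) = 0" if "x \<in> X" for x
      using R0[OF that] qx[OF that] by (simp add: RR)
    ultimately have "R' = 0" using s by (intro roots) simp_all
    then show "R = 0" by (simp add: RR)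
  qed
  then have e1: "g1 * c ^ 2 = q * (g2 * c - g3 * q)" by (simp add: R_def algebra_simps power2_eq_square)
  \<comment> \<open>Since \<open>q\<close> is coprime to \<open>c\<close>, it divides
    \<open>g1\<close>, which is 0 by its degree; then \<open>q\<close> divides \<open>g2\<close>,
    and the pair \<open>g2\<close>, \<open>g3\<close> is a constant multiple of \<open>q\<close>,
    \<open>c\<close>.\<close>
  have "q dvd g1 * c ^ 2" unfolding e1 by simp
  moreover have "coprime q (c ^ 2)" using cop by (simp add: power2_eq_square)
  ultimately have "q dvd g1" by (simp only: coprime_dvd_mult_left_iff)
  then have g10: "g1 = 0" using dvd_imp_degree_le[of q g1] dq(1) dg(1) by fastforce
  then have e2: "g2 * c = g3 * q" using e1 dq(2) by simp
  then have "q dvd g2 * c" by simp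
  then have "q dvd g2" using cop by (simp only: coprime_dvd_mult_left_iff)
  then obtain h where h: "g2 = q * h" by (auto elim: dvdE)
  have "degree h = 0"
  proof (cases "h = 0")
    case False
    then have "degree g2 = 2 + degree h" using degree_mult_eq[OF dq(2) False] h dq(1) by simp
    then show ?thesis using dg(2) by simp
  qed simp
  then obtain k where k: "h = [:k:]" by (auto elim: degree_eq_zeroE)
  have "q * (g3 - smult k c) = 0" using e2 h k by (simp add: algebra_simps)
  then have g3k: "g3 = smult k c" using dq(2) by simp
  have g2k: "g2 = smult k q" using h k by simp
  have "G - smul k F = 0"
  proof (rule form_vanishes_if_open[OF _ swu])
    show "G - smul k F \<in> forms 3" by (intro forms_diff forms_smul F G)
    show "tpoly_eval (G - smul k F) (g *s s + (w + \<beta> *s u)) = 0" for g \<beta>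
      unfolding y_def[symmetric] tpoly_eval_diff tpoly_eval_smul Fe Ge g10 g2k g3k
      by (simp add: algebra_simps)
  qed
  then show ?thesis by auto
qed


section \<open>A pencil of singular cubics\<close>

lemma tendsto_tri:
  assumes "(x \<longlongrightarrow> a) \<F>" "(y \<longlongrightarrow> b) \<F>" "(z \<longlongrightarrow> c) \<F>"
  shows "((\<lambda>n. tri F (x n) (y n) (z n)) \<longlongrightarrow> tri F a b c) \<F>"
  unfolding tri_def by (intro tendsto_intros assms)

lemma tendsto_form3:
  assumes "F \<in> forms 3" "(x \<longlongrightarrow> a) \<F>"
  shows "((\<lambda>n. tpoly_eval F (x n)) \<longlongrightarrow> tpoly_eval F a) \<F>"
  unfolding eval_tri[OF assms(1)] by (intro tendsto_divide tendsto_tri assms(2) tendsto_const) simp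

lemma tendsto_smult_vec:
  fixes x :: "'a \<Rightarrow> complex ^ 3"
  assumes "(c \<longlongrightarrow> d) \<F>" "(x \<longlongrightarrow> a) \<F>"
  shows "((\<lambda>n. c n *s x n) \<longlongrightarrow> d *s a) \<F>"
  by (rule vec_tendstoI) (simp add: tendsto_mult tendsto_vec_nth assms)

lemma tendsto_cr:
  assumes "(x \<longlongrightarrow> a) \<F>"
  shows "((\<lambda>n. cr (x n) b) \<longlongrightarrow> cr a b) \<F>"
proof (rule vec_tendstoI)
  fix i :: 3
  show "((\<lambda>n. cr (x n) b $ i) \<longlongrightarrow> cr a b $ i) \<F>"
    using exhaust_3[of i] by (elim disjE; simp; intro tendsto_intros assms)
qed

lemma scaleR_eq_smult: "r *\<^sub>R x = complex_of_real r *s x" for x :: "complex ^ 3"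
  unfolding vec_eq_iff vector_scaleR_component vector_smult_component by (simp add: scaleR_conv_of_real)

lemma unit_subsequence:
  fixes x :: "nat \<Rightarrow> complex ^ 3"
  assumes "\<And>n. norm (x n) = 1"
  obtains l r where "norm l = 1" "strict_mono (r :: nat \<Rightarrow> nat)" "(x \<circ> r) \<longlonglongrightarrow> l"
proof -
  have "seq_compact (sphere (0 :: complex ^ 3) 1)"
    by (rule compact_imp_seq_compact) simp
  moreover have "\<forall>n. x n \<in> sphere 0 1" using assms by simp
  ultimately obtain l r where "l \<in> sphere 0 1" "strict_mono (r :: nat \<Rightarrow> nat)" "(x \<circ> r) \<longlonglongrightarrow> l"
    by (rule seq_compactE)
  then show thesis using that by simp
qed

lemma normalize_vec:
  fixes x :: "complex ^ 3"
  assumes "x \<noteq> 0"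
  obtains c :: complex where "c \<noteq> 0" "norm (c *s x) = 1"
proof (rule that)
  show "complex_of_real (inverse (norm x)) \<noteq> 0" using assms by simp
  show "norm (complex_of_real (inverse (norm x)) *s x) = 1"
    unfolding scaleR_eq_smult[symmetric] using assms by simp
qed

lemma sing_at_scale: "sing_at F x \<Longrightarrow> sing_at F (c *s x)"
  by (simp add: sing_at_def tri_lin)

lemma sing_at_unscale: "sing_at F (c *s x) \<Longrightarrow> c \<noteq> 0 \<Longrightarrow> sing_at F x"
  using sing_at_scale[of F "c *s x" "1 / c"] by simp

text \<open>A second singular point lies on the tangent cone at the first, so the line joining them
  would be part of the cubic.\<close>

lemma no_line_sing_unique:
  assumes F: "F \<in> forms 3" "no_line F" and s: "sing_at F s" "sing_at F x" "s \<noteq> 0"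
  obtains k where "x = k *s s"
proof (cases "cr s x = 0")
  case True
  then show thesis using s(3) that by (rule cr_eq_0D)
next
  case False
  have "tri F s x x = 0" using s(2) unfolding sing_at_def by (metis tri_rotate)
  then show thesis
    using no_line_tangent_cone[OF F s(1) False] sing_at_eval[OF F(1) s(2)] by blast
qed

text \<open>Let \<open>s + \<rho>\<^sub>n e\<^sub>n\<close>, with \<open>e\<^sub>n\<close> a unit vector, be the singular point of \<open>F + t\<^sub>n G\<close>. Eliminating
  \<open>t\<^sub>n\<close> shows that the derivative of \<open>F\<close> at this point is bounded by its value; the two leading orders
  in \<open>\<rho>\<^sub>n\<close> put the line spanned by \<open>s\<close> and \<open>lim e\<^sub>n\<close> into the cubic.\<close>

lemma base_point_if_singular_nearby_aux:
  assumes F: "F \<in> forms 3" "no_line F" "sing_at F s" and G: "G \<in> forms 3" "tpoly_eval G s \<noteq> 0"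
    and t: "\<And>n. t n \<noteq> 0"
    and z: "\<And>n. sing_at (F + smul (t n) G) (z n)" "z \<longlonglongrightarrow> s"
    and i: "s $ i \<noteq> 0" "\<And>n. z n $ i = s $ i" and Gz: "\<And>n. tpoly_eval G (z n) \<noteq> 0"
  shows False
proof -
  define v where "v n = z n - s" for n
  have zn: "z n = s + v n" for n by (simp add: v_def)
  have s0: "tri F s s h = 0" for h using F(3) by (simp add: sing_at_def)
  have dF: "2 * tri F s (v n) h + tri F (v n) (v n) h = - t n * tri G (z n) (z n) h" for n h
  proof -
    have "tri F (z n) (z n) h + t n * tri G (z n) (z n) h = 0"
      using z(1)[of n] by (simp add: sing_at_def tri_plus tri_smul)
    moreover have "tri F (z n) (z n) h = 2 * tri F s (v n) h + tri F (v n) (v n) h"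
      unfolding zn by (simp add: tri_lin s0 tri_swap12[of F "v n" s])
    ultimately show ?thesis by (simp add: eq_neg_iff_add_eq_0)
  qed
  have Fz: "tpoly_eval F (z n) = tri F s (v n) (v n) / 2 + tpoly_eval F (v n)" for n
    unfolding zn eval_tri_add[OF F(1)] using s0 sing_at_eval[OF F(1,3)] by simp
  have FG: "tpoly_eval F (z n) = - t n * tpoly_eval G (z n)" for n
  proof -
    have "tpoly_eval (F + smul (t n) G) (z n) = 0"
      by (rule sing_at_eval[OF _ z(1)]) (intro forms_add forms_smul F G)
    then show ?thesis by (simp add: eq_neg_iff_add_eq_0)
  qed
  have v0: "v n \<noteq> 0" for n
  proof
    assume "v n = 0"
    then have "tpoly_eval F (z n) = 0" unfolding Fz using tpoly_eval_scale[OF F(1), of 0 0] by simp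
    then show False using FG[of n] t[of n] Gz[of n] by simp
  qed
  define \<rho> where "\<rho> n = complex_of_real (norm (v n))" for n
  define e where "e n = (1 / \<rho> n) *s v n" for n
  have \<rho>0: "\<rho> n \<noteq> 0" for n using v0 by (simp add: \<rho>_def)
  have ve: "v n = \<rho> n *s e n" for n using \<rho>0 by (simp add: e_def)
  have "norm (e n) = 1" for n
  proof -
    have "e n = inverse (norm (v n)) *\<^sub>R v n"
      by (simp add: e_def \<rho>_def scaleR_eq_smult inverse_eq_divide)
    then show ?thesis using v0[of n] by simp
  qed
  then obtain l r where l: "norm l = 1" "strict_mono (r :: nat \<Rightarrow> nat)" "(e \<circ> r) \<longlonglongrightarrow> l"
    by (rule unit_subsequence)
  have er: "(\<lambda>n. e (r n)) \<longlonglongrightarrow> l" using l(3) by (simp add: o_def)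
  have zr: "(\<lambda>n. z (r n)) \<longlonglongrightarrow> s" using LIMSEQ_subseq_LIMSEQ[OF z(2) l(2)] by (simp add: o_def)
  have "(\<lambda>n. v (r n)) \<longlonglongrightarrow> s - s" unfolding v_def by (intro tendsto_diff zr tendsto_const)
  then have "(\<lambda>n. norm (v (r n))) \<longlonglongrightarrow> 0" using tendsto_norm by fastforce
  then have \<rho>r: "(\<lambda>n. \<rho> (r n)) \<longlonglongrightarrow> 0" unfolding \<rho>_def using tendsto_of_real by fastforce
  \<comment> \<open>At \<open>z n\<close> the derivative and the value of \<open>F\<close> are
    \<open>- t n\<close> times those of \<open>G\<close>. Dividing one by the other eliminates
    \<open>t n\<close>, and the quotient \<open>K\<close> converges along the subsequence because
    \<open>tpoly_eval G s \<noteq> 0\<close>.\<close>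
  define K where "K h n = tri G (z n) (z n) h / tpoly_eval G (z n)" for h n
  have Kr: "(\<lambda>n. K h (r n)) \<longlonglongrightarrow> tri G s s h / tpoly_eval G s" for h
    unfolding K_def by (intro tendsto_divide tendsto_tri tendsto_form3 G zr tendsto_const)
  have K: "2 * tri F s (v n) h + tri F (v n) (v n) h = K h n * tpoly_eval F (z n)" for n h
    unfolding dF FG K_def using Gz[of n] by simp
  have main: "2 * tri F s (e n) h + \<rho> n * tri F (e n) (e n) h =
      K h n * (\<rho> n * (tri F s (e n) (e n) / 2) + (\<rho> n)\<^sup>2 * tpoly_eval F (e n))" (is "?l = ?r") for n h
  proof -
    have "\<rho> n * ?l = \<rho> n * ?r"
      using K[of n h] unfolding Fz unfolding ve tpoly_eval_scale[OF F(1)] tri_lin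
      by (simp add: algebra_simps power2_eq_square power3_eq_cube)
    then show ?thesis using \<rho>0 by simp
  qed
  have cone1: "tri F s l h = 0" for h
  proof -
    have "(\<lambda>n. 2 * tri F s (e (r n)) h + \<rho> (r n) * tri F (e (r n)) (e (r n)) h) \<longlonglongrightarrow>
        2 * tri F s l h + 0 * tri F l l h"
      by (intro tendsto_add tendsto_mult tendsto_tri er \<rho>r tendsto_const)
    moreover have "(\<lambda>n. K h (r n) * (\<rho> (r n) * (tri F s (e (r n)) (e (r n)) / 2) + (\<rho> (r n))\<^sup>2 * tpoly_eval F (e (r n))))
        \<longlonglongrightarrow> tri G s s h / tpoly_eval G s * (0 * (tri F s l l / 2) + 0\<^sup>2 * tpoly_eval F l)"
      by (intro tendsto_add tendsto_mult tendsto_divide tendsto_power tendsto_tri tendsto_form3 F er \<rho>r Kr tendsto_const) simp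
    ultimately have "2 * tri F s l h + 0 * tri F l l h =
        tri G s s h / tpoly_eval G s * (0 * (tri F s l l / 2) + 0\<^sup>2 * tpoly_eval F l)"
      unfolding main by (rule LIMSEQ_unique)
    then show ?thesis by simp
  qed
  \<comment> \<open>For \<open>h = l\<close> the leading term of \<open>main\<close> is 0 by
    \<open>cone1\<close>, so a further factor \<open>\<rho> n\<close> can be cancelled.\<close>
  have main2: "tri F (e n) (e n) l = K l n * (tri F s (e n) (e n) / 2 + \<rho> n * tpoly_eval F (e n))" (is "?l = ?r") for n
  proof -
    have "tri F s (e n) l = 0" using cone1[of "e n"] by (metis tri_swap23)
    then have "\<rho> n * ?l = \<rho> n * ?r" using main[of n l] by (simp add: algebra_simps power2_eq_square)
    then show ?thesis using \<rho>0 by simp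
  qed
  have "(\<lambda>n. tri F (e (r n)) (e (r n)) l) \<longlonglongrightarrow> tri F l l l"
    by (intro tendsto_tri er tendsto_const)
  moreover have "(\<lambda>n. K l (r n) * (tri F s (e (r n)) (e (r n)) / 2 + \<rho> (r n) * tpoly_eval F (e (r n))))
      \<longlonglongrightarrow> tri G s s l / tpoly_eval G s * (tri F s l l / 2 + 0 * tpoly_eval F l)"
    by (intro tendsto_add tendsto_mult tendsto_divide tendsto_tri tendsto_form3 F er \<rho>r Kr tendsto_const) simp
  ultimately have "tri F l l l = tri G s s l / tpoly_eval G s * (tri F s l l / 2 + 0 * tpoly_eval F l)"
    unfolding main2 by (rule LIMSEQ_unique)
  then have cone2: "tpoly_eval F l = 0" by (simp add: cone1 eval_tri[OF F(1)])
  \<comment> \<open>All \<open>z n\<close> share the nonzero \<open>i\<close>-th coordinate of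
    \<open>s\<close>; so the limit direction \<open>l\<close> has \<open>i\<close>-th coordinate 0
    and is not proportional to \<open>s\<close>.\<close>
  have "e n $ i = 0" for n using i(2)[of n] by (simp add: e_def v_def)
  moreover have "(\<lambda>n. e (r n) $ i) \<longlonglongrightarrow> l $ i" by (intro tendsto_vec_nth er)
  ultimately have li: "l $ i = 0" by (simp add: LIMSEQ_const_iff)
  have "cr s l \<noteq> 0"
  proof
    assume "cr s l = 0"
    moreover have "s \<noteq> 0" using i(1) by auto
    ultimately obtain k where k: "l = k *s s" by (rule cr_eq_0D)
    then have "k = 0" using li i(1) by simp
    then show False using k l(1) by simp
  qed
  then show False using no_line_tangent_cone[OF F _ cone1 cone2] by blast
qed

text \<open>A limit of normalized singular points of the members \<open>F + smul (t n) G\<close> is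
  singular on \<open>F\<close>, hence proportional to \<open>s\<close> by uniqueness. Rescaling to a
  common \<open>i\<close>-th coordinate and dropping finitely many indices leads to the preceding
  lemma.\<close>

lemma base_point_if_singular_nearby:
  assumes F: "F \<in> forms 3" "no_line F" "sing_at F s" "s \<noteq> 0" and G: "G \<in> forms 3"
    and t: "\<And>n. t n \<noteq> 0" "t \<longlonglongrightarrow> 0"
    and x: "\<And>n. \<exists>x. x \<noteq> 0 \<and> sing_at (F + smul (t n) G) x"
  shows "tpoly_eval G s = 0"
proof (rule ccontr)
  assume G0: "tpoly_eval G s \<noteq> 0"
  have "\<exists>x. norm x = 1 \<and> sing_at (F + smul (t n) G) x" for n
    using x[of n] normalize_vec sing_at_scale by metis
  then obtain x where x: "\<And>n. norm (x n) = 1" "\<And>n. sing_at (F + smul (t n) G) (x n)" by metis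
  obtain l r where l: "norm l = 1" "strict_mono (r :: nat \<Rightarrow> nat)" "(x \<circ> r) \<longlonglongrightarrow> l"
    using unit_subsequence[OF x(1)] .
  have xr: "(\<lambda>n. x (r n)) \<longlonglongrightarrow> l" using l(3) by (simp add: o_def)
  have tr: "(\<lambda>n. t (r n)) \<longlonglongrightarrow> 0" using LIMSEQ_subseq_LIMSEQ[OF t(2) l(2)] by (simp add: o_def)
  have "sing_at F l"
    unfolding sing_at_def
  proof
    fix h
    have "(\<lambda>n. tri F (x (r n)) (x (r n)) h + t (r n) * tri G (x (r n)) (x (r n)) h) \<longlonglongrightarrow>
        tri F l l h + 0 * tri G l l h"
      by (intro tendsto_add tendsto_mult tendsto_tri xr tr tendsto_const)
    moreover have "tri F (x n) (x n) h + t n * tri G (x n) (x n) h = 0" for n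
      using x(2)[of n] by (simp add: sing_at_def tri_plus tri_smul)
    ultimately show "tri F l l h = 0" by (simp add: LIMSEQ_const_iff)
  qed
  then obtain k where k: "l = k *s s" using no_line_sing_unique[OF F(1,2,3) _ F(4)] by blast
  have "k \<noteq> 0" using k l(1) by auto
  obtain i where i: "s $ i \<noteq> 0" using F(4) by (auto simp: vec_eq_iff)
  have li: "l $ i \<noteq> 0" using k i \<open>k \<noteq> 0\<close> by simp
  define z where "z n = (s $ i / x (r n) $ i) *s x (r n)" for n
  have xi: "(\<lambda>n. x (r n) $ i) \<longlonglongrightarrow> l $ i" by (intro tendsto_vec_nth xr)
  have "z \<longlonglongrightarrow> (s $ i / l $ i) *s l"
    unfolding z_def by (intro tendsto_smult_vec tendsto_divide tendsto_const xi xr li)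
  moreover have "(s $ i / l $ i) *s l = s" using \<open>k \<noteq> 0\<close> i unfolding k by simp
  ultimately have zs: "z \<longlonglongrightarrow> s" by simp
  have "(\<lambda>n. tpoly_eval G (z n)) \<longlonglongrightarrow> tpoly_eval G s" by (intro tendsto_form3 G zs)
  then have "\<forall>\<^sub>F n in sequentially. tpoly_eval G (z n) \<noteq> 0"
    using G0 by (rule tendsto_imp_eventually_ne)
  moreover have "\<forall>\<^sub>F n in sequentially. x (r n) $ i \<noteq> 0"
    using xi li by (rule tendsto_imp_eventually_ne)
  ultimately have "\<forall>\<^sub>F n in sequentially. tpoly_eval G (z n) \<noteq> 0 \<and> x (r n) $ i \<noteq> 0"
    by (rule eventually_conj)
  then obtain N where N: "\<And>n. n \<ge> N \<Longrightarrow> tpoly_eval G (z n) \<noteq> 0 \<and> x (r n) $ i \<noteq> 0"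
    unfolding eventually_sequentially by blast
  show False
  proof (rule base_point_if_singular_nearby_aux[OF F(1-3) G G0])
    show "t (r (n + N)) \<noteq> 0" for n by (rule t(1))
    show "sing_at (F + smul (t (r (n + N))) G) (z (n + N))" for n
      unfolding z_def by (intro sing_at_scale x(2))
    show "(\<lambda>n. z (n + N)) \<longlonglongrightarrow> s" using zs by (rule LIMSEQ_ignore_initial_segment)
    show "s $ i \<noteq> 0" by (rule i)
    show "z (n + N) $ i = s $ i" for n using N[of "n + N"] by (simp add: z_def)
    show "tpoly_eval G (z (n + N)) \<noteq> 0" for n using N[of "n + N"] by simp
  qed
qed

text \<open>By compactness of the unit sphere, lines contained in members with \<open>t n\<close>
  tending to 0 accumulate at a line, which would be contained in \<open>F\<close>.\<close>

lemma no_line_open: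
  assumes F: "F \<in> forms 3" "no_line F" and G: "G \<in> forms 3"
  shows "\<exists>\<delta>>0. \<forall>t. norm t < \<delta> \<longrightarrow> no_line (F + smul t G)"
proof (rule ccontr)
  assume "\<not> ?thesis"
  then have "\<exists>t. norm t < \<delta> \<and> \<not> no_line (F + smul t G)" if "\<delta> > 0" for \<delta>
    using that by blast
  then have "\<exists>t. norm t < inverse (real (Suc n)) \<and> \<not> no_line (F + smul t G)" for n by simp
  then obtain t where t: "\<And>n. norm (t n) < inverse (real (Suc n))" "\<And>n. \<not> no_line (F + smul (t n) G)" by metis
  have t0: "t \<longlonglongrightarrow> 0"
    by (rule Lim_null_comparison[OF _ LIMSEQ_inverse_real_of_nat])
      (rule always_eventually, rule allI, rule less_imp_le, rule t(1))
  have "\<exists>a. norm a = 1 \<and> (\<forall>x. dt a x = 0 \<longrightarrow> tpoly_eval (F + smul (t n) G) x = 0)" for n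
  proof -
    obtain a where a: "a \<noteq> 0" "\<And>x. dt a x = 0 \<Longrightarrow> tpoly_eval (F + smul (t n) G) x = 0"
      using t(2)[of n] unfolding no_line_def by blast
    obtain c where c: "c \<noteq> 0" "norm (c *s a) = 1" using normalize_vec[OF a(1)] .
    show ?thesis by (rule exI[of _ "c *s a"]) (use a(2) c in \<open>auto simp: dt_lin\<close>)
  qed
  then obtain a where a: "\<And>n. norm (a n) = 1" "\<And>n x. dt (a n) x = 0 \<Longrightarrow> tpoly_eval (F + smul (t n) G) x = 0" by metis
  obtain l r where l: "norm l = 1" "strict_mono (r :: nat \<Rightarrow> nat)" "(a \<circ> r) \<longlonglongrightarrow> l"
    using unit_subsequence[OF a(1)] .
  have ar: "(\<lambda>n. a (r n)) \<longlonglongrightarrow> l" using l(3) by (simp add: o_def)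
  have tr: "(\<lambda>n. t (r n)) \<longlonglongrightarrow> 0" using LIMSEQ_subseq_LIMSEQ[OF t0 l(2)] by (simp add: o_def)
  \<comment> \<open>The vectors \<open>cr a y\<close> lie on the line \<open>a\<close> and depend
    continuously on \<open>a\<close>; for fixed \<open>a \<noteq> 0\<close> they exhaust the
    line.\<close>
  have Fl: "tpoly_eval F (cr l y) = 0" for y
  proof -
    have "(\<lambda>n. tpoly_eval F (cr (a (r n)) y) + t (r n) * tpoly_eval G (cr (a (r n)) y)) \<longlonglongrightarrow>
        tpoly_eval F (cr l y) + 0 * tpoly_eval G (cr l y)"
      by (intro tendsto_add tendsto_mult tendsto_form3 tendsto_cr F(1) G ar tr)
    moreover have "tpoly_eval F (cr (a n) y) + t n * tpoly_eval G (cr (a n) y) = 0" for n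
      using a(2)[of n "cr (a n) y"] by simp
    ultimately show ?thesis by (simp add: LIMSEQ_const_iff)
  qed
  have "l \<noteq> 0" using l(1) by auto
  then obtain x where x: "dt l x = 0" "tpoly_eval F x \<noteq> 0" using F(2) unfolding no_line_def by blast
  obtain j where "l $ j \<noteq> 0" using \<open>l \<noteq> 0\<close> by (auto simp: vec_eq_iff)
  then have w: "dt l ((1 / l $ j) *s axis j 1) = 1" by (simp add: dt_lin dt_axis)
  have "cr l (cr x ((1 / l $ j) *s axis j 1)) = x" unfolding cr_cr w x(1) by simp
  then show False using Fl x(2) by metis
qed

theorem singular_pencil_trivial:
  assumes P: "distinct_points P" "card P = 8"
    and F: "F \<in> forms 3" "no_line F" "vanishes_on F P" and G: "G \<in> forms 3" "vanishes_on G P"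
    and sing: "\<And>t. \<exists>x. x \<noteq> 0 \<and> sing_at (F + smul t G) x"
  shows "\<exists>k. G = smul k F"
proof (rule ccontr)
  assume nk: "\<not> ?thesis"
  have fin: "finite P" using P(2) by (simp add: card_ge_0_finite)
  obtain \<delta> where \<delta>: "\<delta> > 0" "\<And>t. norm t < \<delta> \<Longrightarrow> no_line (F + smul t G)"
    using no_line_open[OF F(1,2) G(1)] by blast
  have Ft: "F + smul t G \<in> forms 3" "vanishes_on (F + smul t G) P" for t
    using F(3) G(2) by (auto simp: vanishes_on_def intro!: forms_add forms_smul F(1) G(1))
  have "\<exists>p\<in>P. sing_at (F + smul t G) p" if t: "norm t < \<delta>" for t
  proof -
    let ?F = "F + smul t G"
    obtain x where x: "x \<noteq> 0" "sing_at ?F x" using sing by blast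
    have Gx: "tpoly_eval G x = 0"
    proof (rule base_point_if_singular_nearby[OF Ft(1) \<delta>(2)[OF t] x(2,1) G(1)])
      show "complex_of_real (inverse (real (Suc n))) \<noteq> 0" for n by (simp del: of_nat_Suc)
      show "(\<lambda>n. complex_of_real (inverse (real (Suc n)))) \<longlonglongrightarrow> 0"
        using tendsto_of_real[OF LIMSEQ_inverse_real_of_nat] by (simp only: of_real_0)
      show "\<exists>x. x \<noteq> 0 \<and> sing_at (?F + smul (complex_of_real (inverse (real (Suc n)))) G) x" for n
        using sing[of "t + complex_of_real (inverse (real (Suc n)))"] by (simp only: smul_add_left add.assoc)
    qed
    show ?thesis
    proof (cases "\<exists>p\<in>P. cr p x = 0")
      case True
      then obtain p where p: "p \<in> P" "cr p x = 0" by blast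
      have "p \<noteq> 0" using p(1) P(1) by (auto simp: distinct_points_def)
      then obtain k where k: "x = k *s p" using p(2) cr_eq_0D by metis
      then have "k \<noteq> 0" using x(1) by auto
      then have "sing_at ?F p" using x(2) unfolding k by (rule sing_at_unscale[rotated])
      then show ?thesis using p(1) by blast
    next
      case False
      then have dp: "distinct_points (insert x P)" by (intro distinct_points_insert P(1) x(1)) blast
      have xP: "x \<notin> P" using False by (metis cr_self)
      have "\<exists>k. G = smul k ?F"
        by (rule common_points_bound[OF Ft(1) \<delta>(2)[OF t] x(2) G(1) Gx dp xP fin Ft(2) G(2)]) (simp add: P(2))
      then obtain k where k: "G = smul k ?F" by blast
      \<comment> \<open>This would make \<open>G\<close> a multiple of \<open>F\<close>: the factor
        \<open>1 - k * t\<close> is nonzero, since otherwise \<open>smul k F = 0\<close> and so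
        \<open>k = 0\<close>.\<close>
      have e: "smul (1 - k * t) G = smul k F"
      proof (rule tpoly_eqI)
        fix y
        have "tpoly_eval G y = k * (tpoly_eval F y + t * tpoly_eval G y)"
          using arg_cong[OF k, of "\<lambda>H. tpoly_eval H y"] by simp
        then show "tpoly_eval (smul (1 - k * t) G) y = tpoly_eval (smul k F) y"
          by (simp add: algebra_simps)
      qed
      show ?thesis
      proof (cases "1 - k * t = 0")
        case True
        then have "smul k F = 0" using e by simp
        then have "k = 0" using no_line_neq_0[OF F(2)] by simp
        then show ?thesis using True by simp
      next
        case False
        have "G = smul (1 / (1 - k * t)) (smul (1 - k * t) G)" using False by simp
        also have "\<dots> = smul (k / (1 - k * t)) F" unfolding e by simp
        finally show ?thesis using nk by blast
      qed
    qed
  qed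
  then obtain f where f: "\<And>t. norm t < \<delta> \<Longrightarrow> f t \<in> P \<and> sing_at (F + smul t G) (f t)" by metis
  \<comment> \<open>Infinitely many parameters choose among eight points, so two members share a
    singular point.\<close>
  have inf: "infinite (ball (0 :: complex) \<delta>)"
    using uncountable_ball[OF \<delta>(1)] countable_finite by blast
  have "f ` ball 0 \<delta> \<subseteq> P" using f by auto
  then have "\<not> inj_on f (ball 0 \<delta>)" using inf fin finite_imageD finite_subset by metis
  then obtain t t' where tt: "norm t < \<delta>" "norm t' < \<delta>" "t \<noteq> t'" "f t = f t'" by (auto simp: inj_on_def)
  define p where "p = f t"
  have p: "p \<in> P" "sing_at (F + smul t G) p" "sing_at (F + smul t' G) p"
    using f[OF tt(1)] f[OF tt(2)] tt(4) by (simp_all add: p_def)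
  have sG: "sing_at G p"
    unfolding sing_at_def
  proof
    fix h
    have "tri F p p h + t * tri G p p h = 0" "tri F p p h + t' * tri G p p h = 0"
      using p(2,3) by (simp_all add: sing_at_def tri_plus tri_smul)
    then have "(t - t') * tri G p p h = 0" by algebra
    then show "tri G p p h = 0" using tt(3) by simp
  qed
  then have sF: "sing_at F p" using p(2) by (simp add: sing_at_def tri_plus tri_smul)
  have "\<exists>k. G = smul k F"
  proof (rule common_points_bound[OF F(1,2) sF G(1) sing_at_eval[OF G(1) sG]])
    show "distinct_points (insert p (P - {p}))" using P(1) p(1) by (simp add: insert_absorb)
    show "vanishes_on F (P - {p})" "vanishes_on G (P - {p})" using F(3) G(2) by (auto simp: vanishes_on_def)
    show "card (P - {p}) \<ge> 8 \<or> card (P - {p}) \<ge> 7 \<and> sing_at G p" using P(2) p(1) sG by simp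
  qed (use fin in auto)
  then show False using nk by blast
qed


section \<open>The discriminant on a pencil\<close>

text \<open>For \<open>degree p \<le> d\<close>, the binary form of degree \<open>d\<close> that
  becomes \<open>p\<close> at \<open>a = 1\<close>. Its value at \<open>(0, 1)\<close> is
  \<open>coeff p d\<close>, so a smaller degree of \<open>p\<close> records a zero there.\<close>

definition homogenize :: "complex poly \<Rightarrow> nat \<Rightarrow> complex \<Rightarrow> complex \<Rightarrow> complex" where
  "homogenize p d a b = (\<Sum>k\<le>d. coeff p k * a ^ (d - k) * b ^ k)"

lemma homogenize_neq_0:
  assumes "degree p \<le> d" "a \<noteq> 0"
  shows "homogenize p d a b = a ^ d * poly p (b / a)"
proof -
  have "poly p (b / a) = (\<Sum>k\<le>d. coeff p k * (b / a) ^ k)"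
    using assms(1) by (rule poly_as_sum_of_monoms'[THEN arg_cong[of _ _ "\<lambda>q. poly q (b / a)"], symmetric, unfolded poly_sum poly_monom])
  then have "a ^ d * poly p (b / a) = (\<Sum>k\<le>d. a ^ d * (coeff p k * (b / a) ^ k))"
    by (simp add: sum_distrib_left)
  also have "\<dots> = homogenize p d a b"
    unfolding homogenize_def
    by (intro sum.cong refl) (use assms(2) in \<open>simp add: power_divide power_diff\<close>)
  finally show ?thesis by simp
qed

lemma homogenize_0: "homogenize p d 0 b = coeff p d * b ^ d"
proof -
  have "homogenize p d 0 b = (\<Sum>k\<le>d. if k = d then coeff p d * b ^ d else 0)"
    unfolding homogenize_def by (intro sum.cong refl) (auto simp: power_0_left)
  then show ?thesis by simp
qed

lemma homogenize_1: "degree p \<le> d \<Longrightarrow> homogenize p d 1 t = poly p t"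
  by (simp add: homogenize_neq_0)

lemma homogenize_mult:
  assumes "degree p \<le> d" "degree q \<le> e"
  shows "homogenize (p * q) (d + e) a b = homogenize p d a b * homogenize q e a b"
proof (cases "a = 0")
  case True
  then show ?thesis using coeff_mult_top[OF assms] by (simp add: homogenize_0 power_add)
next
  case False
  have "degree (p * q) \<le> d + e" using degree_mult_le[of p q] assms by linarith
  then show ?thesis using False assms by (simp add: homogenize_neq_0 power_add)
qed

lemma homogenize_add: "homogenize (p + q) d a b = homogenize p d a b + homogenize q d a b"
  by (simp add: homogenize_def distrib_right sum.distrib)

lemma homogenize_smult: "homogenize (smult c p) d a b = c * homogenize p d a b"
  by (simp add: homogenize_def sum_distrib_left mult_ac)

definition binary_form :: "nat \<Rightarrow> (complex \<Rightarrow> complex \<Rightarrow> complex) \<Rightarrow> bool" where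
  "binary_form d f \<longleftrightarrow> (\<exists>p. degree p \<le> d \<and> (\<forall>a b. f a b = homogenize p d a b))"

lemma binary_form_mult: "binary_form d f \<Longrightarrow> binary_form e g \<Longrightarrow> binary_form (d + e) (\<lambda>a b. f a b * g a b)"
  unfolding binary_form_def
  by (metis homogenize_mult degree_mult_le add_mono order_trans)

lemma binary_form_add: "binary_form d f \<Longrightarrow> binary_form d g \<Longrightarrow> binary_form d (\<lambda>a b. f a b + g a b)"
  unfolding binary_form_def by (metis homogenize_add degree_add_le)

lemma binary_form_smult: "binary_form d f \<Longrightarrow> binary_form d (\<lambda>a b. c * f a b)"
  unfolding binary_form_def by (metis homogenize_smult degree_smult_le order_trans)

lemma binary_form_zero: "binary_form d (\<lambda>a b. 0)"
  unfolding binary_form_def by (intro exI[of _ 0]) (simp add: homogenize_def)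

lemma binary_form_sum:
  "(\<And>i. i \<in> A \<Longrightarrow> binary_form d (f i)) \<Longrightarrow> binary_form d (\<lambda>a b. \<Sum>i\<in>A. f i a b)"
  by (induction A rule: infinite_finite_induct) (simp_all add: binary_form_zero binary_form_add)

lemma binary_form_prod:
  "(\<And>i. i \<in> A \<Longrightarrow> binary_form (d i) (f i)) \<Longrightarrow> finite A \<Longrightarrow>
    binary_form (\<Sum>i\<in>A. d i) (\<lambda>a b. \<Prod>i\<in>A. f i a b)"
proof (induction A rule: infinite_finite_induct)
  case empty
  then show ?case unfolding binary_form_def by (intro exI[of _ 1]) (simp add: homogenize_def)
qed (simp_all add: binary_form_mult)

lemma binary_form_linear: "binary_form 1 (\<lambda>a b. a * x + b * y)"
  unfolding binary_form_def by (intro exI[of _ "[:x, y:]"]) (simp add: homogenize_def mult.commute)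

lemma binary_form_cubic:
  "binary_form 3 (\<lambda>a b. a ^ 3 * x + a\<^sup>2 * b * y + a * b\<^sup>2 * z + b ^ 3 * w)"
  unfolding binary_form_def
  by (intro exI[of _ "[:x, y, z, w:]"])
    (simp add: homogenize_def numeral_3_eq_3 algebra_simps power2_eq_square)

text \<open>Binary cubics in \<open>a\<close> and \<open>b\<close> with ternary polynomials as
  coefficients: the shape of the Hessian along a pencil.\<close>

definition cubic_family :: "(complex \<Rightarrow> complex \<Rightarrow> tpoly) \<Rightarrow> bool" where
  "cubic_family f \<longleftrightarrow> (\<exists>A B C D. \<forall>a b. f a b =
     smul (a ^ 3) A + smul (a\<^sup>2 * b) B + smul (a * b\<^sup>2) C + smul (b ^ 3) D)"

lemma cubic_family_add: 
  assumes "cubic_family f" "cubic_family g"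
  shows "cubic_family (\<lambda>a b. f a b + g a b)"
proof -
  obtain A B C D A' B' C' D' where "\<And>a b. f a b = smul (a ^ 3) A + smul (a\<^sup>2 * b) B + smul (a * b\<^sup>2) C + smul (b ^ 3) D"
    "\<And>a b. g a b = smul (a ^ 3) A' + smul (a\<^sup>2 * b) B' + smul (a * b\<^sup>2) C' + smul (b ^ 3) D'"
    using assms unfolding cubic_family_def by blast
  then show ?thesis unfolding cubic_family_def
    by (intro exI[of _ "A + A'"] exI[of _ "B + B'"] exI[of _ "C + C'"] exI[of _ "D + D'"]) (simp add: smul_add)
qed

lemma cubic_family_diff: 
  assumes "cubic_family f" "cubic_family g"
  shows "cubic_family (\<lambda>a b. f a b - g a b)"
proof -
  obtain A B C D A' B' C' D' where "\<And>a b. f a b = smul (a ^ 3) A + smul (a\<^sup>2 * b) B + smul (a * b\<^sup>2) C + smul (b ^ 3) D"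
    "\<And>a b. g a b = smul (a ^ 3) A' + smul (a\<^sup>2 * b) B' + smul (a * b\<^sup>2) C' + smul (b ^ 3) D'"
    using assms unfolding cubic_family_def by blast
  then show ?thesis unfolding cubic_family_def
    by (intro exI[of _ "A - A'"] exI[of _ "B - B'"] exI[of _ "C - C'"] exI[of _ "D - D'"]) (simp add: smul_diff)
qed

lemma cubic_family_product:
  "cubic_family (\<lambda>a b. (smul a A + smul b A') * (smul a B + smul b B') * (smul a C + smul b C'))"
  unfolding cubic_family_def
  by (intro exI[of _ "A * B * C"] exI[of _ "A * B * C' + A * B' * C + A' * B * C"]
      exI[of _ "A * B' * C' + A' * B * C' + A' * B' * C"] exI[of _ "A' * B' * C'"] allI tpoly_eqI)
    (simp add: algebra_simps power2_eq_square power3_eq_cube)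

lemma cubic_family_hessian: "cubic_family (\<lambda>a b. hessian (smul a F + smul b G))"
  unfolding hessian_def det_3 vec_lambda_beta pd_add pd_smul
  by (intro cubic_family_add cubic_family_diff cubic_family_product)

text \<open>Each term of the determinant takes one entry from every row; three rows are linear in
  \<open>a, b\<close> and the three rows from the Hessian are cubic.\<close>

lemma binary_form_discriminant: "binary_form 12 (\<lambda>a b. discriminant (smul a F + smul b G))"
proof -
  define e :: "complex \<Rightarrow> complex \<Rightarrow> 3 + 3 \<Rightarrow> 3 + 3 \<Rightarrow> complex"
    where "e a b r s = Poly_Mapping.lookup (disc_quadric (smul a F + smul b G) r) (quad_monom s)" for a b r s
  define d :: "3 + 3 \<Rightarrow> nat" where "d r = (case r of Inl _ \<Rightarrow> 1 | Inr _ \<Rightarrow> 3)" for r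
  have e: "binary_form (d r) (\<lambda>a b. e a b r s)" for r s
  proof (cases r)
    case (Inl i)
    then show ?thesis
      using binary_form_linear by (simp add: d_def e_def disc_quadric_def pd_add pd_smul lookup_add)
  next
    case (Inr i)
    obtain A B C D where "\<And>a b. hessian (smul a F + smul b G) =
        smul (a ^ 3) A + smul (a\<^sup>2 * b) B + smul (a * b\<^sup>2) C + smul (b ^ 3) D"
      using cubic_family_hessian unfolding cubic_family_def by blast
    then show ?thesis
      using Inr binary_form_cubic by (simp add: d_def e_def disc_quadric_def pd_add pd_smul lookup_add)
  qed
  have 12: "(\<Sum>r\<in>UNIV. d r) = 12" by (simp add: sum_UNIV_Plus d_def)
  have "binary_form 12 (\<lambda>a b. \<Prod>r\<in>UNIV. e a b r (\<pi> r))" for \<pi>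
    unfolding 12[symmetric] by (intro binary_form_prod e finite)
  then have "binary_form 12 (\<lambda>a b. \<Sum>\<pi> | \<pi> permutes UNIV. of_int (sign \<pi>) * (\<Prod>r\<in>UNIV. e a b r (\<pi> r)))"
    by (intro binary_form_sum binary_form_smult)
  moreover have "discriminant (smul a F + smul b G) =
      (\<Sum>\<pi> | \<pi> permutes UNIV. of_int (sign \<pi>) * (\<Prod>r\<in>UNIV. e a b r (\<pi> r)))" for a b
    by (simp add: discriminant_def det_def e_def disc_quadric_def)
  ultimately show ?thesis by (simp only:)
qed

section \<open>Orders of vanishing on a pencil\<close>

lemma homogenize_linear_power:
  "homogenize ([:- c, 1:] ^ n) n a b = (b - c * a) ^ n"
proof (induction n)
  case (Suc n)
  have "degree ([:- c, 1:] ^ n) \<le> n" using degree_coeff_power by blast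
  then have "homogenize ([:- c, 1:] * [:- c, 1:] ^ n) (1 + n) a b = homogenize [:- c, 1:] 1 a b * homogenize ([:- c, 1:] ^ n) n a b"
    by (intro homogenize_mult) simp_all
  moreover have "homogenize [:- c, 1:] 1 a b = b - c * a" by (simp add: homogenize_def)
  ultimately show ?case using Suc by simp
qed (simp add: homogenize_def)

text \<open>With \<open>p = [:- c, 1:] ^ n * p2\<close>, the first factor turns into the
  \<open>n\<close>-th power of \<open>t * (b - c * a)\<close>, while \<open>p2\<close> contributes a
  nonzero value at \<open>t = 0\<close>. This makes the order independent of the representatives
  that \<open>imult\<close> picks.\<close>

lemma order_along_line:
  assumes p: "degree p \<le> d" "p \<noteq> 0" and l: "l \<noteq> 0" and ab: "b - c * a \<noteq> 0"
  obtains q where "\<And>t. poly q t = homogenize p d (l + t * a) (l * c + t * b)" "order 0 q = order c p"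
proof -
  define n where "n = order c p"
  obtain p2 where p2: "p = [:- c, 1:] ^ n * p2" "\<not> [:- c, 1:] dvd p2"
    using order_decomp[OF p(2), of c] by (auto simp: n_def)
  have p20: "p2 \<noteq> 0" "poly p2 c \<noteq> 0" using p2 p(2) by (auto simp: poly_eq_0_iff_dvd)
  have "degree p = n + degree p2"
    using p2(1) p20(1) by (simp add: degree_mult_eq degree_power_eq)
  then have n: "n \<le> d" "degree p2 \<le> d - n" using p(1) by simp_all
  define q2 where "q2 = (\<Sum>k\<le>d - n. smult (coeff p2 k) ([:l, a:] ^ (d - n - k) * [:l * c, b:] ^ k))"
  define q where "q = [:0, 1:] ^ n * smult ((b - c * a) ^ n) q2"
  have q2: "poly q2 t = homogenize p2 (d - n) (l + t * a) (l * c + t * b)" for t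
    unfolding q2_def homogenize_def poly_sum
    by (intro sum.cong refl) (simp add: poly_power mult_ac)
  have "poly q t = homogenize p d (l + t * a) (l * c + t * b)" for t
  proof -
    have dl: "degree ([:- c, 1:] ^ n) \<le> n" using degree_coeff_power by blast
    have "homogenize p d (l + t * a) (l * c + t * b) = homogenize ([:- c, 1:] ^ n * p2) (n + (d - n)) (l + t * a) (l * c + t * b)"
      using n(1) by (simp add: p2(1))
    also have "\<dots> = (l * c + t * b - c * (l + t * a)) ^ n * homogenize p2 (d - n) (l + t * a) (l * c + t * b)"
      unfolding homogenize_mult[OF dl n(2)] homogenize_linear_power by simp
    also have "l * c + t * b - c * (l + t * a) = t * (b - c * a)" by (simp add: algebra_simps)
    finally show ?thesis by (simp add: q_def q2 poly_power power_mult_distrib)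
  qed
  moreover have "order 0 q = n"
  proof -
    have "poly q2 0 \<noteq> 0"
      using q2[of 0] homogenize_neq_0[OF n(2) l, of "l * c"] p20(2) l by simp
    then have o: "order 0 (smult ((b - c * a) ^ n) q2) = 0" using ab by (intro order_0I) simp
    have nz: "smult ((b - c * a) ^ n) q2 \<noteq> 0" using ab \<open>poly q2 0 \<noteq> 0\<close> by auto
    then have "q \<noteq> 0" by (simp add: q_def)
    then have "order 0 q = order 0 ([:0, 1::complex:] ^ n) + order 0 (smult ((b - c * a) ^ n) q2)"
      unfolding q_def by (rule order_mult)
    then show ?thesis using o order_power_n_n[of "0 :: complex" n] by simp
  qed
  ultimately show thesis unfolding n_def by (rule that)
qed

lemma pencil_poly_eqI:
  assumes "\<And>t. poly q t = \<Phi> (F + smul t G)"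
  shows "pencil_poly \<Phi> F G = q"
  unfolding pencil_poly_def
proof (rule the_equality)
  fix r assume "\<forall>t. poly r t = \<Phi> (F + smul t G)"
  then have "poly r = poly q" using assms by (simp add: fun_eq_iff)
  then show "r = q" by (simp only: poly_eq_poly_eq_iff)
qed (use assms in simp)

lemma sum_order_roots:
  fixes p :: "complex poly"
  assumes "p \<noteq> 0"
  shows "(\<Sum>z | poly p z = 0. order z p) = degree p"
proof -
  have fin: "finite {z. poly p z = 0}" by (rule poly_roots_finite[OF assms])
  have "degree p = degree (smult (lead_coeff p) (\<Prod>z | poly p z = 0. [:- z, 1:] ^ order z p))"
    by (simp only: complex_poly_decompose)
  also have "\<dots> = (\<Sum>z | poly p z = 0. degree ([:- z, 1:] ^ order z p))"
    using assms fin by (simp add: degree_prod_eq_sum_degree)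
  also have "\<dots> = (\<Sum>z | poly p z = 0. order z p)"
    by (intro sum.cong refl) (simp add: degree_power_eq)
  finally show ?thesis by simp
qed

subsection \<open>Classes of cubics\<close>

lemma self_in_class: "F \<in> cubic_class F"
  unfolding cubic_class_def by (intro CollectI exI[of _ 1]) simp

lemma cubic_class_smul: "c \<noteq> 0 \<Longrightarrow> cubic_class (smul c F) = cubic_class F"
proof -
  assume c: "c \<noteq> 0"
  have 1: "cubic_class (smul c F) \<subseteq> cubic_class F" if "c \<noteq> 0" for c F
  proof
    fix H assume "H \<in> cubic_class (smul c F)"
    then obtain d where "d \<noteq> 0" "H = smul (d * c) F" by (auto simp: cubic_class_def)
    then show "H \<in> cubic_class F" using that unfolding cubic_class_def by (intro CollectI exI[of _ "d * c"]) simp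
  qed
  have "cubic_class F = cubic_class (smul (1 / c) (smul c F))" using c by simp
  also have "\<dots> \<subseteq> cubic_class (smul c F)" using c by (intro 1) simp
  finally show ?thesis using 1[OF c, of F] by blast
qed

lemma in_class_iff: "G \<in> cubic_class F \<longleftrightarrow> (\<exists>c. c \<noteq> 0 \<and> G = smul c F)"
  by (auto simp: cubic_class_def)

lemma class_eq_iff: "cubic_class G = cubic_class F \<longleftrightarrow> (\<exists>c. c \<noteq> 0 \<and> G = smul c F)"
  using in_class_iff self_in_class cubic_class_smul by metis

lemma singular_form_smul: "F \<in> forms 3 \<Longrightarrow> c \<noteq> 0 \<Longrightarrow> singular_form (smul c F) \<longleftrightarrow> singular_form F"
  by (simp add: singular_form_iff forms_smul sing_at_def tri_smul)


section \<open>Special position\<close>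

lemma card_ge_imp_subset:
  assumes "card S \<ge> n"
  obtains T where "T \<subseteq> S" "card T = n"
  using obtain_subset_with_card_n[OF assms] by metis

lemma special_position_iff_reducible:
  assumes P: "distinct_points P" "card P = 8"
  shows "(\<exists>T\<subseteq>P. card T = 3 \<and> (\<exists>l\<in>forms 1. l \<noteq> 0 \<and> vanishes_on l T)) \<or>
      (\<exists>T\<subseteq>P. card T = 6 \<and> (\<exists>Q\<in>forms 2. irreducible Q \<and> vanishes_on Q T)) \<longleftrightarrow>
    (\<exists>F\<in>forms 3. F \<noteq> 0 \<and> \<not> irreducible F \<and> vanishes_on F P)" (is "?three \<or> ?six \<longleftrightarrow> ?red")
proof
  have fin: "finite P" using P(2) by (simp add: card_ge_0_finite)
  have prod: ?red if l: "l \<in> forms 1" "l \<noteq> 0" and Q: "Q \<in> forms 2" "Q \<noteq> 0"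
    and T: "vanishes_on l T \<and> vanishes_on Q (P - T) \<or> vanishes_on Q T \<and> vanishes_on l (P - T)" for l Q T
  proof (rule bexI[of _ "l * Q"])
    show "l * Q \<in> forms 3" using forms_mult[OF l(1) Q(1)] by (simp add: numeral_3_eq_3)
    have "\<not> irreducible (l * Q)" using line_mult_not_irreducible[OF l(1), of Q 1] Q(1) by (simp add: numeral_2_eq_2)
    then show "l * Q \<noteq> 0 \<and> \<not> irreducible (l * Q) \<and> vanishes_on (l * Q) P"
      using l(2) Q(2) T by (auto simp: vanishes_on_def)
  qed
  {
    assume "?three \<or> ?six"
    then show ?red
    proof
      assume ?three
      then obtain T l where T: "T \<subseteq> P" "card T = 3" "l \<in> forms 1" "l \<noteq> 0" "vanishes_on l T" by blast
      have "finite T" using T(1) fin by (rule finite_subset)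
      then have "card (P - T) \<le> 5" using T P(2) by (simp add: card_Diff_subset)
      then obtain Q where "Q \<in> forms 2" "Q \<noteq> 0" "\<And>x. x \<in> P - T \<Longrightarrow> tpoly_eval Q x = 0"
        using conic_through_five[of "P - T"] fin by blast
      then show ?red using prod[OF T(3,4), of Q T] T(5) by (auto simp: vanishes_on_def)
    next
      assume ?six
      then obtain T Q where T: "T \<subseteq> P" "card T = 6" "Q \<in> forms 2" "irreducible Q" "vanishes_on Q T" by blast
      have "finite T" using T(1) fin by (rule finite_subset)
      then have "card (P - T) = 2" using T P(2) by (simp add: card_Diff_subset)
      then obtain x y where xy: "P - T = {x, y}" "x \<noteq> y" by (auto simp: card_2_iff)
      have "cr x y \<noteq> 0" using xy P(1) by (auto simp: distinct_points_def)
      moreover have "vanishes_on (lf (cr x y)) (P - T)" by (auto simp: vanishes_on_def xy(1))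
      moreover have "Q \<noteq> 0" using T(4) by auto
      ultimately show ?red using prod[OF lf_forms[of "cr x y"] _ T(3), of T] T(5) by auto
    qed
  }
  assume ?red
  then obtain F where F: "F \<in> forms 3" "F \<noteq> 0" "\<not> irreducible F" "vanishes_on F P" by blast
  obtain l Q where lQ: "l \<in> forms 1" "Q \<in> forms 2" "F = l * Q" using reducible_cubic[OF F(1-3)] .
  have nz: "l \<noteq> 0" "Q \<noteq> 0" using F(2) lQ(3) by auto
  define A where "A = {x \<in> P. tpoly_eval l x = 0}"
  have finA: "finite A" "A \<subseteq> P" using fin by (auto simp: A_def)
  have three: ?three if B: "card B \<ge> 3" "B \<subseteq> P" "m \<in> forms 1" "m \<noteq> 0" "vanishes_on m B" for B m
  proof -
    obtain T where T: "T \<subseteq> B" "card T = 3" using card_ge_imp_subset[OF B(1)] .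
    then have "T \<subseteq> P" "vanishes_on m T" using B(2,5) by (auto simp: vanishes_on_def)
    then show ?thesis using T(2) B(3,4) by blast
  qed
  show "?three \<or> ?six"
  proof (cases "card A \<ge> 3")
    case True
    then show ?thesis using three[of A l] finA(2) lQ(1) nz(1) by (auto simp: A_def vanishes_on_def)
  next
    case False
    \<comment> \<open>With at most two points on the line, six others lie on \<open>Q\<close>; if
      \<open>Q\<close> is a pair of lines, one of them carries three of the six.\<close>
    then have "card (P - A) \<ge> 6" using card_Diff_subset[OF finA] P(2) by simp
    then obtain S where S: "S \<subseteq> P - A" "card S = 6" by (rule card_ge_imp_subset)
    have QS: "vanishes_on Q S"
      using S(1) F(4) unfolding vanishes_on_def lQ(3) by (auto simp: A_def)
    show ?thesis
    proof (cases "irreducible Q")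
      case True
      then show ?thesis using S QS lQ(2) by blast
    next
      case False
      obtain m m' where m: "m \<in> forms 1" "m' \<in> forms 1" "Q = m * m'"
        using reducible_conic[OF lQ(2) nz(2) False] .
      define B B' where "B = {x \<in> S. tpoly_eval m x = 0}" and "B' = {x \<in> S. tpoly_eval m' x = 0}"
      have "S = B \<union> B'" using QS unfolding vanishes_on_def m(3) by (auto simp: B_def B'_def)
      then have "6 \<le> card B + card B'" using card_Un_le[of B B'] S(2) by simp
      then consider "card B \<ge> 3" | "card B' \<ge> 3" by linarith
      then show ?thesis
      proof cases
        case 1
        then show ?thesis
          using three[of B m] S(1) m nz(2) by (auto simp: B_def vanishes_on_def)
      next
        case 2
        then show ?thesis
          using three[of B' m'] S(1) m nz(2) by (auto simp: B'_def vanishes_on_def)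
      qed
    qed
  qed
qed

section \<open>The linear system of cubics through eight points\<close>

definition cubic_system :: "(complex ^ 3) set \<Rightarrow> tpoly set" where
  "cubic_system P = {F \<in> forms 3. vanishes_on F P}"

lemma cubic_system_comb:
  "F \<in> cubic_system P \<Longrightarrow> G \<in> cubic_system P \<Longrightarrow> smul a F + smul b G \<in> cubic_system P"
  by (auto simp: cubic_system_def vanishes_on_def intro: forms_add forms_smul)

definition independent2 :: "tpoly \<Rightarrow> tpoly \<Rightarrow> bool" where
  "independent2 F G \<longleftrightarrow> (\<forall>a b. smul a F + smul b G = 0 \<longrightarrow> a = 0 \<and> b = 0)"

lemma exists_nonzero_value: "F \<noteq> 0 \<Longrightarrow> \<exists>x. tpoly_eval F x \<noteq> 0"
  using tpoly_eq_0 by blast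

text \<open>Nine points impose at most nine conditions on the ten coefficients of a cubic. The ninth
  point is taken off \<open>F\<close>, so the cubic found is not a multiple of
  \<open>F\<close>.\<close>

lemma exists_independent:
  assumes "F \<in> cubic_system P" "F \<noteq> 0" "finite P" "card P = 8"
  obtains G where "G \<in> cubic_system P" "independent2 F G"
proof -
  obtain x where x: "tpoly_eval F x \<noteq> 0" using exists_nonzero_value[OF assms(2)] by blast
  have "card (insert x P) \<le> 9" using card_insert_le_m1[of 9 P x] assms(4) by simp
  then obtain G where G: "G \<in> forms 3" "G \<noteq> 0" "\<And>y. y \<in> insert x P \<Longrightarrow> tpoly_eval G y = 0"
    using cubic_through_nine[of "insert x P"] assms(3) by blast
  have "independent2 F G"
    unfolding independent2_def
  proof (intro allI impI)
    fix a b assume e: "smul a F + smul b G = 0"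
    have "a * tpoly_eval F x + b * tpoly_eval G x = 0"
      using arg_cong[OF e, of "\<lambda>H. tpoly_eval H x"] by simp
    then have "a = 0" using G(3)[of x] x by simp
    then show "a = 0 \<and> b = 0" using e G(2) by simp
  qed
  then show thesis using that[of G] G by (auto simp: cubic_system_def vanishes_on_def)
qed

lemma cubic_system_nonzero:
  assumes "finite P" "card P = 8"
  obtains F where "F \<in> cubic_system P" "F \<noteq> 0"
proof (rule cubic_through_nine[OF assms(1)])
  show "card P \<le> 9" using assms(2) by simp
qed (auto intro: that simp: cubic_system_def vanishes_on_def)

lemma independent2_comb_neq_0: "independent2 F G \<Longrightarrow> a \<noteq> 0 \<or> b \<noteq> 0 \<Longrightarrow> smul a F + smul b G \<noteq> 0"
  by (auto simp: independent2_def)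

lemma independent2_comb_eq:
  assumes "independent2 F G" "smul a F + smul b G = smul a' F + smul b' G"
  shows "a = a' \<and> b = b'"
proof -
  have "smul (a - a') F + smul (b - b') G = (smul a F + smul b G) - (smul a' F + smul b' G)"
    by (rule tpoly_eqI) (simp add: algebra_simps)
  then have "smul (a - a') F + smul (b - b') G = 0" using assms(2) by simp
  then have "a - a' = 0 \<and> b - b' = 0" using assms(1) unfolding independent2_def by blast
  then show ?thesis by simp
qed

text \<open>\<open>G\<close> is the member at infinity of the parametrization
  \<open>F + smul t G\<close>. Taking it with nonzero discriminant, as
  \<open>singular_pencil_trivial\<close> permits, keeps every singular member at a finite
  parameter.\<close>

lemma pencil_basis:
  assumes P: "distinct_points P" "card P = 8"
    and F0: "F0 \<in> cubic_system P" "irreducible F0"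
  obtains F G where "F \<in> cubic_system P" "G \<in> cubic_system P" "independent2 F G"
    "discriminant G \<noteq> 0" "\<And>H. H \<in> cubic_system P \<Longrightarrow> \<exists>a b. H = smul a F + smul b G"
proof -
  have fin: "finite P" using P(2) by (simp add: card_ge_0_finite)
  have sys: "F \<in> cubic_system P \<longleftrightarrow> F \<in> forms 3 \<and> vanishes_on F P" for F by (simp add: cubic_system_def)
  have F0': "F0 \<in> forms 3" "vanishes_on F0 P" "no_line F0" "F0 \<noteq> 0"
    using F0 irreducible_imp_no_line by (auto simp: sys)
  obtain F where F: "F \<in> cubic_system P" "independent2 F0 F" using exists_independent[OF F0(1) F0'(4) fin P(2)] .
  have "\<not> (\<forall>t. \<exists>x. x \<noteq> 0 \<and> sing_at (F0 + smul t F) x)"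
  proof
    assume "\<forall>t. \<exists>x. x \<noteq> 0 \<and> sing_at (F0 + smul t F) x"
    then obtain k where "F = smul k F0"
      using singular_pencil_trivial[OF P F0'(1,3,2), of F] F(1) sys by blast
    then have "smul (- k) F0 + smul 1 F = 0" by (intro tpoly_eqI) simp
    then show False using F(2) unfolding independent2_def by (metis zero_neq_one)
  qed
  then obtain t where t: "\<not> (\<exists>x. x \<noteq> 0 \<and> sing_at (F0 + smul t F) x)" by blast
  define G where "G = F0 + smul t F"
  have G: "G \<in> cubic_system P" using cubic_system_comb[OF F0(1) F(1), of 1 t] by (simp add: G_def)
  then have dG: "discriminant G \<noteq> 0"
    using t discriminant_0_iff[of G] singular_form_iff[of G] by (simp add: sys G_def)
  have ind: "independent2 F G"
    unfolding independent2_def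
  proof (intro allI impI)
    fix a b assume e: "smul a F + smul b G = 0"
    have "smul b F0 + smul (a + b * t) F = smul a F + smul b G"
      unfolding G_def by (intro tpoly_eqI) (simp add: algebra_simps)
    then show "a = 0 \<and> b = 0" using e F(2) unfolding independent2_def by force
  qed
  have "\<exists>a b. H = smul a F + smul b G" if H: "H \<in> cubic_system P" for H
  proof -
    obtain k where k: "k \<noteq> 0" "comb3 F G H k = 0"
      using cubics_through_eight_dependent[OF P F0'(1) F0(2) F0'(2), of F G H] F(1) G H sys by blast
    have k3: "k $ 3 \<noteq> 0"
    proof
      assume 0: "k $ 3 = 0"
      then have "smul (k $ 1) F + smul (k $ 2) G = 0" using k(2) by (simp add: comb3_def)
      then have "k $ 1 = 0 \<and> k $ 2 = 0" using ind unfolding independent2_def by blast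
      then show False using k(1) 0 by (auto intro: vec3_eqI)
    qed
    have "H = smul (- k $ 1 / k $ 3) F + smul (- k $ 2 / k $ 3) G"
    proof (rule tpoly_eqI)
      fix x
      have "k $ 1 * tpoly_eval F x + k $ 2 * tpoly_eval G x + k $ 3 * tpoly_eval H x = 0"
        using arg_cong[OF k(2), of "\<lambda>H. tpoly_eval H x"] by (simp add: comb3_def)
      then have "k $ 3 * tpoly_eval H x = - k $ 1 * tpoly_eval F x - k $ 2 * tpoly_eval G x" by algebra
      then have "tpoly_eval H x = (- k $ 1 * tpoly_eval F x - k $ 2 * tpoly_eval G x) / k $ 3"
        using k3 by (simp add: eq_divide_eq mult.commute)
      then show "tpoly_eval H x = tpoly_eval (smul (- k $ 1 / k $ 3) F + smul (- k $ 2 / k $ 3) G) x"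
        by (simp add: diff_divide_distrib)
    qed
    then show ?thesis by blast
  qed
  then show thesis using that F(1) G ind dG by blast
qed

definition classes :: "(complex ^ 3) set \<Rightarrow> tpoly set set" where
  "classes P = {cubic_class F | F. F \<in> cubic_system P \<and> F \<noteq> 0}"

lemma class_singular_iff:
  assumes "F \<in> forms 3" "F \<noteq> 0"
  shows "cubic_class F \<in> singular_cubics \<longleftrightarrow> singular_form F"
proof
  assume "cubic_class F \<in> singular_cubics"
  then obtain G where "cubic_class F = cubic_class G" "G \<in> forms 3" "singular_form G"
    by (auto simp: singular_cubics_def)
  then show "singular_form F" using class_eq_iff singular_form_smul by metis
qed (use assms in \<open>auto simp: singular_cubics_def\<close>)

lemma class_rational_iff:
  assumes "F \<in> forms 3" "F \<noteq> 0"
  shows "cubic_class F \<in> rational_cubics \<longleftrightarrow> singular_form F \<and> irreducible F"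
proof
  assume "cubic_class F \<in> rational_cubics"
  then obtain G where "cubic_class F = cubic_class G" "G \<in> forms 3" "singular_form G" "irreducible G"
    by (auto simp: rational_cubics_def)
  then show "singular_form F \<and> irreducible F" using class_eq_iff singular_form_smul irreducible_smul by metis
qed (use assms in \<open>auto simp: rational_cubics_def\<close>)

lemma rational_subset_singular: "rational_cubics \<subseteq> singular_cubics"
  by (auto simp: rational_cubics_def singular_cubics_def)

lemma pencil_class_inj:
  assumes "independent2 F G" "cubic_class (F + smul t G) = cubic_class (F + smul t' G)"
  shows "t = t'"
proof -
  obtain c where "F + smul t G = smul c (F + smul t' G)" using assms(2) class_eq_iff by blast
  then have "smul 1 F + smul t G = smul c F + smul (c * t') G" by (simp add: smul_add)
  then have "1 = c \<and> t = c * t'" by (rule independent2_comb_eq[OF assms(1)])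
  then show ?thesis by simp
qed

text \<open>The definition of \<open>imult\<close> chooses arbitrary representatives
  \<open>F'\<close> and \<open>G'\<close>. They are written in the basis \<open>F\<close>,
  \<open>G\<close>, and \<open>order_along_line\<close> shows that the order is the same for all
  choices.\<close>

lemma imult_pencil:
  assumes F: "F \<in> cubic_system P" and G: "G \<in> cubic_system P" and ind: "independent2 F G"
    and span: "\<And>H. H \<in> cubic_system P \<Longrightarrow> \<exists>a b. H = smul a F + smul b G"
    and p: "degree p \<le> 12" "p \<noteq> 0" "\<And>a b. discriminant (smul a F + smul b G) = homogenize p 12 a b"
  shows "imult discriminant (classes P) (cubic_class (F + smul c G)) = order c p"
proof -
  define C where "C = cubic_class (F + smul c G)"
  define F' where "F' = (SOME F. F \<in> C)"
  define G' where "G' = (SOME G. G \<in> \<Union> (classes P - {C}))"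
  have "F' \<in> C" unfolding F'_def by (rule someI[of _ "F + smul c G"]) (simp add: C_def self_in_class)
  then obtain l where l: "l \<noteq> 0" "F' = smul l (F + smul c G)" by (auto simp: C_def in_class_iff)
  have G0: "G \<noteq> 0" using independent2_comb_neq_0[OF ind, of 0 1] by simp
  have "cubic_class G \<noteq> C"
  proof
    assume "cubic_class G = C"
    then obtain k where k: "k \<noteq> 0" "G = smul k (F + smul c G)" by (auto simp: C_def class_eq_iff)
    then have "smul 0 F + smul 1 G = smul k F + smul (k * c) G" by (simp add: smul_add)
    then show False using independent2_comb_eq[OF ind] k(1) by metis
  qed
  then have "G \<in> \<Union> (classes P - {C})"
    using G G0 self_in_class[of G] by (auto simp: classes_def)
  then have "G' \<in> \<Union> (classes P - {C})" unfolding G'_def by (rule someI)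
  then obtain H where H: "H \<in> cubic_system P" "H \<noteq> 0" "cubic_class H \<noteq> C" "G' \<in> cubic_class H"
    by (auto simp: classes_def)
  obtain k where k: "k \<noteq> 0" "G' = smul k H" using H(4) by (auto simp: in_class_iff)
  obtain a' b' where "H = smul a' F + smul b' G" using span[OF H(1)] by blast
  then have Hab: "G' = smul (k * a') F + smul (k * b') G" using k by (simp add: smul_add)
  define a b where "a = k * a'" and "b = k * b'"
  \<comment> \<open>Coordinates proportional to \<open>(1, c)\<close> would put \<open>G'\<close>
    into the class \<open>C\<close> that was excluded.\<close>
  have ab: "b - c * a \<noteq> 0"
  proof
    assume "b - c * a = 0"
    then have "b = a * c" by (simp add: mult.commute)
    then have Ga: "G' = smul a (F + smul c G)" using Hab unfolding a_def[symmetric] b_def[symmetric]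
      by (simp add: smul_add)
    have "a \<noteq> 0" using Ga k H(2) by auto
    then have "cubic_class G' = C" unfolding Ga C_def by (rule cubic_class_smul)
    moreover have "cubic_class G' = cubic_class H" unfolding k(2) by (rule cubic_class_smul[OF k(1)])
    ultimately show False using H(3) by simp
  qed
  obtain q where q: "\<And>t. poly q t = homogenize p 12 (l + t * a) (l * c + t * b)" "order 0 q = order c p"
    using order_along_line[OF p(1,2) l(1) ab] by blast
  have "pencil_poly discriminant F' G' = q"
  proof (rule pencil_poly_eqI)
    fix t
    have "F' + smul t G' = smul (l + t * a) F + smul (l * c + t * b) G"
      unfolding l(2) Hab a_def b_def by (rule tpoly_eqI) (simp add: algebra_simps)
    then show "poly q t = discriminant (F' + smul t G')" by (simp add: q(1) p(3))
  qed
  then show ?thesis using q(2) unfolding imult_def C_def[symmetric] F'_def[symmetric] G'_def[symmetric] by simp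
qed

text \<open>The coefficient of degree 12 of \<open>p\<close> is the discriminant of
  \<open>G\<close>. As it is nonzero, \<open>p\<close> has exact degree 12, and a singular member
  has a nonzero coefficient at \<open>F\<close>, which can be scaled to 1.\<close>

lemma pencil_discriminant:
  assumes P: "distinct_points P" "card P = 8"
    and F0: "F0 \<in> cubic_system P" "irreducible F0"
  obtains F G p where "F \<in> cubic_system P" "G \<in> cubic_system P" "independent2 F G"
    "degree p = 12"
    "classes P \<inter> singular_cubics = (\<lambda>t. cubic_class (F + smul t G)) ` {t. poly p t = 0}"
    "\<And>t. imult discriminant (classes P) (cubic_class (F + smul t G)) = order t p"
    "\<And>t. poly p t = 0 \<Longrightarrow> cubic_class (F + smul t G) \<in> rational_cubics \<longleftrightarrow> irreducible (F + smul t G)"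
proof -
  obtain F G where FG: "F \<in> cubic_system P" "G \<in> cubic_system P" "independent2 F G"
    "discriminant G \<noteq> 0" and span: "\<And>H. H \<in> cubic_system P \<Longrightarrow> \<exists>a b. H = smul a F + smul b G"
    using pencil_basis[OF P F0] by blast
  obtain p where p: "degree p \<le> 12" "\<And>a b. discriminant (smul a F + smul b G) = homogenize p 12 a b"
    using binary_form_discriminant unfolding binary_form_def by blast
  have "coeff p 12 = discriminant G" using p(2)[of 0 1] by (simp add: homogenize_0)
  then have c12: "coeff p 12 \<noteq> 0" using FG(4) by simp
  then have d12: "degree p = 12" using p(1) le_degree by fastforce
  have p0: "p \<noteq> 0" using c12 by auto
  have pt: "discriminant (F + smul t G) = poly p t" for t
    using p(2)[of 1 t] homogenize_1[OF p(1)] by simp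
  have mem: "F + smul t G \<in> forms 3" "F + smul t G \<in> cubic_system P" "F + smul t G \<noteq> 0" for t
    using cubic_system_comb[OF FG(1,2), of 1 t] independent2_comb_neq_0[OF FG(3), of 1 t]
    by (simp_all add: cubic_system_def)
  have sing: "singular_form (F + smul t G) \<longleftrightarrow> poly p t = 0" for t
    using discriminant_0_iff[OF mem(1)] pt by simp
  have "classes P \<inter> singular_cubics = (\<lambda>t. cubic_class (F + smul t G)) ` {t. poly p t = 0}"
  proof (intro equalityI subsetI)
    fix C assume C: "C \<in> classes P \<inter> singular_cubics"
    then obtain H where H: "C = cubic_class H" "H \<in> cubic_system P" "H \<noteq> 0" by (auto simp: classes_def)
    then have "singular_form H" using C class_singular_iff[of H] by (simp add: cubic_system_def)
    then have dH: "discriminant H = 0" using H(2) discriminant_0_iff[of H] by (simp add: cubic_system_def)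
    obtain a b where ab: "H = smul a F + smul b G" using span[OF H(2)] by blast
    have "a \<noteq> 0"
    proof
      assume "a = 0"
      then have "coeff p 12 * b ^ 12 = 0" using dH p(2)[of 0 b] ab by (simp add: homogenize_0)
      then have "b = 0" using c12 by simp
      then show False using \<open>a = 0\<close> ab H(3) by simp
    qed
    then have e: "H = smul a (F + smul (b / a) G)" unfolding ab by (simp add: smul_add)
    then have C': "C = cubic_class (F + smul (b / a) G)" using H(1) cubic_class_smul[OF \<open>a \<noteq> 0\<close>] by simp
    then have "singular_form (F + smul (b / a) G)" using C class_singular_iff[OF mem(1,3)] by simp
    then show "C \<in> (\<lambda>t. cubic_class (F + smul t G)) ` {t. poly p t = 0}" using C' sing by blast
  next
    fix C assume "C \<in> (\<lambda>t. cubic_class (F + smul t G)) ` {t. poly p t = 0}"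
    then obtain t where t: "poly p t = 0" "C = cubic_class (F + smul t G)" by blast
    then show "C \<in> classes P \<inter> singular_cubics"
      using class_singular_iff[OF mem(1,3)] sing mem by (auto simp: classes_def)
  qed
  moreover have "cubic_class (F + smul t G) \<in> rational_cubics \<longleftrightarrow> irreducible (F + smul t G)" if "poly p t = 0" for t
    using class_rational_iff[OF mem(1,3)] sing that by simp
  moreover have "imult discriminant (classes P) (cubic_class (F + smul t G)) = order t p" for t
    by (rule imult_pencil[OF FG(1-3) span p(1) p0 p(2)])
  ultimately show thesis using that[OF FG(1-3) d12] by blast
qed

section \<open>Counting\<close>

lemma infinite_if_all_reducible:
  assumes "finite P" "card P = 8"
    and "\<And>F. F \<in> cubic_system P \<Longrightarrow> F \<noteq> 0 \<Longrightarrow> \<not> irreducible F"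
  shows "infinite (classes P \<inter> singular_cubics)"
proof
  assume fin: "finite (classes P \<inter> singular_cubics)"
  obtain F where F: "F \<in> cubic_system P" "F \<noteq> 0" using cubic_system_nonzero[OF assms(1,2)] .
  obtain G where G: "G \<in> cubic_system P" "independent2 F G" using exists_independent[OF F assms(1,2)] .
  have "cubic_class (F + smul t G) \<in> classes P \<inter> singular_cubics" for t
  proof -
    have H: "F + smul t G \<in> cubic_system P" "F + smul t G \<noteq> 0"
      using cubic_system_comb[OF F(1) G(1), of 1 t] independent2_comb_neq_0[OF G(2), of 1 t] by simp_all
    then have "F + smul t G \<in> forms 3" by (simp add: cubic_system_def)
    then have "singular_form (F + smul t G)" using reducible_imp_singular assms(3)[OF H] H(2) by blast
    then show ?thesis
      using class_singular_iff[OF \<open>F + smul t G \<in> forms 3\<close> H(2)] H by (auto simp: classes_def)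
  qed
  then have "range (\<lambda>t. cubic_class (F + smul t G)) \<subseteq> classes P \<inter> singular_cubics" by blast
  then have "finite (range (\<lambda>t. cubic_class (F + smul t G)))" using fin by (rule finite_subset)
  moreover have "inj (\<lambda>t. cubic_class (F + smul t G))"
    using pencil_class_inj[OF G(2)] by (auto intro: injI)
  ultimately show False using finite_imageD infinite_UNIV_char_0 by blast
qed

text \<open>Singular classes correspond injectively to the roots of \<open>p\<close> and
  multiplicities to the orders of these roots, which are positive and add up to the degree.\<close>

lemma counting:
  assumes P: "distinct_points P" "card P = 8"
    and F0: "F0 \<in> cubic_system P" "irreducible F0"
  defines "L \<equiv> classes P"
  shows "finite (L \<inter> singular_cubics)"
    and "(\<Sum>C\<in>L \<inter> singular_cubics. imult discriminant L C) = 12"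
    and "C \<in> L \<inter> singular_cubics \<Longrightarrow> imult discriminant L C > 0"
proof -
  obtain F G p where FG: "independent2 F G" "degree p = 12"
    "L \<inter> singular_cubics = (\<lambda>t. cubic_class (F + smul t G)) ` {t. poly p t = 0}"
    "\<And>t. imult discriminant L (cubic_class (F + smul t G)) = order t p"
    using pencil_discriminant[OF P F0] unfolding L_def by metis
  have p0: "p \<noteq> 0" using FG(2) by auto
  show "finite (L \<inter> singular_cubics)"
    unfolding FG(3) using poly_roots_finite[OF p0] by (rule finite_imageI)
  have inj: "inj_on (\<lambda>t. cubic_class (F + smul t G)) {t. poly p t = 0}"
    using pencil_class_inj[OF FG(1)] by (auto intro: inj_onI)
  show "(\<Sum>C\<in>L \<inter> singular_cubics. imult discriminant L C) = 12"
    unfolding FG(3) sum.reindex[OF inj] o_def FG(4) sum_order_roots[OF p0] by (rule FG(2))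
  assume "C \<in> L \<inter> singular_cubics"
  then obtain t where t: "poly p t = 0" "C = cubic_class (F + smul t G)" unfolding FG(3) by blast
  then have "order t p \<noteq> 0" using p0 by (simp add: order_root)
  then show "imult discriminant L C > 0" unfolding t(2) FG(4) by simp
qed


section \<open>Projective points and their representatives\<close>

lemma point_representatives:
  fixes p :: "nat \<Rightarrow> (complex ^ 3) set"
  assumes "\<forall>i\<in>I. p i \<in> plane_points" "inj_on p I"
  obtains v where "inj_on v I" "distinct_points (v ` I)"
    "\<And>i F d. i \<in> I \<Longrightarrow> F \<in> forms d \<Longrightarrow> vanishes_at F (p i) \<longleftrightarrow> tpoly_eval F (v i) = 0"
proof -
  have "\<forall>i\<in>I. \<exists>w. w \<noteq> 0 \<and> p i = {c *s w | c. c \<noteq> 0}"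
  proof
    fix i assume "i \<in> I"
    then have "p i \<in> plane_points" using assms(1) by blast
    then show "\<exists>w. w \<noteq> 0 \<and> p i = {c *s w | c. c \<noteq> 0}"
      unfolding plane_points_def by (elim CollectE exE conjE) (intro exI conjI)
  qed
  from bchoice[OF this] obtain v
    where v': "\<forall>i\<in>I. v i \<noteq> 0 \<and> p i = {c *s v i | c. c \<noteq> 0}" ..
  note v = bspec[OF v', THEN conjunct1] bspec[OF v', THEN conjunct2]
  have sub: "p i \<subseteq> p j" if ij: "i \<in> I" "j \<in> I" "v i = k *s v j" "k \<noteq> 0" for i j k
  proof
    fix x assume "x \<in> p i"
    then obtain c where "c \<noteq> 0" "x = (c * k) *s v j" using v(2)[OF ij(1)] ij(3) by auto
    then show "x \<in> p j" unfolding v(2)[OF ij(2)] using ij(4) by (intro CollectI exI[of _ "c * k"]) simp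
  qed
  have cr: "cr (v i) (v j) \<noteq> 0" if ij: "i \<in> I" "j \<in> I" "i \<noteq> j" for i j
  proof
    assume "cr (v i) (v j) = 0"
    then obtain k where k: "v j = k *s v i" using v(1)[OF ij(1)] by (rule cr_eq_0D)
    then have k0: "k \<noteq> 0" using v(1)[OF ij(2)] by auto
    have "v i = (1 / k) *s v j" using k k0 by simp
    then have "p i \<subseteq> p j" using sub[OF ij(1,2), of "1 / k"] k0 by simp
    moreover have "p j \<subseteq> p i" using sub[OF ij(2,1) k k0] .
    ultimately show False using assms(2) ij by (auto simp: inj_on_def)
  qed
  have inj: "inj_on v I"
  proof (rule inj_onI, rule ccontr)
    fix i j assume "i \<in> I" "j \<in> I" "v i = v j" "i \<noteq> j"
    then show False using cr[of i j] by simp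
  qed
  moreover have "distinct_points (v ` I)"
    unfolding distinct_points_def
  proof (intro conjI ballI impI)
    show "0 \<notin> v ` I" using v(1) by force
    fix x y assume "x \<in> v ` I" "y \<in> v ` I" "x \<noteq> y"
    then obtain i j where ij: "i \<in> I" "j \<in> I" "x = v i" "y = v j" by blast
    then have "i \<noteq> j" using \<open>x \<noteq> y\<close> by auto
    then show "cr x y \<noteq> 0" unfolding ij(3,4) by (rule cr[OF ij(1,2)])
  qed
  moreover have "vanishes_at F (p i) \<longleftrightarrow> tpoly_eval F (v i) = 0" if "i \<in> I" "F \<in> forms d" for i F d
  proof
    assume "vanishes_at F (p i)"
    then have "tpoly_eval F (1 *s v i) = 0"
      unfolding vanishes_at_def v(2)[OF that(1)] by (metis (mono_tags, lifting) mem_Collect_eq zero_neq_one)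
    then show "tpoly_eval F (v i) = 0" by simp
  next
    assume "tpoly_eval F (v i) = 0"
    then show "vanishes_at F (p i)"
      unfolding vanishes_at_def v(2)[OF that(1)] by (auto simp: tpoly_eval_scale[OF that(2)])
  qed
  ultimately show thesis by (rule that)
qed

lemma ex_subset_image_iff:
  assumes "inj_on v I"
  shows "(\<exists>J\<subseteq>I. card J = n \<and> \<Phi> (v ` J)) \<longleftrightarrow> (\<exists>T\<subseteq>v ` I. card T = n \<and> \<Phi> T)"
proof
  assume "\<exists>J\<subseteq>I. card J = n \<and> \<Phi> (v ` J)"
  then obtain J where J: "J \<subseteq> I" "card J = n" "\<Phi> (v ` J)" by blast
  have "card (v ` J) = n" using card_image[OF inj_on_subset[OF assms J(1)]] J(2) by simp
  then show "\<exists>T\<subseteq>v ` I. card T = n \<and> \<Phi> T" using J(1,3) by blast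
next
  assume "\<exists>T\<subseteq>v ` I. card T = n \<and> \<Phi> T"
  then obtain T where T: "T \<subseteq> v ` I" "card T = n" "\<Phi> T" by blast
  obtain J where J: "J \<subseteq> I" "T = v ` J" using T(1) by (meson subset_image_iff)
  have "card J = n" using card_image[OF inj_on_subset[OF assms J(1)]] T(2) J(2) by simp
  then show "\<exists>J\<subseteq>I. card J = n \<and> \<Phi> (v ` J)" using J T(3) by blast
qed

theorem theorem2p5:
  fixes p :: "nat \<Rightarrow> (complex ^ 3) set"
  assumes "\<forall>i\<in>{1..8}. p i \<in> plane_points"
    and "inj_on p {1..8}"
  shows "((three_on_line p \<or> six_on_conic p) \<longleftrightarrow> reducible_cubic_through p)
       \<and> (reducible_cubic_through p \<longleftrightarrow> r_mult p > 0)
       \<and> (reducible_cubic_through p \<longleftrightarrow>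
            cubics_through p \<inter> rational_cubics \<subset> cubics_through p \<inter> singular_cubics)
       \<and> (reducible_cubic_through p \<longleftrightarrow> d_mult p < 12)"
proof -
  obtain v where v: "inj_on v {1..8}" "distinct_points (v ` {1..8})"
    and van: "\<And>i F d. i \<in> {1..8} \<Longrightarrow> F \<in> forms d \<Longrightarrow> vanishes_at F (p i) \<longleftrightarrow> tpoly_eval F (v i) = 0"
    using point_representatives[OF assms] by blast
  define P where "P = v ` {1..8}"
  have P: "distinct_points P" "card P = 8" "finite P"
    using v card_image[OF v(1)] by (simp_all add: P_def)
  have vanI: "(\<forall>i\<in>J. vanishes_at F (p i)) \<longleftrightarrow> vanishes_on F (v ` J)" if J: "J \<subseteq> {1..8}" "F \<in> forms d" for J F d
  proof -
    have "vanishes_at F (p i) \<longleftrightarrow> tpoly_eval F (v i) = 0" if "i \<in> J" for i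
      by (rule van[OF subsetD[OF J(1) that] J(2)])
    then show ?thesis by (simp add: vanishes_on_def)
  qed
  have three: "three_on_line p \<longleftrightarrow> (\<exists>T\<subseteq>P. card T = 3 \<and> (\<exists>l\<in>forms 1. l \<noteq> 0 \<and> vanishes_on l T))"
    unfolding P_def ex_subset_image_iff[OF v(1), symmetric] three_on_line_def
    using vanI[where d = 1] by (intro ex_cong1 conj_cong refl bex_cong) blast
  have six: "six_on_conic p \<longleftrightarrow> (\<exists>T\<subseteq>P. card T = 6 \<and> (\<exists>Q\<in>forms 2. irreducible Q \<and> vanishes_on Q T))"
    unfolding P_def ex_subset_image_iff[OF v(1), symmetric] six_on_conic_def
    using vanI[where d = 2] by (intro ex_cong1 conj_cong refl bex_cong) blast
  have van3: "(\<forall>i\<in>{1..8}. vanishes_at F (p i)) \<longleftrightarrow> vanishes_on F P" if "F \<in> forms 3" for F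
    unfolding P_def by (rule vanI[OF order_refl that])
  have red: "reducible_cubic_through p \<longleftrightarrow> (\<exists>F\<in>cubic_system P. F \<noteq> 0 \<and> \<not> irreducible F)"
    unfolding reducible_cubic_through_def cubic_system_def using van3 by blast
  define L where "L = cubics_through p"
  have L: "L = classes P"
    unfolding L_def cubics_through_def classes_def cubic_system_def using van3 by blast
  let ?S = "L \<inter> singular_cubics" and ?R = "L \<inter> rational_cubics"
  have RS: "?R \<subseteq> ?S" using rational_subset_singular by blast
  have diff: "?S - rational_cubics = ?S - ?R" by blast
  have strict: "reducible_cubic_through p \<longleftrightarrow> ?S - ?R \<noteq> {}"
  proof
    assume "reducible_cubic_through p"
    then obtain F where F: "F \<in> cubic_system P" "F \<noteq> 0" "\<not> irreducible F" using red by blast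
    then have F3: "F \<in> forms 3" by (simp add: cubic_system_def)
    have "cubic_class F \<in> L" using F(1,2) unfolding L classes_def by blast
    moreover have "cubic_class F \<in> singular_cubics"
      using class_singular_iff[OF F3 F(2)] reducible_imp_singular[OF F3 F(2,3)] by simp
    moreover have "cubic_class F \<notin> rational_cubics" using class_rational_iff[OF F3 F(2)] F(3) by simp
    ultimately show "?S - ?R \<noteq> {}" by blast
  next
    assume "?S - ?R \<noteq> {}"
    then obtain C where C: "C \<in> L" "C \<in> singular_cubics" "C \<notin> rational_cubics" by blast
    then obtain F where F: "C = cubic_class F" "F \<in> cubic_system P" "F \<noteq> 0" unfolding L classes_def by blast
    then have F3: "F \<in> forms 3" by (simp add: cubic_system_def)
    have "\<not> irreducible F"
      using C(2,3) class_singular_iff[OF F3 F(3)] class_rational_iff[OF F3 F(3)] unfolding F(1) by blast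
    then show "reducible_cubic_through p" using red F(2,3) by blast
  qed
  let ?m = "imult discriminant L"
  have d: "d_mult p = sum ?m ?R" by (simp add: d_mult_def L_def)
  have r: "r_mult p = (if finite ?S then enat (sum ?m (?S - ?R)) else \<infinity>)"
    unfolding r_mult_def L_def[symmetric] diff ..
  \<comment> \<open>With an irreducible member, \<open>r_mult\<close> is finite,
    \<open>r_mult\<close> and \<open>d_mult\<close> add up to 12, and \<open>r_mult\<close> is a sum
    of positive terms over the reducible members. Without one, \<open>r_mult\<close> is infinite and
    \<open>d_mult\<close> is an empty sum.\<close>
  have dr: "(reducible_cubic_through p \<longleftrightarrow> r_mult p > 0) \<and> (reducible_cubic_through p \<longleftrightarrow> d_mult p < 12)"
  proof (cases "\<exists>F0\<in>cubic_system P. irreducible F0")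
    case True
    then obtain F0 where F0: "F0 \<in> cubic_system P" "irreducible F0" by blast
    have fin: "finite ?S" and s12: "sum ?m ?S = 12" and pos: "\<And>C. C \<in> ?S \<Longrightarrow> ?m C > 0"
      using counting[OF P(1,2) F0] unfolding L by blast+
    have split: "sum ?m (?S - ?R) + sum ?m ?R = 12"
      using sum.subset_diff[OF RS fin, of ?m] s12 by simp
    have "finite (?S - ?R)" using fin by simp
    then have z0: "sum ?m (?S - ?R) = 0 \<longleftrightarrow> (\<forall>C\<in>?S - ?R. ?m C = 0)" by (rule sum_eq_0_iff)
    have z1: "(\<forall>C\<in>?S - ?R. ?m C = 0) \<longleftrightarrow> ?S - ?R = {}"
    proof
      assume z: "\<forall>C\<in>?S - ?R. ?m C = 0"
      show "?S - ?R = {}"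
      proof (rule equals0I)
        fix C assume C: "C \<in> ?S - ?R"
        then show False using pos[of C] z by simp
      qed
    next
      assume "?S - ?R = {}"
      then show "\<forall>C\<in>?S - ?R. ?m C = 0" by blast
    qed
    have e: "reducible_cubic_through p \<longleftrightarrow> 0 < sum ?m (?S - ?R)"
      unfolding strict z1[symmetric] z0[symmetric] by (rule neq0_conv)
    have "r_mult p = enat (sum ?m (?S - ?R))" unfolding r by (simp only: fin if_True)
    then have "r_mult p > 0 \<longleftrightarrow> 0 < sum ?m (?S - ?R)" by (simp add: zero_enat_def)
    moreover have "d_mult p < 12 \<longleftrightarrow> 0 < sum ?m (?S - ?R)" unfolding d using split by linarith
    ultimately show ?thesis unfolding e by blast
  next
    case False
    have all: "\<not> irreducible F" if "F \<in> cubic_system P" for F using that False by blast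
    obtain F where "F \<in> cubic_system P" "F \<noteq> 0" using cubic_system_nonzero[OF P(3,2)] .
    then have "reducible_cubic_through p" using red all by blast
    moreover have "infinite ?S" using infinite_if_all_reducible[OF P(3,2) all] unfolding L by blast
    moreover have "?R = {}"
    proof (rule ccontr)
      assume "?R \<noteq> {}"
      then obtain F where "F \<in> cubic_system P" "F \<noteq> 0" "cubic_class F \<in> rational_cubics"
        unfolding L classes_def by blast
      then show False using class_rational_iff[of F] all by (auto simp: cubic_system_def)
    qed
    ultimately show ?thesis by (simp add: d r)
  qed
  have special: "three_on_line p \<or> six_on_conic p \<longleftrightarrow> reducible_cubic_through p"
    unfolding three six special_position_iff_reducible[OF P(1,2)] red cubic_system_def by blast
  have "?R \<subset> ?S \<longleftrightarrow> ?S - ?R \<noteq> {}" using RS by blast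
  then show ?thesis using special dr strict unfolding L_def by blast
qed

end
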